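(* Let $H_1,H_2\in(0,1)\setminus\{\frac12\}$ with $H=H_1+H_2<\frac32$, $H\ne1$, and let $Y=(Y^1,Y^2)$ be the bivariate fractional Ornstein–Uhlenbeck process. Let $(\Delta_n)$ be a sequence of positive numbers such that, as $n\to+\infty$, $\Delta_n\to0$, $n\Delta_n\to+\infty$, $n\Delta_n^2\to0$ and $n\Delta_n^{4-2H}\to0$, and let $$\tilde\rho_n=\frac1{\nu_1\nu_2n\Delta_n^H}\sum_{k=0}^{n-1}\big(Y^1_{(k+1)\Delta_n}-Y^1_{k\Delta_n}\big)\big(Y^2_{(k+1)\Delta_n}-Y^2_{k\Delta_n}\big).$$ Let $\sigma^2=\lim_{n\to+\infty}\mathrm{Var}(\sqrt n(\tilde\rho_n-\rho))$. Then $$\sqrt n(\tilde\rho_n-\rho)\xrightarrow{d}\mathcal N(0,\sigma^2).$$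
   Context: Bivariate fractional Brownian motion ($H=H_1+H_2\ne1$). $(B^{H_1}_t,B^{H_2}_t)_{t\in\mathbb R}$ is a centered Gaussian process such that each $B^{H_i}$ is a fractional Brownian motion on $\mathbb R$ with Hurst index $H_i$, $\mathrm{Var}(B^{H_i}_1)=1$, and for $i\ne j$ $$\mathbb E[B^{H_i}_tB^{H_j}_s]=\tfrac12\big((\rho+\mathrm{sign}(t)\eta_{ij})|t|^H+(\rho-\mathrm{sign}(s)\eta_{ij})|s|^H-(\rho-\mathrm{sign}(s-t)\eta_{ij})|s-t|^H\big),$$ with $\mathrm{sign}(x)=1$ for $x\ge0$, $-1$ for $x<0$; $\rho\in[-1,1]$ and $\eta_{12}=-\eta_{21}\in\mathbb R$ are such that this is a valid covariance. Bivariate fractional Ornstein–Uhlenbeck process: $Y^i_t=\nu_i\int_{-\infty}^te^{-\alpha_i(t-u)}dB^{H_i}_u$, $t\in\mathbb R$, $i=1,2$ (pathwise Riemann–Stieltjes integrals), with $\alpha_i,\nu_i>0$. *)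

theory Defs
  imports "HOL-Probability.Probability"
begin

text \<open>
  The normal law with mean m and variance v. The case v = 0 is the point mass at m, so that
  degenerate Gaussian vectors and a vanishing limit variance are covered.
\<close>

definition gaussian_measure :: "real \<Rightarrow> real \<Rightarrow> real measure" where
  "gaussian_measure m v =
     (if v = 0 then return borel m else density lborel (normal_density m (sqrt v)))"

definition gaussian_process :: "'w measure \<Rightarrow> ('i \<Rightarrow> 'w \<Rightarrow> real) \<Rightarrow> bool" where
  "gaussian_process M X \<longleftrightarrow>
     (\<forall>i. X i \<in> borel_measurable M) \<and>
     (\<forall>I c. finite I \<longrightarrow>
        (\<exists>m v. v \<ge> 0 \<and> distr M borel (\<lambda>\<omega>. \<Sum>i\<in>I. c i * X i \<omega>) = gaussian_measure m v))"

definition standard_fbm :: "'w measure \<Rightarrow> real \<Rightarrow> (real \<Rightarrow> 'w \<Rightarrow> real) \<Rightarrow> bool" where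
  "standard_fbm M h X \<longleftrightarrow>
     gaussian_process M X \<and>
     (\<forall>t. prob_space.expectation M (X t) = 0) \<and>
     (\<forall>s t. prob_space.expectation M (\<lambda>\<omega>. X s \<omega> * X t \<omega>) =
        (\<bar>s\<bar> powr (2 * h) + \<bar>t\<bar> powr (2 * h) - \<bar>t - s\<bar> powr (2 * h)) / 2) \<and>
     (AE \<omega> in M. continuous_on UNIV (\<lambda>t. X t \<omega>))"

text \<open>Unlike the library function \<^const>\<open>sgn\<close>, this takes the value 1 at 0.\<close>

definition sign_rc :: "real \<Rightarrow> real" where
  "sign_rc x = (if x \<ge> 0 then 1 else - 1)"

text \<open>
  The two components are indexed by the two-element type \<^typ>\<open>2\<close>. The Gaussian hypothesis is on
  the joint family indexed by component and time. The cross-covariance formula is the one for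
  H 1 + H 2 different from 1.
\<close>

definition bivariate_fbm ::
  "'w measure \<Rightarrow> (2 \<Rightarrow> real) \<Rightarrow> real \<Rightarrow> (2 \<Rightarrow> 2 \<Rightarrow> real) \<Rightarrow> (2 \<Rightarrow> real \<Rightarrow> 'w \<Rightarrow> real) \<Rightarrow> bool" where
  "bivariate_fbm M H \<rho> \<eta> B \<longleftrightarrow>
     gaussian_process M (\<lambda>(i, t). B i t) \<and>
     (\<forall>i. standard_fbm M (H i) (B i)) \<and>
     - 1 \<le> \<rho> \<and> \<rho> \<le> 1 \<and> \<eta> 1 2 = - \<eta> 2 1 \<and>
     (\<forall>i j. i \<noteq> j \<longrightarrow> (\<forall>t s.
        prob_space.expectation M (\<lambda>\<omega>. B i t \<omega> * B j s \<omega>) =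
          ((\<rho> + sign_rc t * \<eta> i j) * \<bar>t\<bar> powr (H 1 + H 2)
           + (\<rho> - sign_rc s * \<eta> i j) * \<bar>s\<bar> powr (H 1 + H 2)
           - (\<rho> - sign_rc (s - t) * \<eta> i j) * \<bar>s - t\<bar> powr (H 1 + H 2)) / 2))"

definition has_RS_integral ::
  "(real \<Rightarrow> real) \<Rightarrow> (real \<Rightarrow> real) \<Rightarrow> real \<Rightarrow> real \<Rightarrow> real \<Rightarrow> bool" where
  "has_RS_integral f g a b I \<longleftrightarrow>
     (\<forall>e>0. \<exists>\<delta>>0. \<forall>p. p tagged_division_of {a..b} \<and> (\<forall>(x, K)\<in>p. diameter K < \<delta>) \<longrightarrow>
        \<bar>(\<Sum>(x, K)\<in>p. f x * (g (Sup K) - g (Inf K))) - I\<bar> < e)"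

definition has_RS_integral_from_minf ::
  "(real \<Rightarrow> real) \<Rightarrow> (real \<Rightarrow> real) \<Rightarrow> real \<Rightarrow> real \<Rightarrow> bool" where
  "has_RS_integral_from_minf f g b I \<longleftrightarrow>
     (\<exists>J. (\<forall>a<b. has_RS_integral f g a b (J a)) \<and> (J \<longlongrightarrow> I) at_bot)"

definition bivariate_fou ::
  "'w measure \<Rightarrow> (2 \<Rightarrow> real) \<Rightarrow> (2 \<Rightarrow> real) \<Rightarrow> (2 \<Rightarrow> real \<Rightarrow> 'w \<Rightarrow> real) \<Rightarrow>
   (2 \<Rightarrow> real \<Rightarrow> 'w \<Rightarrow> real) \<Rightarrow> bool" where
  "bivariate_fou M \<alpha> \<nu> B Y \<longleftrightarrow>
     (\<forall>i t. Y i t \<in> borel_measurable M) \<and>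
     (\<forall>i. AE \<omega> in M. \<forall>t. \<exists>I.
        has_RS_integral_from_minf (\<lambda>u. exp (- \<alpha> i * (t - u))) (\<lambda>u. B i u \<omega>) t I \<and>
        Y i t \<omega> = \<nu> i * I)"

definition rho_estimator ::
  "(2 \<Rightarrow> real) \<Rightarrow> (2 \<Rightarrow> real) \<Rightarrow> (nat \<Rightarrow> real) \<Rightarrow> (2 \<Rightarrow> real \<Rightarrow> 'w \<Rightarrow> real) \<Rightarrow> nat \<Rightarrow> 'w \<Rightarrow> real" where
  "rho_estimator H \<nu> \<Delta> Y n \<omega> =
     1 / (\<nu> 1 * \<nu> 2 * real n * \<Delta> n powr (H 1 + H 2)) *
     (\<Sum>k<n. (Y 1 (real (k + 1) * \<Delta> n) \<omega> - Y 1 (real k * \<Delta> n) \<omega>)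
           * (Y 2 (real (k + 1) * \<Delta> n) \<omega> - Y 2 (real k * \<Delta> n) \<omega>))"

end

(*
  After integration by parts, the increments of the normalised process Y i / nu i are centred
  Gaussian with cross-covariance fou_cov: a second difference of (rho - sign(x) eta) |x|^h averaged
  against two independent exponential laws. The statistic is a quadratic form in these increments.
  Diagonalising it in an orthonormal Gaussian system writes it as a sum of mu j (zeta j ^ 2 - 1) with
  zeta j independent standard normal. The mu j ^ 2 add up to half the variance, and the largest
  |mu j| is at most a row sum of covariances. The covariances at lag m are O((1 + |m|)^(-b)), uniformly
  in the step: hence the variance converges, the row sums vanish, and the characteristic function,
  a product over j, tends to the Gaussian one. The bias is O(Delta) if h = H 1 + H 2 < 1 and
  O(Delta^(2 - h)) if h > 1, which the last two hypotheses on the step make o(n^(-1/2)).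
*)
theory Submission
  imports Defs
begin

section \<open>Diagonalisation of symmetric forms\<close>

text \<open>The obstacle is that H 1 + H 2 < 3/2 still lets one Hurst index exceed 3/4. The
  autocovariance of that component is then not square summable in the lag, and its normalised row
  sums need not tend to 0. Only combinations stay under control: the decay exponents 2 - 2 H 1 and 2
  - 2 H 2 of the two autocovariances add up to more than 1, and the exponent 2 - h of the
  cross-covariances exceeds 1/2. The eigenvalue bound therefore involves the geometric mean of the
  two autocovariance row bounds instead of their maximum. A second constraint comes from averaging
  over exponential times. It preserves a decay of exponent b uniformly in the step when b < 1,
  whereas b > 1 costs a negative power of the step. The exponents are thus capped below 1, with a
  cap high enough to keep the inequalities above. Degenerate laws are allowed throughout: a singular
  covariance matrix is diagonalised and its null directions are dropped, and the limit variance may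
  vanish.\<close>

definition orthonormal_on :: "'a set \<Rightarrow> ('a \<times> 'a \<Rightarrow> real) \<Rightarrow> bool" where
  "orthonormal_on I U \<longleftrightarrow>
     (\<forall>i\<in>I. \<forall>j\<in>I. (\<Sum>k\<in>I. U (k, i) * U (k, j)) = (if i = j then 1 else 0)) \<and>
     (\<forall>i\<in>I. \<forall>j\<in>I. (\<Sum>k\<in>I. U (i, k) * U (j, k)) = (if i = j then 1 else 0))"

definition conj_form :: "'a set \<Rightarrow> ('a \<Rightarrow> 'a \<Rightarrow> real) \<Rightarrow> ('a \<times> 'a \<Rightarrow> real) \<Rightarrow> 'a \<Rightarrow> 'a \<Rightarrow> real" where
  "conj_form I S U i j = (\<Sum>k\<in>I. \<Sum>l\<in>I. U (k, i) * S k l * U (l, j))"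

text \<open>Tychonoff's theorem: matrices are functions on index pairs, and the product topology
  makes the box compact. The box also bounds the entries outside the index set, which orthonormality
  leaves free.\<close>

lemma compact_fun_box: "compact {U :: 'b \<Rightarrow> real. \<forall>p. \<bar>U p\<bar> \<le> 1}"
proof -
  have "{U :: 'b \<Rightarrow> real. \<forall>p. \<bar>U p\<bar> \<le> 1} = PiE UNIV (\<lambda>_. {-1..1})"
    by (auto simp: PiE_UNIV_domain abs_le_iff)
  moreover have "compactin (product_topology (\<lambda>_::'b. euclideanreal) UNIV) (PiE UNIV (\<lambda>_. {-1..1}))"
    by (subst compactin_PiE) auto
  ultimately show ?thesis
    by (simp add: euclidean_product_topology)
qed

lemma orthonormal_on_entry_le:
  assumes "finite I" "orthonormal_on I U" "i \<in> I" "j \<in> I"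
  shows "\<bar>U (i, j)\<bar> \<le> 1"
proof -
  have "(U (i, j))\<^sup>2 \<le> (\<Sum>k\<in>I. (U (k, j))\<^sup>2)"
    using assms by (intro member_le_sum) auto
  also have "\<dots> = 1"
    using assms by (simp add: orthonormal_on_def power2_eq_square)
  finally show ?thesis
    by (simp add: abs_square_le_1)
qed

lemma closed_orthonormal_on:
  assumes "finite I"
  shows "closed {U. orthonormal_on I U}"
proof -
  have "{U. orthonormal_on I U} =
     (\<Inter>i\<in>I. \<Inter>j\<in>I. {U. (\<Sum>k\<in>I. U (k, i) * U (k, j)) = (if i = j then 1 else 0)}) \<inter>
     (\<Inter>i\<in>I. \<Inter>j\<in>I. {U. (\<Sum>k\<in>I. U (i, k) * U (j, k)) = (if i = j then 1 else 0)})"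
    by (auto simp: orthonormal_on_def)
  also have "closed \<dots>"
    by (intro closed_Int closed_INT ballI closed_Collect_eq continuous_intros
        continuous_on_product_coordinates)
  finally show ?thesis .
qed

text \<open>
  The rotation angle is the one that diagonalises the 2 by 2 block: the trace of the block is kept,
  and the squared difference of its diagonal entries grows by 4 z^2.
\<close>

lemma jacobi_rotation_exists:
  fixes x y z :: real
  assumes "z \<noteq> 0"
  obtains c s where "c\<^sup>2 + s\<^sup>2 = 1"
    "(c\<^sup>2 * x + 2 * c * s * z + s\<^sup>2 * y)\<^sup>2 + (s\<^sup>2 * x - 2 * c * s * z + c\<^sup>2 * y)\<^sup>2 > x\<^sup>2 + y\<^sup>2"
proof -
  define d where "d = x - y"
  define r where "r = sqrt (d\<^sup>2 + (2*z)\<^sup>2)"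
  have r: "r > 0" and r2: "r\<^sup>2 = d\<^sup>2 + (2*z)\<^sup>2"
    using assms by (auto simp: r_def intro!: add_nonneg_pos)
  have "(d/r)\<^sup>2 + (2*z/r)\<^sup>2 = 1"
    unfolding power_divide add_divide_distrib [symmetric] r2 [symmetric] using r by simp
  \<comment> \<open>The rotation angle is t / 2: by the double-angle formulas
    \<open>c\<^sup>2 - s\<^sup>2\<close> and \<open>2 * s * c\<close> become the two coordinates of
    this point of the unit circle.\<close>
  then obtain t where t: "d/r = cos t" "2*z/r = sin t"
    using sincos_total_2pi by metis
  define c where "c = cos (t/2)"
  define s where "s = sin (t/2)"
  have cs: "c\<^sup>2 + s\<^sup>2 = 1" by (simp add: c_def s_def)
  have c2: "c\<^sup>2 - s\<^sup>2 = d/r"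
    using cos_double[of "t/2"] t by (simp add: c_def s_def)
  have s2: "2 * s * c = 2*z/r"
    using sin_double[of "t/2"] t by (simp add: c_def s_def)
  let ?p = "c\<^sup>2 * x + 2 * c * s * z + s\<^sup>2 * y"
  let ?q = "s\<^sup>2 * x - 2 * c * s * z + c\<^sup>2 * y"
  have 1: "?p + ?q = x + y"
  proof -
    have "?p + ?q = (c\<^sup>2+s\<^sup>2)*(x+y)" by algebra
    then show ?thesis using cs by simp
  qed
  have "?p - ?q = (c\<^sup>2-s\<^sup>2) * d + 2*(2 * s * c)*z"
    unfolding d_def by algebra
  also have "\<dots> = (d\<^sup>2 + (2*z)\<^sup>2) / r"
    unfolding c2 s2 by (simp add: power2_eq_square add_divide_distrib)
  also have "\<dots> = r"
    using r r2 by (simp add: power2_eq_square field_simps)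
  finally have 2: "?p - ?q = r" .
  have "2 * (?p\<^sup>2 + ?q\<^sup>2) = (?p+?q)\<^sup>2 + (?p-?q)\<^sup>2" by algebra
  also have "\<dots> = (x+y)\<^sup>2 + (x-y)\<^sup>2 + 4*z\<^sup>2"
    unfolding 1 2 r2 d_def by algebra
  also have "\<dots> = 2 * (x\<^sup>2 + y\<^sup>2) + 4 * z\<^sup>2" by algebra
  finally have e: "2 * (?p\<^sup>2 + ?q\<^sup>2) = 2 * (x\<^sup>2 + y\<^sup>2) + 4 * z\<^sup>2" .
  have "z\<^sup>2 > 0" using assms by simp
  with e have "?p\<^sup>2 + ?q\<^sup>2 > x\<^sup>2 + y\<^sup>2"
    by argo
  then show ?thesis using that cs by blast
qed

text \<open>The entries of a conjugated matrix are values of this bilinear form on columns, so the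
  effect of mixing two columns follows by bilinearity.\<close>

definition bform :: "'a set \<Rightarrow> ('a \<Rightarrow> 'a \<Rightarrow> real) \<Rightarrow> ('a \<Rightarrow> real) \<Rightarrow> ('a \<Rightarrow> real) \<Rightarrow> real" where
  "bform I S x y = (\<Sum>k\<in>I. \<Sum>l\<in>I. x k * S k l * y l)"

lemma bform_left: "bform I S (\<lambda>k. a * x k + b * y k) z = a * bform I S x z + b * bform I S y z"
  by (simp add: bform_def algebra_simps sum.distrib sum_distrib_left)

lemma bform_right: "bform I S z (\<lambda>k. a * x k + b * y k) = a * bform I S z x + b * bform I S z y"
  by (simp add: bform_def algebra_simps sum.distrib sum_distrib_left)

lemma bform_sym:
  assumes "\<And>k l. k \<in> I \<Longrightarrow> l \<in> I \<Longrightarrow> S k l = S l k"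
  shows "bform I S x y = bform I S y x"
  unfolding bform_def
  by (subst sum.swap) (intro sum.cong refl, simp add: assms mult.commute mult.left_commute)

lemma conj_form_eq_bform: "conj_form I S U i j = bform I S (\<lambda>k. U (k, i)) (\<lambda>k. U (k, j))"
  by (simp add: conj_form_def bform_def)

lemma bform_cong:
  assumes "\<And>k. k \<in> I \<Longrightarrow> x k = x' k" "\<And>k. k \<in> I \<Longrightarrow> y k = y' k"
  shows "bform I S x y = bform I S x' y'"
  unfolding bform_def by (intro sum.cong refl) (simp add: assms)

lemma sum_split_pair:
  fixes f :: "'a \<Rightarrow> real"
  assumes "finite I" "p \<in> I" "q \<in> I" "p \<noteq> q"
  shows "sum f I = f p + f q + sum f (I - {p, q})"
proof -
  have "I = insert p (insert q (I - {p,q}))" using assms by auto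
  then have "sum f I = sum f (insert p (insert q (I - {p,q})))" by simp
  then show ?thesis using assms by simp
qed

theorem symmetric_form_diagonalizable:
  fixes S :: "'a \<Rightarrow> 'a \<Rightarrow> real"
  assumes fin: "finite I" and sym: "\<And>k l. k \<in> I \<Longrightarrow> l \<in> I \<Longrightarrow> S k l = S l k"
  obtains U where "orthonormal_on I U"
    "\<And>i j. i \<in> I \<Longrightarrow> j \<in> I \<Longrightarrow> i \<noteq> j \<Longrightarrow> conj_form I S U i j = 0"
proof -
  \<comment> \<open>A maximiser of the sum of squared diagonal entries over the compact orthogonal group is
    diagonal: a Jacobi rotation would otherwise increase the sum.\<close>
  define K where "K = {U :: 'a \<times> 'a \<Rightarrow> real. \<forall>p. \<bar>U p\<bar> \<le> 1} \<inter> {U. orthonormal_on I U}"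
  define F where "F = (\<lambda>U. \<Sum>i\<in>I. (conj_form I S U i i)\<^sup>2)"
  have "compact K"
    unfolding K_def by (intro compact_Int_closed compact_fun_box closed_orthonormal_on fin)
  moreover have "continuous_on K F"
    unfolding F_def conj_form_def
    by (intro continuous_intros continuous_on_subset[OF continuous_on_product_coordinates]) auto
  moreover have "(\<lambda>(i, j). if i = j then 1 else 0) \<in> K"
    using fin by (auto simp: K_def orthonormal_on_def if_distrib[of "\<lambda>x. x * _"] if_distrib[of "\<lambda>x. _ * x"] cong: if_cong)
  ultimately obtain U where U: "U \<in> K" and max: "\<And>V. V \<in> K \<Longrightarrow> F V \<le> F U"
    using continuous_attains_sup[of K F] by blast
  have orth: "orthonormal_on I U" and box: "\<And>p. \<bar>U p\<bar> \<le> 1"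
    using U by (auto simp: K_def)
  have "conj_form I S U p q = 0" if p: "p \<in> I" and q: "q \<in> I" and pq: "p \<noteq> q" for p q
  proof (rule ccontr)
    assume nz: "conj_form I S U p q \<noteq> 0"
    obtain c s where cs: "c\<^sup>2 + s\<^sup>2 = 1" and
      inc: "(c\<^sup>2 * conj_form I S U p p + 2 * c * s * conj_form I S U p q + s\<^sup>2 * conj_form I S U q q)\<^sup>2 +
        (s\<^sup>2 * conj_form I S U p p - 2 * c * s * conj_form I S U p q + c\<^sup>2 * conj_form I S U q q)\<^sup>2
        > (conj_form I S U p p)\<^sup>2 + (conj_form I S U q q)\<^sup>2"
      using jacobi_rotation_exists[OF nz] by blast
    \<comment> \<open>Columns p and q are rotated on the rows in I only. All other entries are those
      of U, so V stays in the box and competes with the maximiser.\<close>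
    define V where "V = (\<lambda>(k, j). if k \<in> I \<and> j = p then c * U (k, p) + s * U (k, q)
        else if k \<in> I \<and> j = q then (- s) * U (k, p) + c * U (k, q) else U (k, j))"
    have Vp: "V (k, p) = c * U (k, p) + s * U (k, q)" if "k \<in> I" for k using that by (simp add: V_def)
    have Vq: "V (k, q) = (- s) * U (k, p) + c * U (k, q)" if "k \<in> I" for k using that pq by (simp add: V_def)
    have Vo: "V (k, j) = U (k, j)" if "j \<noteq> p" "j \<noteq> q" for k j using that by (simp add: V_def)
    define D where "D = (\<lambda>x y. \<Sum>k\<in>I. x k * y k :: real)"
    have Dl: "D (\<lambda>k. a * x k + b * y k) z = a * D x z + b * D y z" for a b x y z
      by (simp add: D_def algebra_simps sum.distrib sum_distrib_left)
    have Dr: "D z (\<lambda>k. a * x k + b * y k) = a * D z x + b * D z y" for a b x y z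
      by (simp add: D_def algebra_simps sum.distrib sum_distrib_left)
    have Dcong: "D x y = D x' y'" if "\<And>k. k \<in> I \<Longrightarrow> x k = x' k" "\<And>k. k \<in> I \<Longrightarrow> y k = y' k" for x y x' y'
      unfolding D_def by (intro sum.cong refl) (simp add: that)
    have DU: "D (\<lambda>k. U (k, i)) (\<lambda>k. U (k, j)) = (if i = j then 1 else 0)" if "i \<in> I" "j \<in> I" for i j
      using orth that by (simp add: D_def orthonormal_on_def)
    have DVp: "D (\<lambda>k. V (k, p)) z = c * D (\<lambda>k. U (k, p)) z + s * D (\<lambda>k. U (k, q)) z" for z
      by (subst Dl[symmetric]) (intro Dcong, auto simp: Vp)
    have DVq: "D (\<lambda>k. V (k, q)) z = (- s) * D (\<lambda>k. U (k, p)) z + c * D (\<lambda>k. U (k, q)) z" for z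
      by (subst Dl[symmetric]) (intro Dcong, auto simp: Vq)
    have DVp': "D z (\<lambda>k. V (k, p)) = c * D z (\<lambda>k. U (k, p)) + s * D z (\<lambda>k. U (k, q))" for z
      by (subst Dr[symmetric]) (intro Dcong, auto simp: Vp)
    have DVq': "D z (\<lambda>k. V (k, q)) = (- s) * D z (\<lambda>k. U (k, p)) + c * D z (\<lambda>k. U (k, q))" for z
      by (subst Dr[symmetric]) (intro Dcong, auto simp: Vq)
    have cs': "c * c + s * s = 1" "s * s + c * c = 1" using cs by (auto simp: power2_eq_square)
    have D1: "D (\<lambda>k. V (k, i)) (\<lambda>k. V (k, j)) = (if i = j then 1 else 0)" if "i \<in> I" "j \<in> I" for i j
    proof (cases "i = p"; cases "i = q"; cases "j = p"; cases "j = q")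
    qed (use that p q pq cs' in \<open>simp_all add: DVp DVq DVp' DVq' DU Vo algebra_simps\<close>)
    \<comment> \<open>In every row the rotation acts on the coordinate pair (p, q) as one and the
      same orthogonal map, so scalar products of rows do not change.\<close>
    have row: "(\<Sum>k\<in>I. V (i, k) * V (j, k)) = (if i = j then 1 else 0)" if "i \<in> I" "j \<in> I" for i j
    proof -
      have "(\<Sum>k\<in>I. V (i, k) * V (j, k)) = V (i,p) * V (j,p) + V (i,q) * V (j,q) + (\<Sum>k\<in>I-{p,q}. V (i, k) * V (j, k))"
        by (rule sum_split_pair[OF fin p q pq])
      also have "(\<Sum>k\<in>I-{p,q}. V (i, k) * V (j, k)) = (\<Sum>k\<in>I-{p,q}. U (i, k) * U (j, k))"
        by (intro sum.cong refl) (auto simp: Vo)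
      also have "V (i,p) * V (j,p) + V (i,q) * V (j,q) = (c * c + s * s) * (U (i,p) * U (j,p) + U (i,q) * U (j,q))"
        using that by (simp add: Vp Vq algebra_simps)
      also have "\<dots> + (\<Sum>k\<in>I-{p,q}. U (i, k) * U (j, k)) = (\<Sum>k\<in>I. U (i, k) * U (j, k))"
        unfolding cs' by (subst sum_split_pair[OF fin p q pq, of "\<lambda>k. U (i, k) * U (j, k)"]) simp
      finally show ?thesis using orth that by (simp add: orthonormal_on_def)
    qed
    have orthV: "orthonormal_on I V"
      using D1 row by (simp add: orthonormal_on_def D_def)
    have "\<bar>V (k, j)\<bar> \<le> 1" for k j
    proof (cases "k \<in> I \<and> j \<in> I")
      case True
      then show ?thesis using orthonormal_on_entry_le[OF fin orthV] by blast
    next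
      case False
      then have "V (k, j) = U (k, j)" using p q by (auto simp: V_def)
      then show ?thesis using box by simp
    qed
    then have "V \<in> K" using orthV by (auto simp: K_def)
    then have le: "F V \<le> F U" by (rule max)
    have Tsym: "conj_form I S U q p = conj_form I S U p q"
      unfolding conj_form_eq_bform by (rule bform_sym) (rule sym)
    have Tp: "conj_form I S V p p = c\<^sup>2 * conj_form I S U p p + 2 * c * s * conj_form I S U p q + s\<^sup>2 * conj_form I S U q q"
    proof -
      have "conj_form I S V p p = bform I S (\<lambda>k. c * U (k, p) + s * U (k, q)) (\<lambda>k. c * U (k, p) + s * U (k, q))"
        unfolding conj_form_eq_bform by (intro bform_cong) (auto simp: Vp)
      then show ?thesis
        using Tsym by (simp add: bform_left bform_right conj_form_eq_bform[symmetric] power2_eq_square algebra_simps)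
    qed
    have Tq: "conj_form I S V q q = s\<^sup>2 * conj_form I S U p p - 2 * c * s * conj_form I S U p q + c\<^sup>2 * conj_form I S U q q"
    proof -
      have "conj_form I S V q q = bform I S (\<lambda>k. (- s) * U (k, p) + c * U (k, q)) (\<lambda>k. (- s) * U (k, p) + c * U (k, q))"
        unfolding conj_form_eq_bform by (intro bform_cong) (auto simp: Vq)
      then show ?thesis
        using Tsym unfolding bform_left bform_right conj_form_eq_bform[symmetric]
        by (simp add: power2_eq_square algebra_simps)
    qed
    have To: "conj_form I S V i i = conj_form I S U i i" if "i \<in> I - {p, q}" for i
      using that by (auto simp: conj_form_def Vo)
    have "F V = (conj_form I S V p p)\<^sup>2 + (conj_form I S V q q)\<^sup>2 + (\<Sum>i\<in>I-{p,q}. (conj_form I S V i i)\<^sup>2)"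
      unfolding F_def by (rule sum_split_pair[OF fin p q pq])
    also have "(\<Sum>i\<in>I-{p,q}. (conj_form I S V i i)\<^sup>2) = (\<Sum>i\<in>I-{p,q}. (conj_form I S U i i)\<^sup>2)"
      by (intro sum.cong refl) (simp add: To)
    finally have "F V > (conj_form I S U p p)\<^sup>2 + (conj_form I S U q q)\<^sup>2 + (\<Sum>i\<in>I-{p,q}. (conj_form I S U i i)\<^sup>2)"
      using inc unfolding Tp Tq by simp
    also have "(conj_form I S U p p)\<^sup>2 + (conj_form I S U q q)\<^sup>2 + (\<Sum>i\<in>I-{p,q}. (conj_form I S U i i)\<^sup>2) = F U"
      unfolding F_def by (rule sum_split_pair[OF fin p q pq, symmetric])
    finally show False using le by simp
  qed
  then show ?thesis using that orth by blast
qed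

section \<open>Centred Gaussian families\<close>

text \<open>
  Stating joint normality with covariance kernel K through characteristic functions makes the notion
  stable under linear maps and almost sure limits without any integrability argument. The selection f
  may repeat indices, so linear maps need no bookkeeping of coinciding indices.
\<close>

definition gauss_fam :: "'w measure \<Rightarrow> ('i \<Rightarrow> 'w \<Rightarrow> real) \<Rightarrow> ('i \<Rightarrow> 'i \<Rightarrow> real) \<Rightarrow> bool" where
  "gauss_fam M Z K \<longleftrightarrow> (\<forall>i. Z i \<in> borel_measurable M) \<and>
     (\<forall>L c f. finite (L :: nat set) \<longrightarrow>
        (CLINT \<omega>|M. iexp (\<Sum>l\<in>L. c l * Z (f l) \<omega>)) =
          complex_of_real (exp (- (\<Sum>l\<in>L. \<Sum>m\<in>L. c l * c m * K (f l) (f m)) / 2)))"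

lemma gauss_fam_measurable: "gauss_fam M Z K \<Longrightarrow> Z i \<in> borel_measurable M"
  by (simp add: gauss_fam_def)

text \<open>A definition cannot quantify over all index types, hence the \<open>nat set\<close> in
  \<open>gauss_fam\<close>. Enumerating a finite set of any type transfers the formula to
  it.\<close>

lemma gauss_fam_char:
  assumes "gauss_fam M Z K" "finite L"
  shows "(CLINT \<omega>|M. iexp (\<Sum>l\<in>L. c l * Z (f l) \<omega>)) =
          complex_of_real (exp (- (\<Sum>l\<in>L. \<Sum>m\<in>L. c l * c m * K (f l) (f m)) / 2))"
proof -
  obtain h where h: "bij_betw h {0..<card L} L"
    using ex_bij_betw_nat_finite[OF assms(2)] by blast
  have 1: "(\<Sum>l\<in>L. g l) = (\<Sum>l\<in>{0..<card L}. g (h l))" for g :: "_ \<Rightarrow> real"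
    by (rule sum.reindex_bij_betw[OF h, symmetric])
  show ?thesis
    using assms(1) unfolding 1 gauss_fam_def by simp
qed

text \<open>A combination of combinations is a single combination over the disjoint union
  \<open>Sigma L\<close>; since the selection may repeat indices, overlapping inner sums do no
  harm.\<close>

lemma gauss_fam_linear:
  assumes Z: "gauss_fam M Z K" and fin: "\<And>a. finite (J a)"
  shows "gauss_fam M (\<lambda>a \<omega>. \<Sum>j\<in>J a. d a j * Z (g a j) \<omega>)
           (\<lambda>a b. \<Sum>j\<in>J a. \<Sum>k\<in>J b. d a j * d b k * K (g a j) (g b k))"
  unfolding gauss_fam_def
proof (intro conjI allI impI)
  show "(\<lambda>\<omega>. \<Sum>j\<in>J a. d a j * Z (g a j) \<omega>) \<in> borel_measurable M" for a
    using gauss_fam_measurable[OF Z] by measurable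
next
  fix L :: "nat set" and c f
  assume L: "finite L"
  define T where "T = Sigma L (\<lambda>l. J (f l))"
  have SG: "sum h T = (\<Sum>l\<in>L. \<Sum>j\<in>J (f l). h (l, j))" for h :: "_ \<Rightarrow> real"
    unfolding T_def using L fin by (subst sum.Sigma) auto
  have T: "finite T" using L fin by (auto simp: T_def)
  have 1: "(\<Sum>l\<in>L. c l * (\<Sum>j\<in>J (f l). d (f l) j * Z (g (f l) j) \<omega>)) =
      (\<Sum>p\<in>T. (c (fst p) * d (f (fst p)) (snd p)) * Z (g (f (fst p)) (snd p)) \<omega>)" for \<omega>
    by (simp add: SG sum_distrib_left mult.assoc)
  have 2: "(\<Sum>l\<in>L. \<Sum>m\<in>L. c l * c m * (\<Sum>j\<in>J (f l). \<Sum>k\<in>J (f m). d (f l) j * d (f m) k * K (g (f l) j) (g (f m) k)))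
     = (\<Sum>p\<in>T. \<Sum>q\<in>T. (c (fst p) * d (f (fst p)) (snd p)) * (c (fst q) * d (f (fst q)) (snd q)) *
          K (g (f (fst p)) (snd p)) (g (f (fst q)) (snd q)))" (is "?l = ?r")
  proof -
    have "?r = (\<Sum>l\<in>L. \<Sum>j\<in>J (f l). \<Sum>m\<in>L. \<Sum>k\<in>J (f m). (c l * d (f l) j) * (c m * d (f m) k) * K (g (f l) j) (g (f m) k))"
      by (simp add: SG)
    also have "\<dots> = (\<Sum>l\<in>L. \<Sum>m\<in>L. \<Sum>j\<in>J (f l). \<Sum>k\<in>J (f m). (c l * d (f l) j) * (c m * d (f m) k) * K (g (f l) j) (g (f m) k))"
      by (intro sum.cong refl sum.swap)
    also have "\<dots> = ?l"
      by (simp add: sum_distrib_left mult_ac)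
    finally show ?thesis by simp
  qed
  show "(CLINT \<omega>|M. iexp (\<Sum>l\<in>L. c l * (\<Sum>j\<in>J (f l). d (f l) j * Z (g (f l) j) \<omega>))) =
      complex_of_real (exp (- (\<Sum>l\<in>L. \<Sum>m\<in>L. c l * c m *
        (\<Sum>j\<in>J (f l). \<Sum>k\<in>J (f m). d (f l) j * d (f m) k * K (g (f l) j) (g (f m) k))) / 2))"
    unfolding 1 2 by (rule gauss_fam_char[OF Z T])
qed

text \<open>Only functions of modulus 1 are integrated, so dominated convergence turns almost sure
  convergence of the variables into convergence of the characteristic functions.\<close>

lemma gauss_fam_limit:
  assumes M: "prob_space M" and Z: "\<And>n. gauss_fam M (Z n) (K n)"
    and W: "\<And>i. W i \<in> borel_measurable M"
    and lim: "\<And>i. AE \<omega> in M. (\<lambda>n. Z n i \<omega>) \<longlonglongrightarrow> W i \<omega>"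
    and K: "\<And>i j. (\<lambda>n. K n i j) \<longlonglongrightarrow> K' i j"
  shows "gauss_fam M W K'"
  unfolding gauss_fam_def
proof (intro conjI allI impI W)
  interpret prob_space M by (rule M)
  note [measurable] = W gauss_fam_measurable[OF Z]
  fix L :: "nat set" and c f
  assume L: "finite L"
  have "(\<lambda>n. CLINT \<omega>|M. iexp (\<Sum>l\<in>L. c l * Z n (f l) \<omega>)) \<longlonglongrightarrow> (CLINT \<omega>|M. iexp (\<Sum>l\<in>L. c l * W (f l) \<omega>))"
  proof (rule integral_dominated_convergence[where w="\<lambda>_. 1"])
    have "AE \<omega> in M. \<forall>l\<in>L. (\<lambda>n. Z n (f l) \<omega>) \<longlonglongrightarrow> W (f l) \<omega>"
      using lim L by (auto simp: AE_finite_all)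
    then show "AE \<omega> in M. (\<lambda>n. iexp (\<Sum>l\<in>L. c l * Z n (f l) \<omega>)) \<longlonglongrightarrow> iexp (\<Sum>l\<in>L. c l * W (f l) \<omega>)"
      by eventually_elim (intro tendsto_intros, auto)
  qed auto
  moreover have "(\<lambda>n. CLINT \<omega>|M. iexp (\<Sum>l\<in>L. c l * Z n (f l) \<omega>)) \<longlonglongrightarrow>
      complex_of_real (exp (- (\<Sum>l\<in>L. \<Sum>m\<in>L. c l * c m * K' (f l) (f m)) / 2))"
    unfolding gauss_fam_char[OF Z L] by (intro tendsto_intros K) auto
  ultimately show "(CLINT \<omega>|M. iexp (\<Sum>l\<in>L. c l * W (f l) \<omega>)) =
      complex_of_real (exp (- (\<Sum>l\<in>L. \<Sum>m\<in>L. c l * c m * K' (f l) (f m)) / 2))"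
    by (rule LIMSEQ_unique)
qed

lemma gauss_fam_char_single:
  assumes "gauss_fam M Z K"
  shows "char (distr M borel (Z i)) t = complex_of_real (exp (- (t\<^sup>2 * K i i) / 2))"
  using gauss_fam_char[OF assms, of "{0::nat}" "\<lambda>_. t" "\<lambda>_. i"] gauss_fam_measurable[OF assms, of i]
  by (simp add: char_def integral_distr power2_eq_square)

text \<open>The kernel is an arbitrary function in \<open>gauss_fam\<close>; its sign on the
  diagonal is forced because exp (- K i i / 2) is the value of a characteristic function and so at
  most 1.\<close>

lemma gauss_fam_var_nonneg:
  assumes "prob_space M" "gauss_fam M Z K"
  shows "K i i \<ge> 0"
proof -
  interpret prob_space M by (rule assms)
  interpret D: real_distribution "distr M borel (Z i)"
    using gauss_fam_measurable[OF assms(2)] by (intro real_distribution_distr)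
  have "cmod (char (distr M borel (Z i)) 1) \<le> 1" by (rule D.cmod_char_le_1)
  then show ?thesis
    by (simp add: gauss_fam_char_single[OF assms(2)])
qed

lemma gauss_fam_std_normal:
  assumes "prob_space M" "gauss_fam M Z K" "K i i = 1"
  shows "distr M borel (Z i) = std_normal_distribution"
proof -
  interpret prob_space M by (rule assms)
  show ?thesis
    using gauss_fam_measurable[OF assms(2)]
    by (intro Levy_uniqueness real_distribution_distr real_dist_normal_dist ext)
       (auto simp: gauss_fam_char_single[OF assms(2)] char_std_normal_distribution assms)
qed

lemma gauss_fam_zero:
  assumes "prob_space M" "gauss_fam M Z K" "K i i = 0"
  shows "AE \<omega> in M. Z i \<omega> = 0"
proof -
  interpret prob_space M by (rule assms)
  have m: "Z i \<in> borel_measurable M" by (rule gauss_fam_measurable[OF assms(2)])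
  interpret R: prob_space "return borel (0::real)" by (rule prob_space_return) simp
  have d: "distr M borel (Z i) = return borel 0"
  proof (intro Levy_uniqueness real_distribution_distr m ext)
    show "real_distribution (return borel (0::real))"
      by unfold_locales auto
    show "char (distr M borel (Z i)) t = char (return borel 0) t" for t
      unfolding gauss_fam_char_single[OF assms(2)] by (simp add: assms char_def integral_return)
  qed
  have "AE x in distr M borel (Z i). x = 0"
    unfolding d by (subst AE_return) auto
  then show ?thesis
    by (subst (asm) AE_distr_iff[OF m]) auto
qed

text \<open>
  The density proportional to 2 + V leaves the characteristic function of Z unchanged, hence, by
  uniqueness, the law of Z.
\<close>

lemma (in prob_space) real_integral_mult_of_char:
  fixes V Z :: "'a \<Rightarrow> real" and f :: "real \<Rightarrow> complex"
  assumes [measurable]: "V \<in> borel_measurable M" "Z \<in> borel_measurable M" "f \<in> borel_measurable borel"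
    and V: "\<And>x. \<bar>V x\<bar> \<le> 1" and f: "\<And>x. cmod (f x) \<le> 1"
    and char: "\<And>u. (CLINT x|M. of_real (V x) * iexp (u * Z x)) = of_real (expectation V) * (CLINT x|M. iexp (u * Z x))"
  shows "(CLINT x|M. of_real (V x) * f (Z x)) = of_real (expectation V) * (CLINT x|M. f (Z x))"
proof -
  have iV: "integrable M V"
    by (rule integrable_const_bound[where B=1]) (use V in auto)
  \<comment> \<open>The shift by 2 makes both \<open>2 + V\<close> and its mean at least 1, so that
    dividing by the mean yields a probability density.\<close>
  define m where "m = 2 + expectation V"
  have "expectation V \<ge> expectation (\<lambda>_. -1)"
    using V iV by (intro integral_mono) (auto simp: abs_le_iff) 
  then have m: "m > 0" by (simp add: m_def prob_space)
  define w where "w x = (2 + V x) / m" for x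
  have [measurable]: "w \<in> borel_measurable M" unfolding w_def by measurable
  have w0: "w x \<ge> 0" for x using V[of x] m by (simp add: w_def)
  have Ew: "(CLINT x|M. w x *\<^sub>R g x) = (2 * (CLINT x|M. g x) + (CLINT x|M. of_real (V x) * g x)) / of_real m"
    if [measurable]: "g \<in> borel_measurable M" and g: "\<And>x. cmod (g x) \<le> 1" for g
  proof -
    have ig: "integrable M g" by (rule integrable_const_bound[where B=1]) (use g in auto)
    have iVg: "integrable M (\<lambda>x. of_real (V x) * g x)"
      by (rule integrable_const_bound[where B=1])
         (use g V in \<open>auto simp: norm_mult intro!: mult_le_one\<close>)
    have "(CLINT x|M. w x *\<^sub>R g x) = (CLINT x|M. (2 * g x + of_real (V x) * g x) / of_real m)"
      by (intro Bochner_Integration.integral_cong) (auto simp: w_def scaleR_conv_of_real field_simps add_divide_distrib)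
    also have "\<dots> = (2 * (CLINT x|M. g x) + (CLINT x|M. of_real (V x) * g x)) / of_real m"
      using ig iVg by simp
    finally show ?thesis .
  qed
  define N where "N = density M w"
  have "integrable M w" unfolding w_def using iV by simp
  moreover have "(\<integral>x. w x \<partial>M) = 1"
    unfolding w_def using iV m by (simp add: prob_space m_def)
  ultimately have "(\<integral>\<^sup>+ x. ennreal (w x) \<partial>M) = 1"
    by (subst nn_integral_eq_integral) (auto simp: w0)
  then have "prob_space N"
    by (intro prob_spaceI) (simp add: N_def emeasure_density cong: nn_integral_cong)
  then interpret N: prob_space N .
  have ZN [measurable]: "Z \<in> borel_measurable N" by (simp add: N_def)
  have EN: "(CLINT x|N. g x) = (CLINT x|M. w x *\<^sub>R g x)" if "g \<in> borel_measurable M" for g :: "'a \<Rightarrow> complex"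
    unfolding N_def using that by (intro integral_density) (auto simp: w0)
  have iexpm: "(\<lambda>x. iexp (u * Z x)) \<in> borel_measurable M" and iexp1: "cmod (iexp (u * Z x)) \<le> 1" for u x
    by auto
  have "distr N borel Z = distr M borel Z"
  proof (intro Levy_uniqueness N.real_distribution_distr real_distribution_distr ext ZN)
    fix u
    have "char (distr N borel Z) u = (CLINT x|N. iexp (u * Z x))"
      by (simp add: char_def integral_distr)
    also have "\<dots> = (2 * (CLINT x|M. iexp (u * Z x)) + of_real (expectation V) * (CLINT x|M. iexp (u * Z x))) / of_real m"
      by (simp only: EN[OF iexpm] Ew[OF iexpm iexp1] char)
    also have "\<dots> = (CLINT x|M. iexp (u * Z x))"
    proof -
      have "2 * (CLINT x|M. iexp (u * Z x)) + of_real (expectation V) * (CLINT x|M. iexp (u * Z x)) = of_real m * (CLINT x|M. iexp (u * Z x))"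
        by (simp add: m_def ring_distribs)
      then show ?thesis using m by simp
    qed
    also have "\<dots> = char (distr M borel Z) u"
      by (simp add: char_def integral_distr)
    finally show "char (distr N borel Z) u = char (distr M borel Z) u" .
  qed simp
  then have "(CLINT x|distr N borel Z. f x) = (CLINT x|distr M borel Z. f x)" by simp
  then have "(CLINT x|N. f (Z x)) = (CLINT x|M. f (Z x))"
    by (simp add: integral_distr)
  then have "(2 * (CLINT x|M. f (Z x)) + (CLINT x|M. of_real (V x) * f (Z x))) = of_real m * (CLINT x|M. f (Z x))"
    using m by (simp add: EN Ew f field_simps)
  then show ?thesis
    by (simp add: m_def algebra_simps)
qed

text \<open>The real and imaginary parts of W satisfy the hypothesis of the real case: conjugating
  the assumption at - u gives it for \<open>cnj (W x)\<close>, and both parts are combinations of W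
  and its conjugate.\<close>

lemma (in prob_space) complex_integral_mult_of_char:
  fixes W :: "'a \<Rightarrow> complex" and Z :: "'a \<Rightarrow> real" and f :: "real \<Rightarrow> complex"
  assumes [measurable]: "W \<in> borel_measurable M" "Z \<in> borel_measurable M" "f \<in> borel_measurable borel"
    and W: "\<And>x. cmod (W x) \<le> 1" and f: "\<And>x. cmod (f x) \<le> 1"
    and char: "\<And>u. (CLINT x|M. W x * iexp (u * Z x)) = (CLINT x|M. W x) * (CLINT x|M. iexp (u * Z x))"
  shows "(CLINT x|M. W x * f (Z x)) = (CLINT x|M. W x) * (CLINT x|M. f (Z x))"
proof -
  have iW: "integrable M W"
    by (rule integrable_const_bound[where B=1]) (use W in auto)
  have ib: "integrable M (\<lambda>x. W x * g x)" "integrable M (\<lambda>x. cnj (W x) * g x)"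
    "integrable M (\<lambda>x. of_real (Re (W x)) * g x)" "integrable M (\<lambda>x. of_real (Im (W x)) * g x)"
    if "g \<in> borel_measurable M" "\<And>x. cmod (g x) \<le> 1" for g
  proof -
    note [measurable] = that(1)
    have le: "cmod (a * b) \<le> 1" if "cmod a \<le> 1" "cmod b \<le> 1" for a b
      using that by (simp add: norm_mult mult_le_one)
    have [measurable]: "(\<lambda>x. cnj (W x)) \<in> borel_measurable M"
      by (rule measurable_compose[OF assms(1)]) (intro borel_measurable_continuous_onI continuous_intros)
    show "integrable M (\<lambda>x. W x * g x)" "integrable M (\<lambda>x. cnj (W x) * g x)"
      "integrable M (\<lambda>x. of_real (Re (W x)) * g x)" "integrable M (\<lambda>x. of_real (Im (W x)) * g x)"
      using that(2) W order_trans[OF abs_Re_le_cmod W] order_trans[OF abs_Im_le_cmod W]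
      by (auto intro!: integrable_const_bound[where B=1] AE_I2 le)
  qed
  have conj: "(CLINT x|M. cnj (W x) * iexp (u * Z x)) = cnj (CLINT x|M. W x) * (CLINT x|M. iexp (u * Z x))" for u
  proof -
    have "(CLINT x|M. cnj (W x) * iexp (u * Z x)) = cnj (CLINT x|M. W x * iexp ((-u) * Z x))"
      by (subst Bochner_Integration.integral_cnj[symmetric]) (simp add: exp_cnj)
    also have "\<dots> = cnj (CLINT x|M. W x) * (CLINT x|M. cnj (iexp ((-u) * Z x)))"
      by (simp only: char complex_cnj_mult Bochner_Integration.integral_cnj)
    finally show ?thesis by (simp add: exp_cnj)
  qed
  have ReW: "of_real (Re z) = (z + cnj z) / 2" and ImW: "of_real (Im z) = (z - cnj z) / (2 * \<i>)" for z
    by (simp_all add: complex_eq_iff)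
  have iexp1: "(\<lambda>x. iexp (u * Z x)) \<in> borel_measurable M" "cmod (iexp (u * Z x)) \<le> 1" for u x
    by auto
  have R: "(CLINT x|M. of_real (Re (W x)) * f (Z x)) = of_real (expectation (\<lambda>x. Re (W x))) * (CLINT x|M. f (Z x))"
  proof (rule real_integral_mult_of_char)
    fix u
    have "(CLINT x|M. of_real (Re (W x)) * iexp (u * Z x)) =
        (CLINT x|M. (W x * iexp (u * Z x) + cnj (W x) * iexp (u * Z x)) / 2)"
      by (simp only: ReW times_divide_eq_left distrib_right)
    also have "\<dots> = ((CLINT x|M. W x * iexp (u * Z x)) + (CLINT x|M. cnj (W x) * iexp (u * Z x))) / 2"
      using ib[OF iexp1] by simp
    also have "\<dots> = ((CLINT x|M. W x) + cnj (CLINT x|M. W x)) / 2 * (CLINT x|M. iexp (u * Z x))"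
      unfolding char conj by (simp add: field_simps)
    also have "\<dots> = of_real (expectation (\<lambda>x. Re (W x))) * (CLINT x|M. iexp (u * Z x))"
      using iW by (simp add: ReW[symmetric])
    finally show "(CLINT x|M. of_real (Re (W x)) * iexp (u * Z x)) = \<dots>" .
  qed (auto simp: f intro: order_trans[OF abs_Re_le_cmod W])
  have I: "(CLINT x|M. of_real (Im (W x)) * f (Z x)) = of_real (expectation (\<lambda>x. Im (W x))) * (CLINT x|M. f (Z x))"
  proof (rule real_integral_mult_of_char)
    fix u
    have "(CLINT x|M. of_real (Im (W x)) * iexp (u * Z x)) =
        (CLINT x|M. (W x * iexp (u * Z x) - cnj (W x) * iexp (u * Z x)) / (2 * \<i>))"
      by (simp only: ImW times_divide_eq_left left_diff_distrib)
    also have "\<dots> = ((CLINT x|M. W x * iexp (u * Z x)) - (CLINT x|M. cnj (W x) * iexp (u * Z x))) / (2 * \<i>)"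
      using ib[OF iexp1] by simp
    also have "\<dots> = ((CLINT x|M. W x) - cnj (CLINT x|M. W x)) / (2 * \<i>) * (CLINT x|M. iexp (u * Z x))"
      unfolding char conj by (simp add: field_simps)
    also have "\<dots> = of_real (Im (CLINT x|M. W x)) * (CLINT x|M. iexp (u * Z x))"
      by (simp only: ImW)
    also have "Im (CLINT x|M. W x) = expectation (\<lambda>x. Im (W x))"
      using iW by simp
    finally show "(CLINT x|M. of_real (Im (W x)) * iexp (u * Z x)) =
        of_real (expectation (\<lambda>x. Im (W x))) * (CLINT x|M. iexp (u * Z x))" .
  qed (auto simp: f intro: order_trans[OF abs_Im_le_cmod W])
  have fm: "(\<lambda>x. f (Z x)) \<in> borel_measurable M" "cmod (f (Z x)) \<le> 1" for x using f by auto
  have "(CLINT x|M. W x * f (Z x)) =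
     (CLINT x|M. of_real (Re (W x)) * f (Z x) + \<i> * (of_real (Im (W x)) * f (Z x)))"
    by (intro Bochner_Integration.integral_cong refl) (metis complex_eq distrib_right mult.assoc)
  also have "\<dots> = of_real (expectation (\<lambda>x. Re (W x))) * (CLINT x|M. f (Z x)) + \<i> * (of_real (expectation (\<lambda>x. Im (W x))) * (CLINT x|M. f (Z x)))"
    using ib[OF fm] by (simp add: R I)
  also have "\<dots> = (CLINT x|M. W x) * (CLINT x|M. f (Z x))"
  proof -
    have "(CLINT x|M. W x) = of_real (expectation (\<lambda>x. Re (W x))) + \<i> * of_real (expectation (\<lambda>x. Im (W x)))"
      using iW complex_eq[of "CLINT x|M. W x"] by simp
    then show ?thesis by (simp only: distrib_right mult.assoc)
  qed
  finally show ?thesis .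
qed

text \<open>Orthonormal jointly Gaussian variables are independent, here as a product formula for
  bounded functions. The induction replaces the exponential of one coordinate after the other by f
  j. Its claim keeps arbitrary frequencies on the untouched coordinates: varying one of them
  provides the factorisation at all u that \<open>complex_integral_mult_of_char\<close> asks
  for.\<close>

lemma gauss_fam_integral_prod:
  fixes f :: "'i \<Rightarrow> real \<Rightarrow> complex"
  assumes M: "prob_space M" and Z: "gauss_fam M Z K" and J: "finite J"
    and K: "\<And>i j. i \<in> J \<Longrightarrow> j \<in> J \<Longrightarrow> K i j = (if i = j then 1 else 0)"
    and f[measurable]: "\<And>i. f i \<in> borel_measurable borel" and f1: "\<And>i x. cmod (f i x) \<le> 1"
  shows "(CLINT \<omega>|M. (\<Prod>j\<in>J. f j (Z j \<omega>))) = (\<Prod>j\<in>J. CLINT \<omega>|M. f j (Z j \<omega>))"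
proof -
  interpret prob_space M by (rule M)
  note [measurable] = gauss_fam_measurable[OF Z]
  have single: "(CLINT \<omega>|M. iexp (u * Z a \<omega>)) = of_real (exp (- u\<^sup>2 / 2))" if "a \<in> J" for a u
    using gauss_fam_char[OF Z, of "{a}" "\<lambda>_. u" "\<lambda>i. i"] K[OF that that] by (simp add: power2_eq_square)
  have prod1: "cmod (\<Prod>j\<in>A. f j (x j)) \<le> 1" for A x
    unfolding prod_norm[symmetric] by (intro prod_le_1) (auto simp: f1)
  have "\<forall>s. (CLINT \<omega>|M. (\<Prod>j\<in>A. f j (Z j \<omega>)) * iexp (\<Sum>j\<in>J-A. s j * Z j \<omega>)) =
      (\<Prod>j\<in>A. CLINT \<omega>|M. f j (Z j \<omega>)) * of_real (exp (- (\<Sum>j\<in>J-A. (s j)\<^sup>2) / 2))" if "finite A" "A \<subseteq> J" for A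
    using that
  proof induction
    case empty
    show ?case
    proof
      fix s
      have "(\<Sum>l\<in>J. \<Sum>m\<in>J. s l * s m * K l m) = (\<Sum>l\<in>J. (s l)\<^sup>2)"
      proof (rule sum.cong[OF refl])
        fix l assume l: "l \<in> J"
        have "(\<Sum>m\<in>J. s l * s m * K l m) = (\<Sum>m\<in>J. if m = l then (s l)\<^sup>2 else 0)"
          using l by (intro sum.cong refl) (auto simp: K power2_eq_square)
        then show "(\<Sum>m\<in>J. s l * s m * K l m) = (s l)\<^sup>2" using l J by simp
      qed
      then show "(CLINT \<omega>|M. (\<Prod>j\<in>{}. f j (Z j \<omega>)) * iexp (\<Sum>j\<in>J-{}. s j * Z j \<omega>)) =
      (\<Prod>j\<in>{}. CLINT \<omega>|M. f j (Z j \<omega>)) * of_real (exp (- (\<Sum>j\<in>J-{}. (s j)\<^sup>2) / 2))"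
        using gauss_fam_char[OF Z J, of s "\<lambda>i. i"] by simp
    qed
  next
    case (insert a A)
    show ?case
    proof
      fix s
      have a: "a \<in> J" "a \<notin> A" using insert by auto
      define R where "R = J - insert a A"
      have R: "J - A = insert a R" "a \<notin> R" "finite R" using a J by (auto simp: R_def)
      define W where "W \<omega> = (\<Prod>j\<in>A. f j (Z j \<omega>)) * iexp (\<Sum>j\<in>R. s j * Z j \<omega>)" for \<omega>
      have [measurable]: "W \<in> borel_measurable M" unfolding W_def by measurable
      have W1: "cmod (W \<omega>) \<le> 1" for \<omega> by (simp add: W_def norm_mult prod1)
      define P where "P = (\<Prod>j\<in>A. CLINT \<omega>|M. f j (Z j \<omega>)) * of_real (exp (- (\<Sum>j\<in>R. (s j)\<^sup>2) / 2))"
      have *: "(CLINT \<omega>|M. W \<omega> * iexp (u * Z a \<omega>)) = P * of_real (exp (- u\<^sup>2 / 2))" for u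
      proof -
        have "\<forall>s. (CLINT \<omega>|M. (\<Prod>j\<in>A. f j (Z j \<omega>)) * iexp (\<Sum>j\<in>J-A. s j * Z j \<omega>)) =
      (\<Prod>j\<in>A. CLINT \<omega>|M. f j (Z j \<omega>)) * of_real (exp (- (\<Sum>j\<in>J-A. (s j)\<^sup>2) / 2))" using insert by auto
        \<comment> \<open>The frequency of the coordinate to be replaced next is set to u; the
          others keep their values.\<close>
        note IH = this[rule_format, of "s(a := u)"]
        have e1: "(\<Sum>j\<in>J-A. (s(a := u)) j * Z j \<omega>) = u * Z a \<omega> + (\<Sum>j\<in>R. s j * Z j \<omega>)" for \<omega>
          unfolding R(1) using R(2,3) by (simp, intro sum.cong) auto
        have e2: "(\<Sum>j\<in>J-A. ((s(a := u)) j)\<^sup>2) = u\<^sup>2 + (\<Sum>j\<in>R. (s j)\<^sup>2)"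
          unfolding R(1) using R(2,3) by (simp, intro sum.cong) auto
        have "(CLINT \<omega>|M. W \<omega> * iexp (u * Z a \<omega>)) = (CLINT \<omega>|M. (\<Prod>j\<in>A. f j (Z j \<omega>)) * iexp (\<Sum>j\<in>J-A. (s(a:=u)) j * Z j \<omega>))"
          unfolding e1 W_def by (intro Bochner_Integration.integral_cong refl) (simp only: of_real_add distrib_left exp_add mult_ac)
        also have "\<dots> = P * of_real (exp (- u\<^sup>2 / 2))"
        proof -
          have "- (u\<^sup>2 + (\<Sum>j\<in>R. (s j)\<^sup>2)) / 2 = - (\<Sum>j\<in>R. (s j)\<^sup>2) / 2 + - u\<^sup>2 / 2"
            by (simp add: field_simps)
          then show ?thesis
            unfolding IH e2 P_def by (simp only: exp_add of_real_mult mult.assoc)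
        qed
        finally show ?thesis .
      qed
      have EW: "(CLINT \<omega>|M. W \<omega>) = P" using *[of 0] by simp
      have "(CLINT \<omega>|M. W \<omega> * f a (Z a \<omega>)) = P * (CLINT \<omega>|M. f a (Z a \<omega>))"
        unfolding EW[symmetric]
      proof (rule complex_integral_mult_of_char)
        show "(CLINT \<omega>|M. W \<omega> * iexp (u * Z a \<omega>)) = (CLINT \<omega>|M. W \<omega>) * (CLINT \<omega>|M. iexp (u * Z a \<omega>))" for u
          unfolding * EW single[OF a(1)] ..
      qed (auto simp: W1 f1)
      moreover have "(\<lambda>\<omega>. (\<Prod>j\<in>insert a A. f j (Z j \<omega>)) * iexp (\<Sum>j\<in>J - insert a A. s j * Z j \<omega>)) = (\<lambda>\<omega>. W \<omega> * f a (Z a \<omega>))"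
        using a insert by (simp add: fun_eq_iff W_def R_def[symmetric] mult_ac)
      moreover have "(\<Prod>j\<in>insert a A. CLINT \<omega>|M. f j (Z j \<omega>)) * of_real (exp (- (\<Sum>j\<in>J - insert a A. (s j)\<^sup>2) / 2)) =
          P * (CLINT \<omega>|M. f a (Z a \<omega>))"
        using a insert by (simp add: P_def R_def[symmetric] mult_ac)
      ultimately show "(CLINT \<omega>|M. (\<Prod>j\<in>insert a A. f j (Z j \<omega>)) * iexp (\<Sum>j\<in>J - insert a A. s j * Z j \<omega>)) =
         (\<Prod>j\<in>insert a A. CLINT \<omega>|M. f j (Z j \<omega>)) * of_real (exp (- (\<Sum>j\<in>J - insert a A. (s j)\<^sup>2) / 2))"
        by (simp only:)
    qed
  qed
  from this[OF J order_refl] show ?thesis by simp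
qed


section \<open>Quadratic forms in Gaussian variables\<close>

lemma sum_rotate3:
  "(\<Sum>i\<in>A. \<Sum>j\<in>B. \<Sum>k\<in>C. f i j k) = (\<Sum>k\<in>C. \<Sum>i\<in>A. \<Sum>j\<in>B. f i j k)"
proof -
  have "(\<Sum>i\<in>A. \<Sum>j\<in>B. \<Sum>k\<in>C. f i j k) = (\<Sum>i\<in>A. \<Sum>k\<in>C. \<Sum>j\<in>B. f i j k)"
    by (intro sum.cong refl sum.swap)
  also have "\<dots> = (\<Sum>k\<in>C. \<Sum>i\<in>A. \<Sum>j\<in>B. f i j k)"
    by (rule sum.swap)
  finally show ?thesis .
qed

lemma orthonormal_on_parseval:
  assumes "finite J" "orthonormal_on J U"
  shows "(\<Sum>j\<in>J. (\<Sum>i\<in>J. u i * U (i, j)) * (\<Sum>i\<in>J. v i * U (i, j))) = (\<Sum>i\<in>J. u i * v i)"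
proof -
  have "(\<Sum>j\<in>J. (\<Sum>i\<in>J. u i * U (i, j)) * (\<Sum>i\<in>J. v i * U (i, j))) =
      (\<Sum>j\<in>J. \<Sum>i\<in>J. \<Sum>k\<in>J. u i * v k * (U (i, j) * U (k, j)))"
    by (simp add: sum_product mult_ac)
  also have "\<dots> = (\<Sum>i\<in>J. \<Sum>k\<in>J. \<Sum>j\<in>J. u i * v k * (U (i, j) * U (k, j)))"
    by (rule sum_rotate3[symmetric])
  also have "\<dots> = (\<Sum>i\<in>J. \<Sum>k\<in>J. if k = i then u i * v i else 0)"
    using assms(2) by (intro sum.cong refl) (auto simp: orthonormal_on_def simp flip: sum_distrib_left)
  finally show ?thesis using assms(1) by simp
qed

lemma orthonormal_on_inverse:
  assumes "finite J" "orthonormal_on J U" "p \<in> J"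
  shows "(\<Sum>j\<in>J. U (p, j) * (\<Sum>i\<in>J. U (i, j) * x i)) = x p"
proof -
  have e: "(\<Sum>i\<in>J. (if i = p then 1 else 0) * U (i, j)) = U (p, j)" for j
    using assms by (simp add: if_distrib[of "\<lambda>x. x * _"] cong: if_cong)
  show ?thesis
    using orthonormal_on_parseval[OF assms(1,2), of "\<lambda>i. if i = p then 1 else 0" x] assms(1,3)
    unfolding e by (simp add: mult.commute if_distrib[of "\<lambda>y. _ * y"] cong: if_cong)
qed

text \<open>Diagonalising the covariance matrix gives uncorrelated combinations. Those of variance 0
  vanish almost surely and are dropped, the others are normalised; J may thus be smaller than I,
  which is how singular covariances are accommodated.\<close>

lemma gauss_fam_orthonormal_basis:
  fixes z :: "'a \<Rightarrow> 'i"
  assumes M: "prob_space M" and Z: "gauss_fam M Z K" and I: "finite I"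
    and sym: "\<And>p q. p \<in> I \<Longrightarrow> q \<in> I \<Longrightarrow> K (z p) (z q) = K (z q) (z p)"
  obtains J and \<xi> :: "'a \<Rightarrow> 'w \<Rightarrow> real" and K' A where "finite J" "gauss_fam M \<xi> K'"
    "\<And>i j. i \<in> J \<Longrightarrow> j \<in> J \<Longrightarrow> K' i j = (if i = j then 1 else 0)"
    "AE \<omega> in M. \<forall>p\<in>I. Z (z p) \<omega> = (\<Sum>j\<in>J. A p j * \<xi> j \<omega>)"
    "\<And>p q. p \<in> I \<Longrightarrow> q \<in> I \<Longrightarrow> K (z p) (z q) = (\<Sum>j\<in>J. A p j * A q j)"
proof -
  define C where "C p q = K (z p) (z q)" for p q
  obtain U where U: "orthonormal_on I U"
    and diag: "\<And>i j. i \<in> I \<Longrightarrow> j \<in> I \<Longrightarrow> i \<noteq> j \<Longrightarrow> conj_form I C U i j = 0"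
    using symmetric_form_diagonalizable[OF I, of C] sym unfolding C_def by blast
  define \<eta> where "\<eta> j \<omega> = (\<Sum>p\<in>I. U (p, j) * Z (z p) \<omega>)" for j \<omega>
  have \<eta>: "gauss_fam M \<eta> (conj_form I C U)"
  proof -
    have "(\<lambda>a b. \<Sum>j\<in>I. \<Sum>k\<in>I. U (j, a) * U (k, b) * K (z j) (z k)) = conj_form I C U"
      by (simp add: fun_eq_iff conj_form_def C_def mult_ac)
    then show ?thesis
      using gauss_fam_linear[OF Z, of "\<lambda>_. I" "\<lambda>j p. U (p, j)" "\<lambda>_. z"] I
      by (simp add: \<eta>_def[abs_def])
  qed
  define v where "v j = conj_form I C U j j" for j
  have v0: "v j \<ge> 0" for j
    unfolding v_def by (rule gauss_fam_var_nonneg[OF M \<eta>])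
  define J where "J = {j \<in> I. v j \<noteq> 0}"
  have J: "finite J" "J \<subseteq> I" using I by (auto simp: J_def)
  \<comment> \<open>The rescaling is written as a sum over a singleton to be an instance of
    \<open>gauss_fam_linear\<close>.\<close>
  define \<xi> where "\<xi> j \<omega> = (\<Sum>i\<in>{j}. (1 / sqrt (v j)) * \<eta> i \<omega>)" for j \<omega>
  define K' where "K' a b = (\<Sum>j\<in>{a}. \<Sum>k\<in>{b}. (1 / sqrt (v a)) * (1 / sqrt (v b)) * conj_form I C U j k)" for a b
  have \<xi>: "gauss_fam M \<xi> K'"
    using gauss_fam_linear[OF \<eta>, of "\<lambda>j. {j}" "\<lambda>j _. 1 / sqrt (v j)" "\<lambda>_ i. i"]
    by (simp add: \<xi>_def[abs_def] K'_def[abs_def])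
  define A where "A p j = U (p, j) * sqrt (v j)" for p j
  have K': "K' i j = (if i = j then 1 else 0)" if "i \<in> J" "j \<in> J" for i j
    using that v0[of j] diag[of i j] by (auto simp: K'_def J_def v_def[symmetric] real_sqrt_mult[symmetric])
  have "AE \<omega> in M. \<forall>j\<in>I-J. \<eta> j \<omega> = 0"
    using I gauss_fam_zero[OF M \<eta>] by (subst AE_finite_all) (auto simp: J_def v_def)
  then have rep: "AE \<omega> in M. \<forall>p\<in>I. Z (z p) \<omega> = (\<Sum>j\<in>J. A p j * \<xi> j \<omega>)"
  proof eventually_elim
    case (elim \<omega>)
    show ?case
    proof
      fix p assume p: "p \<in> I"
      have "Z (z p) \<omega> = (\<Sum>j\<in>I. U (p, j) * \<eta> j \<omega>)"
        using orthonormal_on_inverse[OF I U p, of "\<lambda>i. Z (z i) \<omega>"] by (simp add: \<eta>_def)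
      also have "\<dots> = (\<Sum>j\<in>J. U (p, j) * \<eta> j \<omega>)"
        using I J elim by (intro sum.mono_neutral_right) auto
      also have "\<dots> = (\<Sum>j\<in>J. A p j * \<xi> j \<omega>)"
        by (intro sum.cong refl) (auto simp: A_def \<xi>_def J_def)
      finally show "Z (z p) \<omega> = (\<Sum>j\<in>J. A p j * \<xi> j \<omega>)" .
    qed
  qed
  \<comment> \<open>The identity concerns the kernel itself, so it is obtained by linear algebra:
    expanding both arguments in the orthonormal columns of U leaves the diagonal of the conjugated
    matrix.\<close>
  have cov: "K (z p) (z q) = (\<Sum>j\<in>J. A p j * A q j)" if p: "p \<in> I" and q: "q \<in> I" for p q
  proof -
    have "K (z p) (z q) = C p q" by (simp add: C_def)
    also have "\<dots> = (\<Sum>i\<in>I. U (p, i) * (\<Sum>k\<in>I. U (k, i) * C k q))"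
      using orthonormal_on_inverse[OF I U p, of "\<lambda>k. C k q"] by simp
    also have "\<dots> = (\<Sum>i\<in>I. U (p, i) * (\<Sum>k\<in>I. U (k, i) * (\<Sum>j\<in>I. U (q, j) * (\<Sum>l\<in>I. U (l, j) * C k l))))"
      using orthonormal_on_inverse[OF I U q] by simp
    also have "\<dots> = (\<Sum>i\<in>I. U (p, i) * (\<Sum>j\<in>I. U (q, j) * conj_form I C U i j))"
    proof -
      have "(\<Sum>k\<in>I. U (k, i) * (\<Sum>j\<in>I. U (q, j) * (\<Sum>l\<in>I. U (l, j) * C k l))) =
          (\<Sum>j\<in>I. U (q, j) * conj_form I C U i j)" for i
      proof -
        have "(\<Sum>k\<in>I. U (k, i) * (\<Sum>j\<in>I. U (q, j) * (\<Sum>l\<in>I. U (l, j) * C k l)))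
          = (\<Sum>k\<in>I. \<Sum>j\<in>I. U (q, j) * (\<Sum>l\<in>I. U (k, i) * C k l * U (l, j)))"
          by (simp add: sum_distrib_left mult_ac)
        also have "\<dots> = (\<Sum>j\<in>I. \<Sum>k\<in>I. U (q, j) * (\<Sum>l\<in>I. U (k, i) * C k l * U (l, j)))"
          by (rule sum.swap)
        also have "\<dots> = (\<Sum>j\<in>I. U (q, j) * conj_form I C U i j)"
          by (simp add: conj_form_def sum_distrib_left)
        finally show ?thesis .
      qed
      then show ?thesis by (simp only:)
    qed
    also have "\<dots> = (\<Sum>i\<in>I. U (p, i) * (\<Sum>j\<in>I. if j = i then U (q, i) * v i else 0))"
    proof (rule sum.cong[OF refl])
      fix i assume i: "i \<in> I"
      have "(\<Sum>j\<in>I. U (q, j) * conj_form I C U i j) = (\<Sum>j\<in>I. if j = i then U (q, i) * v i else 0)"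
        using diag[OF i] by (intro sum.cong refl) (auto simp: v_def)
      then show "U (p, i) * (\<Sum>j\<in>I. U (q, j) * conj_form I C U i j) =
          U (p, i) * (\<Sum>j\<in>I. if j = i then U (q, i) * v i else 0)" by simp
    qed
    also have "\<dots> = (\<Sum>i\<in>I. U (p, i) * (U (q, i) * v i))"
      using I by simp
    also have "\<dots> = (\<Sum>i\<in>J. U (p, i) * (U (q, i) * v i))"
      using I by (intro sum.mono_neutral_right) (auto simp: J_def)
    also have "\<dots> = (\<Sum>j\<in>J. A p j * A q j)"
      using v0 by (intro sum.cong refl) (simp add: A_def mult_ac)
    finally show ?thesis .
  qed
  show ?thesis using that[OF J(1) \<xi> K' rep cov] by blast
qed

text \<open>
  Here a k j and b k j are the coordinates of X k and Y k in an orthonormal system, so sums over j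
  are covariances, and the matrix assumed diagonal is that of the form X 0 * Y 0 + ... .
\<close>

lemma diagonal_form_trace:
  fixes a b :: "nat \<Rightarrow> 'j \<Rightarrow> real"
  assumes diag: "\<And>i j. i \<in> J \<Longrightarrow> j \<in> J \<Longrightarrow>
    ((\<Sum>k<n. a k i * b k j) + (\<Sum>k<n. a k j * b k i)) / 2 = (if i = j then \<mu> i else 0)"
  shows "(\<Sum>j\<in>J. \<mu> j) = (\<Sum>k<n. \<Sum>j\<in>J. a k j * b k j)"
proof -
  have "(\<Sum>j\<in>J. \<mu> j) = (\<Sum>j\<in>J. \<Sum>k<n. a k j * b k j)"
  proof (rule sum.cong[OF refl])
    fix j assume "j \<in> J"
    from diag[OF this this] show "\<mu> j = (\<Sum>k<n. a k j * b k j)" by simp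
  qed
  then show ?thesis by (subst sum.swap) simp
qed

text \<open>With T i j the sum of the a k i * b k j, the sum of the squared eigenvalues is the
  squared Frobenius norm of (T + T^t) / 2, and twice that norm is the sum of the squares of T i j
  plus the sum of the products T i j * T j i. The right-hand side is Wick's formula for the variance
  of X 0 * Y 0 + ... .\<close>

lemma diagonal_form_square_trace:
  fixes a b :: "nat \<Rightarrow> 'j \<Rightarrow> real"
  assumes J: "finite J" and diag: "\<And>i j. i \<in> J \<Longrightarrow> j \<in> J \<Longrightarrow>
    ((\<Sum>k<n. a k i * b k j) + (\<Sum>k<n. a k j * b k i)) / 2 = (if i = j then \<mu> i else 0)"
  shows "2 * (\<Sum>j\<in>J. (\<mu> j)\<^sup>2) = (\<Sum>k<n. \<Sum>l<n.
     (\<Sum>j\<in>J. a k j * a l j) * (\<Sum>j\<in>J. b k j * b l j) + (\<Sum>j\<in>J. a k j * b l j) * (\<Sum>j\<in>J. b k j * a l j))"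
proof -
  define T where "T i j = (\<Sum>k<n. a k i * b k j)" for i j
  have "(\<Sum>j\<in>J. (\<mu> j)\<^sup>2) = (\<Sum>i\<in>J. \<Sum>j\<in>J. if j = i then (\<mu> i)\<^sup>2 else 0)"
    using J by simp
  also have "\<dots> = (\<Sum>i\<in>J. \<Sum>j\<in>J. ((T i j + T j i) / 2)\<^sup>2)"
    using diag by (intro sum.cong refl) (auto simp: T_def)
  also have "\<dots> = ((\<Sum>i\<in>J. \<Sum>j\<in>J. T i j * T i j) + (\<Sum>i\<in>J. \<Sum>j\<in>J. T j i * T j i)) / 4 + (\<Sum>i\<in>J. \<Sum>j\<in>J. T i j * T j i) / 2"
  proof -
    have "((T i j + T j i) / 2)\<^sup>2 = (T i j * T i j + T j i * T j i) / 4 + T i j * T j i / 2" for i j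
      by (simp add: power2_eq_square field_simps)
    then show ?thesis
      by (simp only: sum.distrib sum_divide_distrib[symmetric])
  qed
  also have "(\<Sum>i\<in>J. \<Sum>j\<in>J. T j i * T j i) = (\<Sum>i\<in>J. \<Sum>j\<in>J. T i j * T i j)"
    by (rule sum.swap)
  finally have 1: "2 * (\<Sum>j\<in>J. (\<mu> j)\<^sup>2) = (\<Sum>i\<in>J. \<Sum>j\<in>J. T i j * T i j) + (\<Sum>i\<in>J. \<Sum>j\<in>J. T i j * T j i)"
    by simp
  have swap: "(\<Sum>i\<in>J. \<Sum>j\<in>J. \<Sum>k<n. \<Sum>l<n. f i j k l) = (\<Sum>k<n. \<Sum>l<n. \<Sum>i\<in>J. \<Sum>j\<in>J. f i j k l)" for f :: "_ \<Rightarrow> _ \<Rightarrow> _ \<Rightarrow> _ \<Rightarrow> real"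
  proof -
    have "(\<Sum>i\<in>J. \<Sum>j\<in>J. \<Sum>k<n. \<Sum>l<n. f i j k l) = (\<Sum>k<n. \<Sum>i\<in>J. \<Sum>j\<in>J. \<Sum>l<n. f i j k l)"
      by (rule sum_rotate3)
    also have "\<dots> = (\<Sum>k<n. \<Sum>l<n. \<Sum>i\<in>J. \<Sum>j\<in>J. f i j k l)"
      by (intro sum.cong refl sum_rotate3)
    finally show ?thesis .
  qed
  have 2: "(\<Sum>i\<in>J. \<Sum>j\<in>J. T i j * T i j) = (\<Sum>k<n. \<Sum>l<n. (\<Sum>j\<in>J. a k j * a l j) * (\<Sum>j\<in>J. b k j * b l j))"
    unfolding T_def sum_product swap by (intro sum.cong refl) (simp add: mult_ac)
  have 3: "(\<Sum>i\<in>J. \<Sum>j\<in>J. T i j * T j i) = (\<Sum>k<n. \<Sum>l<n. (\<Sum>j\<in>J. a k j * b l j) * (\<Sum>j\<in>J. b k j * a l j))"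
    unfolding T_def sum_product swap by (intro sum.cong refl) (simp add: mult_ac)
  show ?thesis unfolding 1 2 3 by (simp add: sum.distrib)
qed

text \<open>Let A and B be the largest |a k i| and |b k i|. The eigenvalue equation for \<mu> i,
  tested against the coordinates of the X l and Y l attaining them, gives x * A <= g11 * B and x * B
  <= g22 * A with x = 2 |\<mu> i| - g12. Multiplying yields x^2 <= g11 * g22 unless A = B = 0, and
  then \<mu> i = 0. Keeping A and B apart is what produces a geometric mean: g11 or g22 alone may be
  large.\<close>

lemma diagonal_form_row_bound:
  fixes a b :: "nat \<Rightarrow> 'j \<Rightarrow> real"
  assumes J: "finite J" and diag: "\<And>i j. i \<in> J \<Longrightarrow> j \<in> J \<Longrightarrow>
    ((\<Sum>k<n. a k i * b k j) + (\<Sum>k<n. a k j * b k i)) / 2 = (if i = j then \<mu> i else 0)"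
    and aa: "\<And>l. l < n \<Longrightarrow> (\<Sum>k<n. \<bar>\<Sum>j\<in>J. a k j * a l j\<bar>) \<le> g11"
    and bb: "\<And>l. l < n \<Longrightarrow> (\<Sum>k<n. \<bar>\<Sum>j\<in>J. b k j * b l j\<bar>) \<le> g22"
    and ab: "\<And>l. l < n \<Longrightarrow> (\<Sum>k<n. \<bar>\<Sum>j\<in>J. a k j * b l j\<bar>) \<le> g12"
    and ba: "\<And>l. l < n \<Longrightarrow> (\<Sum>k<n. \<bar>\<Sum>j\<in>J. b k j * a l j\<bar>) \<le> g12"
    and g: "g11 \<ge> 0" "g22 \<ge> 0" "g12 \<ge> 0"
    and i: "i \<in> J"
  shows "2 * \<bar>\<mu> i\<bar> \<le> g12 + sqrt (g11 * g22)"
proof (rule ccontr)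
  assume "\<not> ?thesis"
  then have big: "2 * \<bar>\<mu> i\<bar> - g12 > sqrt (g11 * g22)" by simp
  define x where "x = 2 * \<bar>\<mu> i\<bar> - g12"
  have "sqrt (g11 * g22) \<ge> 0" using g by simp
  with big have x: "x > 0" "x > sqrt (g11 * g22)" unfolding x_def by linarith+
  have x2: "x * x > g11 * g22"
    using mult_strict_mono[OF x(2) x(2)] x(1) g by simp
  \<comment> \<open>The inserted 0 keeps the maximum well defined for n = 0.\<close>
  define A where "A = Max (insert 0 ((\<lambda>k. \<bar>a k i\<bar>) ` {..<n}))"
  define B where "B = Max (insert 0 ((\<lambda>k. \<bar>b k i\<bar>) ` {..<n}))"
  have A: "\<bar>a k i\<bar> \<le> A" and B: "\<bar>b k i\<bar> \<le> B" if "k < n" for k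
    unfolding A_def B_def using that by (auto intro: Max_ge simp del: Max_insert)
  have AB0: "A \<ge> 0" "B \<ge> 0"
    unfolding A_def B_def by (rule Max_ge; simp)+
  \<comment> \<open>Row i of the diagonal matrix, contracted with a vector c. The inner sums on the
    right become covariances once c is a coordinate vector \<open>a l\<close> or
    \<open>b l\<close>.\<close>
  have eqn: "2 * \<mu> i * c i = (\<Sum>k<n. a k i * (\<Sum>j\<in>J. b k j * c j)) + (\<Sum>k<n. b k i * (\<Sum>j\<in>J. a k j * c j))" for c
  proof -
    have "2 * \<mu> i * c i = (\<Sum>j\<in>J. if j = i then 2 * \<mu> i * c i else 0)" using J i by simp
    also have "\<dots> = (\<Sum>j\<in>J. ((\<Sum>k<n. a k i * b k j) + (\<Sum>k<n. a k j * b k i)) * c j)"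
    proof (rule sum.cong[OF refl])
      fix j assume "j \<in> J"
      from diag[OF i this]
      have "((\<Sum>k<n. a k i * b k j) + (\<Sum>k<n. a k j * b k i)) = 2 * (if i = j then \<mu> i else 0)" by argo
      then show "(if j = i then 2 * \<mu> i * c i else 0) = ((\<Sum>k<n. a k i * b k j) + (\<Sum>k<n. a k j * b k i)) * c j"
        by simp
    qed
    also have "\<dots> = (\<Sum>k<n. a k i * (\<Sum>j\<in>J. b k j * c j)) + (\<Sum>k<n. b k i * (\<Sum>j\<in>J. a k j * c j))"
    proof -
      have e: "(\<Sum>j\<in>J. (\<Sum>k<n. F k * G k j) * c j) = (\<Sum>k<n. F k * (\<Sum>j\<in>J. G k j * c j))"
        for F and G :: "nat \<Rightarrow> 'j \<Rightarrow> real"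
        unfolding sum_distrib_left sum_distrib_right by (subst sum.swap) (simp only: mult.assoc)
      show ?thesis
        using e[of "\<lambda>k. a k i" b] e[of "\<lambda>k. b k i" a]
        by (simp only: distrib_right sum.distrib mult.commute[of "a _ _" "b _ i"])
    qed
    finally show ?thesis .
  qed
  have bnd: "2 * \<bar>\<mu> i\<bar> * \<bar>c i\<bar> \<le> A * u + B * w"
    if "(\<Sum>k<n. \<bar>\<Sum>j\<in>J. b k j * c j\<bar>) \<le> u" "(\<Sum>k<n. \<bar>\<Sum>j\<in>J. a k j * c j\<bar>) \<le> w" for c u w
  proof -
    have "2 * \<bar>\<mu> i\<bar> * \<bar>c i\<bar> = \<bar>2 * \<mu> i * c i\<bar>" by (simp add: abs_mult)
    also have "\<dots> \<le> (\<Sum>k<n. \<bar>a k i\<bar> * \<bar>\<Sum>j\<in>J. b k j * c j\<bar>) + (\<Sum>k<n. \<bar>b k i\<bar> * \<bar>\<Sum>j\<in>J. a k j * c j\<bar>)"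
      unfolding eqn abs_mult[symmetric] by (intro order_trans[OF abs_triangle_ineq] add_mono sum_abs)
    also have "\<dots> \<le> (\<Sum>k<n. A * \<bar>\<Sum>j\<in>J. b k j * c j\<bar>) + (\<Sum>k<n. B * \<bar>\<Sum>j\<in>J. a k j * c j\<bar>)"
      using A B by (intro add_mono sum_mono mult_right_mono) auto
    also have "\<dots> \<le> A * u + B * w"
      unfolding sum_distrib_left[symmetric] using that AB0 by (intro add_mono mult_left_mono)
    finally show ?thesis .
  qed
  have attained: "A = 0 \<or> (\<exists>l<n. A = \<bar>a l i\<bar>)" "B = 0 \<or> (\<exists>l<n. B = \<bar>b l i\<bar>)"
    using Max_in[of "insert 0 ((\<lambda>k. \<bar>a k i\<bar>) ` {..<n})"] Max_in[of "insert 0 ((\<lambda>k. \<bar>b k i\<bar>) ` {..<n})"]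
    unfolding A_def[symmetric] B_def[symmetric] by (auto simp del: Max_in)
  have xA: "x * A \<le> g11 * B"
  proof (cases "A = 0")
    case False
    then obtain l where l: "l < n" "A = \<bar>a l i\<bar>" using attained by auto
    show ?thesis using bnd[of "a l", OF ba[OF l(1)] aa[OF l(1)]] l(2)
      by (simp add: x_def algebra_simps)
  qed (use g AB0 in simp)
  have xB: "x * B \<le> g22 * A"
  proof (cases "B = 0")
    case False
    then obtain l where l: "l < n" "B = \<bar>b l i\<bar>" using attained by auto
    show ?thesis using bnd[of "b l", OF bb[OF l(1)] ab[OF l(1)]] l(2)
      by (simp add: x_def algebra_simps)
  qed (use g AB0 in simp)
  have "x * x * A \<le> g11 * g22 * A"
  proof -
    have "x * (x * A) \<le> x * (g11 * B)" using xA x by (intro mult_left_mono) auto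
    also have "\<dots> = g11 * (x * B)" by simp
    also have "\<dots> \<le> g11 * (g22 * A)" using xB g by (intro mult_left_mono) auto
    finally show ?thesis by (simp add: mult_ac)
  qed
  then have "A = 0" using mult_strict_right_mono[OF x2, of A] AB0 by (cases "A = 0") auto
  have "x * x * B \<le> g11 * g22 * B"
  proof -
    have "x * (x * B) \<le> x * (g22 * A)" using xB x by (intro mult_left_mono) auto
    also have "\<dots> = g22 * (x * A)" by simp
    also have "\<dots> \<le> g22 * (g11 * B)" using xA g by (intro mult_left_mono) auto
    finally show ?thesis by (simp add: mult_ac)
  qed
  then have "B = 0" using mult_strict_right_mono[OF x2, of B] AB0 by (cases "B = 0") auto
  have "\<mu> i = ((\<Sum>k<n. a k i * b k i) + (\<Sum>k<n. a k i * b k i)) / 2" using diag[OF i i] by simp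
  also have "\<dots> = 0" using A \<open>A = 0\<close> by simp
  finally have "\<mu> i = 0" .
  then show False using x g by (simp add: x_def)
qed

text \<open>Two diagonalisations are composed: that of the covariance matrix makes the variables
  coordinates in an orthonormal Gaussian system, and that of the symmetrised form rotates this
  system, which remains orthonormal. The index type \<open>bool \<times> nat\<close> labels the 2 n
  variables even when x and y have values in common.\<close>

theorem gauss_fam_quadratic_form:
  fixes x y :: "nat \<Rightarrow> 'i"
  assumes M: "prob_space M" and Z: "gauss_fam M Z K" and sym: "\<And>i j. K i j = K j i"
  obtains J :: "(bool \<times> nat) set" and \<zeta> Kz \<mu> where "finite J" "gauss_fam M \<zeta> Kz"
    "\<And>i j. i \<in> J \<Longrightarrow> j \<in> J \<Longrightarrow> Kz i j = (if i = j then 1 else 0)"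
    "AE \<omega> in M. (\<Sum>k<n. Z (x k) \<omega> * Z (y k) \<omega>) = (\<Sum>j\<in>J. \<mu> j * (\<zeta> j \<omega>)\<^sup>2)"
    "(\<Sum>j\<in>J. \<mu> j) = (\<Sum>k<n. K (x k) (y k))"
    "2 * (\<Sum>j\<in>J. (\<mu> j)\<^sup>2) =
       (\<Sum>k<n. \<Sum>l<n. K (x k) (x l) * K (y k) (y l) + K (x k) (y l) * K (y k) (x l))"
    "\<And>g11 g22 g12 i. g11 \<ge> 0 \<Longrightarrow> g22 \<ge> 0 \<Longrightarrow> g12 \<ge> 0 \<Longrightarrow>
       (\<And>l. l < n \<Longrightarrow> (\<Sum>k<n. \<bar>K (x k) (x l)\<bar>) \<le> g11) \<Longrightarrow>
       (\<And>l. l < n \<Longrightarrow> (\<Sum>k<n. \<bar>K (y k) (y l)\<bar>) \<le> g22) \<Longrightarrow>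
       (\<And>l. l < n \<Longrightarrow> (\<Sum>k<n. \<bar>K (x k) (y l)\<bar>) \<le> g12) \<Longrightarrow>
       (\<And>l. l < n \<Longrightarrow> (\<Sum>k<n. \<bar>K (y k) (x l)\<bar>) \<le> g12) \<Longrightarrow>
       i \<in> J \<Longrightarrow> 2 * \<bar>\<mu> i\<bar> \<le> g12 + sqrt (g11 * g22)"
proof -
  define I where "I = (UNIV :: bool set) \<times> {..<n}"
  define z where "z p = (if fst p then x (snd p) else y (snd p))" for p :: "bool \<times> nat"
  have I: "finite I" by (simp add: I_def)
  obtain J and \<xi> :: "bool \<times> nat \<Rightarrow> _ \<Rightarrow> real" and K' A where J: "finite J" and \<xi>: "gauss_fam M \<xi> K'"
    and K': "\<And>i j. i \<in> J \<Longrightarrow> j \<in> J \<Longrightarrow> K' i j = (if i = j then 1 else 0)"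
    and rep: "AE \<omega> in M. \<forall>p\<in>I. Z (z p) \<omega> = (\<Sum>j\<in>J. A p j * \<xi> j \<omega>)"
    and cov: "\<And>p q. p \<in> I \<Longrightarrow> q \<in> I \<Longrightarrow> K (z p) (z q) = (\<Sum>j\<in>J. A p j * A q j)"
    using gauss_fam_orthonormal_basis[OF M Z I, of z] sym by blast
  define S where "S i j = ((\<Sum>k<n. A (True, k) i * A (False, k) j) + (\<Sum>k<n. A (False, k) i * A (True, k) j)) / 2" for i j
  have Ssym: "S i j = S j i" for i j
    unfolding S_def by (simp only: add.commute mult.commute)
  obtain U where U: "orthonormal_on J U"
    and dg: "\<And>i j. i \<in> J \<Longrightarrow> j \<in> J \<Longrightarrow> i \<noteq> j \<Longrightarrow> conj_form J S U i j = 0"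
    using symmetric_form_diagonalizable[OF J, of S] Ssym by blast
  define \<zeta> where "\<zeta> j \<omega> = (\<Sum>i\<in>J. U (i, j) * \<xi> i \<omega>)" for j \<omega>
  define Kz where "Kz a b = (\<Sum>j\<in>J. \<Sum>k\<in>J. U (j, a) * U (k, b) * K' j k)" for a b
  have \<zeta>: "gauss_fam M \<zeta> Kz"
    using gauss_fam_linear[OF \<xi>, of "\<lambda>_. J" "\<lambda>j i. U (i, j)" "\<lambda>_ i. i"] J
    by (simp add: \<zeta>_def[abs_def] Kz_def[abs_def])
  have Kz: "Kz i j = (if i = j then 1 else 0)" if "i \<in> J" "j \<in> J" for i j
  proof -
    have "Kz i j = (\<Sum>k\<in>J. \<Sum>l\<in>J. if l = k then U (k, i) * U (k, j) else 0)"
      unfolding Kz_def by (intro sum.cong refl) (auto simp: K')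
    then show ?thesis using U J that by (simp add: orthonormal_on_def)
  qed
  define a where "a k j = (\<Sum>i\<in>J. A (True, k) i * U (i, j))" for k j
  define b where "b k j = (\<Sum>i\<in>J. A (False, k) i * U (i, j))" for k j
  have conv: "(\<Sum>i\<in>J. A p i * \<xi> i \<omega>) = (\<Sum>j\<in>J. (\<Sum>i\<in>J. A p i * U (i, j)) * \<zeta> j \<omega>)" for p \<omega>
    using orthonormal_on_parseval[OF J U, of "A p" "\<lambda>i. \<xi> i \<omega>"] by (simp add: \<zeta>_def mult.commute)
  have cfS: "conj_form J S U i j = ((\<Sum>k<n. a k i * b k j) + (\<Sum>k<n. a k j * b k i)) / 2" for i j
  proof -
    have e: "(\<Sum>p\<in>J. \<Sum>q\<in>J. U (p, i) * (\<Sum>k<n. F k p * G k q) * U (q, j)) =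
       (\<Sum>k<n. (\<Sum>p\<in>J. F k p * U (p, i)) * (\<Sum>q\<in>J. G k q * U (q, j)))" for F G :: "nat \<Rightarrow> _ \<Rightarrow> real"
    proof -
      have "(\<Sum>p\<in>J. \<Sum>q\<in>J. U (p, i) * (\<Sum>k<n. F k p * G k q) * U (q, j)) =
        (\<Sum>p\<in>J. \<Sum>q\<in>J. \<Sum>k<n. F k p * U (p, i) * (G k q * U (q, j)))"
        by (simp add: sum_distrib_left sum_distrib_right mult_ac)
      also have "\<dots> = (\<Sum>k<n. \<Sum>p\<in>J. \<Sum>q\<in>J. F k p * U (p, i) * (G k q * U (q, j)))"
        by (rule sum_rotate3)
      finally show ?thesis by (simp add: sum_product)
    qed
    have "conj_form J S U i j = (\<Sum>p\<in>J. \<Sum>q\<in>J. (U (p, i) * (\<Sum>k<n. A (True, k) p * A (False, k) q) * U (q, j)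
       + U (p, i) * (\<Sum>k<n. A (False, k) p * A (True, k) q) * U (q, j)) / 2)"
      unfolding conj_form_def S_def by (intro sum.cong refl) argo
    also have "\<dots> = ((\<Sum>p\<in>J. \<Sum>q\<in>J. U (p, i) * (\<Sum>k<n. A (True, k) p * A (False, k) q) * U (q, j))
       + (\<Sum>p\<in>J. \<Sum>q\<in>J. U (p, i) * (\<Sum>k<n. A (False, k) p * A (True, k) q) * U (q, j))) / 2"
      by (simp only: sum_divide_distrib[symmetric] sum.distrib)
    also have "\<dots> = ((\<Sum>k<n. a k i * b k j) + (\<Sum>k<n. b k i * a k j)) / 2"
      unfolding e a_def b_def ..
    finally show ?thesis by (simp add: mult.commute)
  qed
  define \<mu> where "\<mu> j = conj_form J S U j j" for j
  have diag: "((\<Sum>k<n. a k i * b k j) + (\<Sum>k<n. a k j * b k i)) / 2 = (if i = j then \<mu> i else 0)"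
    if "i \<in> J" "j \<in> J" for i j
    using dg[OF that] cfS by (auto simp: \<mu>_def)
  have Kxx: "K (x k) (x l) = (\<Sum>j\<in>J. a k j * a l j)"
    and Kxy: "K (x k) (y l) = (\<Sum>j\<in>J. a k j * b l j)"
    and Kyx: "K (y k) (x l) = (\<Sum>j\<in>J. b k j * a l j)"
    and Kyy: "K (y k) (y l) = (\<Sum>j\<in>J. b k j * b l j)" if "k < n" "l < n" for k l
    using that cov[of "(True, k)" "(True, l)"] cov[of "(True, k)" "(False, l)"]
      cov[of "(False, k)" "(True, l)"] cov[of "(False, k)" "(False, l)"]
    by (auto simp: z_def I_def a_def b_def orthonormal_on_parseval[OF J U])
  have AEQ: "AE \<omega> in M. (\<Sum>k<n. Z (x k) \<omega> * Z (y k) \<omega>) = (\<Sum>j\<in>J. \<mu> j * (\<zeta> j \<omega>)\<^sup>2)"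
    using rep
  proof eventually_elim
    case (elim \<omega>)
    have X: "Z (x k) \<omega> = (\<Sum>j\<in>J. a k j * \<zeta> j \<omega>)" and Y: "Z (y k) \<omega> = (\<Sum>j\<in>J. b k j * \<zeta> j \<omega>)" if "k < n" for k
      using elim[rule_format, of "(True, k)"] elim[rule_format, of "(False, k)"] that
      by (auto simp: I_def z_def conv a_def b_def)
    define q where "q = (\<Sum>k<n. Z (x k) \<omega> * Z (y k) \<omega>)"
    define T where "T i j = (\<Sum>k<n. a k i * b k j)" for i j
    have "q = (\<Sum>k<n. \<Sum>i\<in>J. \<Sum>j\<in>J. a k i * b k j * (\<zeta> i \<omega> * \<zeta> j \<omega>))"
      unfolding q_def by (intro sum.cong refl) (simp add: X Y sum_product mult_ac)
    also have "\<dots> = (\<Sum>i\<in>J. \<Sum>j\<in>J. T i j * (\<zeta> i \<omega> * \<zeta> j \<omega>))"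
      unfolding T_def sum_distrib_right by (rule sum_rotate3[symmetric])
    finally have 1: "q = (\<Sum>i\<in>J. \<Sum>j\<in>J. T i j * (\<zeta> i \<omega> * \<zeta> j \<omega>))" .
    then have 2: "q = (\<Sum>i\<in>J. \<Sum>j\<in>J. T j i * (\<zeta> i \<omega> * \<zeta> j \<omega>))"
      by (subst (asm) sum.swap) (simp add: mult_ac)
    \<comment> \<open>Averaging the double sum with its transpose brings in the symmetrised matrix,
      the one that is diagonal.\<close>
    have "q = (q + q) / 2" by simp
    also have "\<dots> = (\<Sum>i\<in>J. \<Sum>j\<in>J. (T i j + T j i) / 2 * (\<zeta> i \<omega> * \<zeta> j \<omega>))"
      by (subst (2) 2, subst 1) (simp add: sum.distrib[symmetric] sum_divide_distrib ring_distribs add_divide_distrib)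
    also have "\<dots> = (\<Sum>i\<in>J. \<Sum>j\<in>J. if j = i then \<mu> i * (\<zeta> i \<omega>)\<^sup>2 else 0)"
      using diag unfolding T_def by (intro sum.cong refl) (auto simp: power2_eq_square)
    also have "\<dots> = (\<Sum>j\<in>J. \<mu> j * (\<zeta> j \<omega>)\<^sup>2)" using J by simp
    finally show ?case by (simp add: q_def)
  qed
  have tr: "(\<Sum>j\<in>J. \<mu> j) = (\<Sum>k<n. K (x k) (y k))"
    using diagonal_form_trace[where a=a and b=b, OF diag] by (simp add: Kxy)
  have tr2: "2 * (\<Sum>j\<in>J. (\<mu> j)\<^sup>2) =
       (\<Sum>k<n. \<Sum>l<n. K (x k) (x l) * K (y k) (y l) + K (x k) (y l) * K (y k) (x l))"
    using diagonal_form_square_trace[where a=a and b=b, OF J diag] by (simp add: Kxx Kxy Kyx Kyy)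
  have row: "2 * \<bar>\<mu> i\<bar> \<le> g12 + sqrt (g11 * g22)"
    if "g11 \<ge> 0" "g22 \<ge> 0" "g12 \<ge> 0"
       "\<And>l. l < n \<Longrightarrow> (\<Sum>k<n. \<bar>K (x k) (x l)\<bar>) \<le> g11"
       "\<And>l. l < n \<Longrightarrow> (\<Sum>k<n. \<bar>K (y k) (y l)\<bar>) \<le> g22"
       "\<And>l. l < n \<Longrightarrow> (\<Sum>k<n. \<bar>K (x k) (y l)\<bar>) \<le> g12"
       "\<And>l. l < n \<Longrightarrow> (\<Sum>k<n. \<bar>K (y k) (x l)\<bar>) \<le> g12"
       "i \<in> J" for g11 g22 g12 i
    using that by (intro diagonal_form_row_bound[where a=a and b=b and J=J and n=n, OF J diag]) (simp_all add: Kxx Kxy Kyx Kyy)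
  show ?thesis
    by (rule that[OF J \<zeta> Kz AEQ tr tr2 row])
qed


section \<open>Normal laws, centred squares and the central limit theorem for quadratic
  forms\<close>

lemma prob_space_std_normal: "prob_space std_normal_distribution"
  using real_dist_normal_dist by (rule real_distribution.axioms(1))

text \<open>As affine images of the standard normal law, point masses and nondegenerate normal laws
  can be treated alike in the moment and characteristic function computations.\<close>

lemma gaussian_measure_affine:
  assumes "v \<ge> 0"
  shows "gaussian_measure m v = distr std_normal_distribution borel (\<lambda>x. m + sqrt v * x)"
proof (cases "v = 0")
  case True
  interpret prob_space std_normal_distribution by (rule prob_space_std_normal)
  show ?thesis
  proof (rule measure_eqI)
    fix A assume "A \<in> sets (gaussian_measure m v)"
    then have A: "A \<in> sets borel" using True by (simp add: gaussian_measure_def)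
    have "emeasure (distr std_normal_distribution borel (\<lambda>x. m)) A = indicator A m"
      using A emeasure_space_1 by (cases "m \<in> A") (auto simp: emeasure_distr space_density)
    then show "emeasure (gaussian_measure m v) A = emeasure (distr std_normal_distribution borel (\<lambda>x. m + sqrt v * x)) A"
      using A True by (simp add: gaussian_measure_def)
  qed (simp add: gaussian_measure_def True)
next
  case False
  interpret prob_space std_normal_distribution by (rule prob_space_std_normal)
  have "distributed std_normal_distribution lborel (\<lambda>x. x) (normal_density 0 1)"
    by (auto simp: distributed_def distr_id2 intro!: measurable_ident_sets)
  from normal_density_affine[OF this, of "sqrt v" m] False assms
  have "distributed std_normal_distribution lborel (\<lambda>x. m + sqrt v * x) (normal_density m (sqrt v))"
    by simp
  then have "distr std_normal_distribution lborel (\<lambda>x. m + sqrt v * x) = density lborel (normal_density m (sqrt v))"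
    by (simp add: distributed_def)
  moreover have "distr std_normal_distribution lborel (\<lambda>x. m + sqrt v * x) = distr std_normal_distribution borel (\<lambda>x. m + sqrt v * x)"
    by (rule distr_cong) auto
  ultimately show ?thesis
    using False by (simp add: gaussian_measure_def)
qed

lemma real_distribution_gaussian: "v \<ge> 0 \<Longrightarrow> real_distribution (gaussian_measure m v)"
  unfolding gaussian_measure_affine
  by (intro prob_space.real_distribution_distr prob_space_std_normal) simp

lemma char_gaussian_measure:
  assumes "v \<ge> 0"
  shows "char (gaussian_measure m v) t = iexp (t * m) * complex_of_real (exp (- (t\<^sup>2 * v) / 2))"
proof -
  have "t * (m + sqrt v * x) = t * m + (t * sqrt v) * x" for x
    by (simp add: algebra_simps)
  then have e: "iexp (t * (m + sqrt v * x)) = iexp (t * m) * iexp ((t * sqrt v) * x)" for x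
    by (simp only: of_real_add distrib_left exp_add)
  have "char (gaussian_measure m v) t = (CLINT x|std_normal_distribution. iexp (t * m) * iexp ((t * sqrt v) * x))"
    unfolding gaussian_measure_affine[OF assms] char_def
    by (subst integral_distr) (simp, simp, simp only: e)
  also have "\<dots> = iexp (t * m) * (CLINT x|std_normal_distribution. iexp ((t * sqrt v) * x))"
    by (rule integral_mult_right_zero)
  also have "(CLINT x|std_normal_distribution. iexp ((t * sqrt v) * x)) = complex_of_real (exp (- ((t * sqrt v)\<^sup>2) / 2))"
    using char_std_normal_distribution by (simp only: char_def fun_eq_iff)
  finally show ?thesis
    using assms by (simp add: power_mult_distrib)
qed

lemma std_normal_moments:
  "(LINT x|std_normal_distribution. x) = 0" "(LINT x|std_normal_distribution. x\<^sup>2) = 1"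
  "(LINT x|std_normal_distribution. x ^ 4) = 3"
  using integral_std_normal_distribution_moment_odd[of 1] std_normal_distribution_even_moments(1)[of 1]
    std_normal_distribution_even_moments(1)[of 2]
  by (simp_all add: fact_numeral)

lemma gaussian_measure_moments:
  assumes M: "prob_space M" and [measurable]: "X \<in> borel_measurable M"
    and d: "distr M borel X = gaussian_measure m v" and v: "v \<ge> 0"
  shows "integrable M X" "integrable M (\<lambda>\<omega>. (X \<omega>)\<^sup>2)"
    "prob_space.expectation M X = m" "prob_space.expectation M (\<lambda>\<omega>. (X \<omega>)\<^sup>2) = m\<^sup>2 + v"
proof -
  interpret N: prob_space std_normal_distribution by (rule prob_space_std_normal)
  have i: "integrable std_normal_distribution (\<lambda>x. x)" "integrable std_normal_distribution (\<lambda>x. x\<^sup>2)"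
    using integrable_std_normal_distribution_moment[of 1] integrable_std_normal_distribution_moment[of 2] by simp_all
  have sq: "(m + sqrt v * x)\<^sup>2 = m\<^sup>2 + 2 * m * sqrt v * x + v * x\<^sup>2" for x
    using v by (simp add: power2_sum power_mult_distrib)
  note d' = d[unfolded gaussian_measure_affine[OF v]]
  let ?g = "\<lambda>x. m + sqrt v * x"
  have g: "?g \<in> borel_measurable std_normal_distribution" by measurable
  have int: "integrable M (\<lambda>\<omega>. f (X \<omega>)) \<longleftrightarrow> integrable std_normal_distribution (\<lambda>x. f (?g x))"
    and ex: "(LINT \<omega>|M. f (X \<omega>)) = (LINT x|std_normal_distribution. f (?g x))"
    if f: "f \<in> borel_measurable borel" for f :: "real \<Rightarrow> real"
    using integrable_distr_eq[OF assms(2) f] integrable_distr_eq[OF g f]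
      integral_distr[OF assms(2) f] integral_distr[OF g f] unfolding d' by (simp_all only:)
  have f1: "(\<lambda>x::real. x) \<in> borel_measurable borel" and f2: "(\<lambda>x::real. x\<^sup>2) \<in> borel_measurable borel"
    by measurable
  have I1: "has_bochner_integral std_normal_distribution ?g (m + sqrt v * 0)"
    and I2: "has_bochner_integral std_normal_distribution (\<lambda>x. (?g x)\<^sup>2) (m\<^sup>2 + 2 * m * sqrt v * 0 + v * 1)"
  proof -
    have c: "has_bochner_integral std_normal_distribution (\<lambda>_. c) c" for c :: real
      using N.prob_space by (simp add: has_bochner_integral_iff)
    have x: "has_bochner_integral std_normal_distribution (\<lambda>x. x) 0" "has_bochner_integral std_normal_distribution (\<lambda>x. x\<^sup>2) 1"
      using i std_normal_moments(1,2) by (simp_all only: has_bochner_integral_iff)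
    show "has_bochner_integral std_normal_distribution ?g (m + sqrt v * 0)"
      by (intro has_bochner_integral_add has_bochner_integral_mult_right c x)
    show "has_bochner_integral std_normal_distribution (\<lambda>x. (?g x)\<^sup>2) (m\<^sup>2 + 2 * m * sqrt v * 0 + v * 1)"
      unfolding sq by (intro has_bochner_integral_add has_bochner_integral_mult_right c x)
  qed
  show "integrable M X" "integrable M (\<lambda>\<omega>. (X \<omega>)\<^sup>2)"
    using int[OF f1] int[OF f2] I1 I2 by (simp_all only: has_bochner_integral_iff)
  show "(LINT \<omega>|M. X \<omega>) = m" "(LINT \<omega>|M. (X \<omega>)\<^sup>2) = m\<^sup>2 + v"
    using ex[OF f1] ex[OF f2] has_bochner_integral_integral_eq[OF I1] has_bochner_integral_integral_eq[OF I2] by simp_all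
qed

lemma std_normal_rv_moments:
  assumes [measurable]: "X \<in> borel_measurable M" and d: "distr M borel X = std_normal_distribution"
  shows "integrable M (\<lambda>\<omega>. X \<omega> ^ k)" "(LINT \<omega>|M. (X \<omega>)\<^sup>2) = 1" "(LINT \<omega>|M. (X \<omega>) ^ 4) = 3"
proof -
  have e: "(LINT \<omega>|M. (X \<omega>) ^ k) = (LINT x|std_normal_distribution. x ^ k)" for k
    unfolding d[symmetric] by (subst integral_distr) auto
  show "(LINT \<omega>|M. (X \<omega>)\<^sup>2) = 1" "(LINT \<omega>|M. (X \<omega>) ^ 4) = 3"
    unfolding e by (rule std_normal_moments)+
  have "integrable (distr M borel X) (\<lambda>x. x ^ k)"
    unfolding d by (rule integrable_std_normal_distribution_moment)
  then show "integrable M (\<lambda>\<omega>. X \<omega> ^ k)"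
    by (subst (asm) integrable_distr_eq) auto
qed

text \<open>The characteristic function of a centred chi-square law with one degree of freedom. Its
  closed form involves a complex square root; an expansion at 0 takes its place.\<close>

definition chi_char :: "real \<Rightarrow> complex" where
  "chi_char s = (CLINT x|std_normal_distribution. iexp (s * (x\<^sup>2 - 1)))"

lemma norm_chi_char_le: "cmod (chi_char s) \<le> 1"
proof -
  interpret prob_space std_normal_distribution by (rule prob_space_std_normal)
  have "cmod (chi_char s) \<le> (LINT x|std_normal_distribution. cmod (iexp (s * (x\<^sup>2 - 1))))"
    unfolding chi_char_def by (rule integral_norm_bound)
  also have "\<dots> = (LINT x|std_normal_distribution. 1)" by simp
  finally show ?thesis using prob_space by simp
qed

text \<open>The square of a standard normal variable minus 1 has mean 0 and variance 2, so both
  functions equal 1 - s^2 up to an error of third order; the finite third absolute moment gives the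
  constant.\<close>

lemma chi_char_approx:
  obtains C where "C \<ge> 0" "\<And>s. \<bar>s\<bar> \<le> 1 \<Longrightarrow> cmod (chi_char s - complex_of_real (exp (- s\<^sup>2))) \<le> C * \<bar>s\<bar> ^ 3"
proof -
  interpret prob_space std_normal_distribution by (rule prob_space_std_normal)
  let ?X = "\<lambda>x::real. x\<^sup>2 - 1"
  have i: "integrable std_normal_distribution (\<lambda>x. x ^ k)" for k
    by (rule integrable_std_normal_distribution_moment)
  have i2: "integrable std_normal_distribution (\<lambda>x. (?X x)\<^sup>2)"
    using i[of 4] i[of 2] by (simp add: power2_diff power_mult[symmetric])
  have E2: "(LINT x|std_normal_distribution. (?X x)\<^sup>2) = 2"
    using i[of 4] i[of 2] prob_space by (simp add: power2_diff power_mult[symmetric] std_normal_moments)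
  have E1: "expectation ?X = 0" using i[of 2] prob_space by (simp add: std_normal_moments)
  have "(x\<^sup>2 - 1) ^ 3 = x ^ 6 - 3 * x ^ 4 + 3 * x\<^sup>2 - 1" for x :: real by algebra
  then have "integrable std_normal_distribution (\<lambda>x. (?X x) ^ 3)"
    using i[of 6] i[of 4] i[of 2] by simp
  then have i3: "integrable std_normal_distribution (\<lambda>x. \<bar>?X x\<bar> ^ 3)"
    unfolding power_abs[symmetric] by (rule integrable_abs)
  define c where "c = expectation (\<lambda>x. \<bar>?X x\<bar> ^ 3) / 6"
  have c: "c \<ge> 0" by (simp add: c_def)
  show ?thesis
  proof
    show "c + 1 \<ge> 0" using c by simp
    fix s :: real assume s: "\<bar>s\<bar> \<le> 1"
    have "cmod (char (distr std_normal_distribution borel ?X) s - complex_of_real (1 - s\<^sup>2 * 2 / 2)) \<le>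
        (s\<^sup>2 / 6) * expectation (\<lambda>x. min (6 * (?X x)\<^sup>2) (\<bar>s\<bar> * \<bar>?X x\<bar> ^ 3))"
      by (rule char_approx3') (use i[of 2] i2 E1 E2 in auto)
    also have "\<dots> \<le> (s\<^sup>2 / 6) * expectation (\<lambda>x. \<bar>s\<bar> * \<bar>?X x\<bar> ^ 3)"
      using i2 i3 by (intro mult_left_mono integral_mono integrable_min) auto
    also have "\<dots> = c * \<bar>s\<bar> ^ 3"
      by (simp add: c_def power2_eq_square power3_eq_cube)
    also have "char (distr std_normal_distribution borel ?X) s = chi_char s"
      unfolding char_def chi_char_def by (subst integral_distr) auto
    finally have 1: "cmod (chi_char s - complex_of_real (1 - s\<^sup>2)) \<le> c * \<bar>s\<bar> ^ 3" by simp
    define u where "u = s\<^sup>2"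
    have u: "u \<ge> 0" by (simp add: u_def)
    \<comment> \<open>Elementary bounds 1 - u <= exp (- u) <= 1 - u + u^2 for u = s^2; the error s^4
      is at most |s|^3 because |s| <= 1.\<close>
    have "exp (- u) \<le> 1 / (1 + u)"
      using u exp_ge_add_one_self[of u] by (simp add: exp_minus field_simps)
    also have "\<dots> \<le> 1 - u + u\<^sup>2"
    proof -
      have "(1 - u + u\<^sup>2) * (1 + u) = 1 + u ^ 3" by algebra
      then show ?thesis using u by (simp add: divide_le_eq)
    qed
    finally have "\<bar>1 - u - exp (- u)\<bar> \<le> u\<^sup>2"
      using exp_ge_add_one_self[of "- u"] by simp
    also have "u\<^sup>2 = \<bar>s\<bar> ^ 3 * \<bar>s\<bar>" 
      by (simp add: u_def power2_eq_square power3_eq_cube)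
    also have "\<dots> \<le> \<bar>s\<bar> ^ 3 * 1" using s by (intro mult_left_mono) auto
    finally have "cmod (complex_of_real (1 - s\<^sup>2) - complex_of_real (exp (- s\<^sup>2))) \<le> \<bar>s\<bar> ^ 3"
      unfolding of_real_diff[symmetric] norm_of_real by (simp add: u_def)
    then have "cmod ((chi_char s - complex_of_real (1 - s\<^sup>2)) + (complex_of_real (1 - s\<^sup>2) - complex_of_real (exp (- s\<^sup>2)))) \<le> c * \<bar>s\<bar> ^ 3 + \<bar>s\<bar> ^ 3"
      by (intro norm_triangle_mono 1)
    then show "cmod (chi_char s - complex_of_real (exp (- s\<^sup>2))) \<le> (c + 1) * \<bar>s\<bar> ^ 3"
      by (simp add: ring_distribs)
  qed
qed

text \<open>\<open>gauss_fam_integral_prod\<close> covers bounded functions only, so the mixed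
  moment is found by polarisation: the sum and difference of the two variables over sqrt 2 are again
  standard normal, and their fourth powers determine the product of the squares.\<close>

lemma orthonormal_gauss_square_moments:
  assumes M: "prob_space M" and Z: "gauss_fam M \<zeta> K"
    and K: "K i i = 1" "K j j = 1" "i \<noteq> j \<Longrightarrow> K i j = 0" "i \<noteq> j \<Longrightarrow> K j i = 0"
  shows "integrable M (\<lambda>\<omega>. (\<zeta> i \<omega>)\<^sup>2 * (\<zeta> j \<omega>)\<^sup>2)"
    "(LINT \<omega>|M. (\<zeta> i \<omega>)\<^sup>2 * (\<zeta> j \<omega>)\<^sup>2) = (if i = j then 3 else 1)"
proof -
  interpret prob_space M by (rule M)
  note [measurable] = gauss_fam_measurable[OF Z]
  note mi = std_normal_rv_moments[OF gauss_fam_measurable[OF Z] gauss_fam_std_normal[OF M Z K(1)]]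
  note mj = std_normal_rv_moments[OF gauss_fam_measurable[OF Z] gauss_fam_std_normal[OF M Z K(2)]]
  have "integrable M (\<lambda>\<omega>. (\<zeta> i \<omega>)\<^sup>2 * (\<zeta> j \<omega>)\<^sup>2) \<and> (LINT \<omega>|M. (\<zeta> i \<omega>)\<^sup>2 * (\<zeta> j \<omega>)\<^sup>2) = (if i = j then 3 else 1)"
  proof (cases "i = j")
    case True
    then show ?thesis using mi(1)[of 4] mi(3) by (simp add: power_add[symmetric])
  next
    case False
    define W where "W b \<omega> = (\<Sum>k\<in>{i, j}. (if k = j \<and> b then - 1 / sqrt 2 else 1 / sqrt 2) * \<zeta> k \<omega>)" for b \<omega>
    define KW where "KW a b = (\<Sum>k\<in>{i, j}. \<Sum>l\<in>{i, j}.
        (if k = j \<and> a then - 1 / sqrt 2 else 1 / sqrt 2) * (if l = j \<and> b then - 1 / sqrt 2 else 1 / sqrt 2) * K k l)" for a b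
    have W: "gauss_fam M W KW"
      using gauss_fam_linear[OF Z, of "\<lambda>_. {i, j}" "\<lambda>b k. if k = j \<and> b then - 1 / sqrt 2 else 1 / sqrt 2" "\<lambda>_ k. k"]
      by (simp add: W_def[abs_def] KW_def[abs_def])
    have KW: "KW b b = 1" for b using False K by (simp add: KW_def)
    note mW = std_normal_rv_moments[OF gauss_fam_measurable[OF W] gauss_fam_std_normal[OF M W KW]]
    have s4: "(sqrt 2) ^ 4 = (4::real)" using power_mult[of "sqrt 2 :: real" 2 2] by simp
    have e: "(\<zeta> i \<omega>)\<^sup>2 * (\<zeta> j \<omega>)\<^sup>2 = (2 * (W True \<omega> ^ 4 + W False \<omega> ^ 4) - \<zeta> i \<omega> ^ 4 - \<zeta> j \<omega> ^ 4) / 6" for \<omega>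
    proof -
      have "W True \<omega> = (\<zeta> i \<omega> - \<zeta> j \<omega>) / sqrt 2" "W False \<omega> = (\<zeta> i \<omega> + \<zeta> j \<omega>) / sqrt 2"
        using False by (auto simp: W_def field_simps)
      then have "2 * (W True \<omega> ^ 4 + W False \<omega> ^ 4) = ((\<zeta> i \<omega> - \<zeta> j \<omega>) ^ 4 + (\<zeta> i \<omega> + \<zeta> j \<omega>) ^ 4) / 2"
        by (simp add: power_divide s4)
      also have "\<dots> = \<zeta> i \<omega> ^ 4 + \<zeta> j \<omega> ^ 4 + 6 * ((\<zeta> i \<omega>)\<^sup>2 * (\<zeta> j \<omega>)\<^sup>2)"
      proof -
        have "(a - b) ^ 4 + (a + b) ^ 4 = 2 * (a ^ 4 + b ^ 4 + 6 * (a\<^sup>2 * b\<^sup>2))" for a b :: real by algebra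
        then show ?thesis by simp
      qed
      finally show ?thesis by simp
    qed
    show ?thesis unfolding e
      using mW(1)[of _ 4] mW(3) mi(1)[of 4] mi(3) mj(1)[of 4] mj(3) False by simp
  qed
  then show "integrable M (\<lambda>\<omega>. (\<zeta> i \<omega>)\<^sup>2 * (\<zeta> j \<omega>)\<^sup>2)"
    "(LINT \<omega>|M. (\<zeta> i \<omega>)\<^sup>2 * (\<zeta> j \<omega>)\<^sup>2) = (if i = j then 3 else 1)" by auto
qed

lemma diagonal_form_variance:
  assumes M: "prob_space M" and Z: "gauss_fam M \<zeta> K" and J: "finite J"
    and K: "\<And>i j. i \<in> J \<Longrightarrow> j \<in> J \<Longrightarrow> K i j = (if i = j then 1 else 0)"
  shows "prob_space.expectation M (\<lambda>\<omega>. \<Sum>j\<in>J. \<mu> j * (\<zeta> j \<omega>)\<^sup>2) = (\<Sum>j\<in>J. \<mu> j)"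
    "prob_space.variance M (\<lambda>\<omega>. \<Sum>j\<in>J. \<mu> j * (\<zeta> j \<omega>)\<^sup>2) = 2 * (\<Sum>j\<in>J. (\<mu> j)\<^sup>2)"
proof -
  interpret prob_space M by (rule M)
  note [measurable] = gauss_fam_measurable[OF Z]
  have m1: "integrable M (\<lambda>\<omega>. (\<zeta> j \<omega>)\<^sup>2)" "expectation (\<lambda>\<omega>. (\<zeta> j \<omega>)\<^sup>2) = 1" if "j \<in> J" for j
    using std_normal_rv_moments[OF gauss_fam_measurable[OF Z] gauss_fam_std_normal[OF M Z, of j]] K[OF that that] by auto
  have m2: "integrable M (\<lambda>\<omega>. (\<zeta> i \<omega>)\<^sup>2 * (\<zeta> j \<omega>)\<^sup>2)"
    "expectation (\<lambda>\<omega>. (\<zeta> i \<omega>)\<^sup>2 * (\<zeta> j \<omega>)\<^sup>2) = (if i = j then 3 else 1)" if "i \<in> J" "j \<in> J" for i j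
    using orthonormal_gauss_square_moments[OF M Z, of i j] K that by auto
  show E: "expectation (\<lambda>\<omega>. \<Sum>j\<in>J. \<mu> j * (\<zeta> j \<omega>)\<^sup>2) = (\<Sum>j\<in>J. \<mu> j)"
    using m1 by simp
  have exp: "((\<Sum>j\<in>J. \<mu> j * (\<zeta> j \<omega>)\<^sup>2) - (\<Sum>j\<in>J. \<mu> j))\<^sup>2 =
      (\<Sum>i\<in>J. \<Sum>j\<in>J. \<mu> i * \<mu> j * ((\<zeta> i \<omega>)\<^sup>2 * (\<zeta> j \<omega>)\<^sup>2 - (\<zeta> i \<omega>)\<^sup>2 - (\<zeta> j \<omega>)\<^sup>2 + 1))" for \<omega>
  proof -
    have "(\<Sum>j\<in>J. \<mu> j * (\<zeta> j \<omega>)\<^sup>2) - (\<Sum>j\<in>J. \<mu> j) = (\<Sum>j\<in>J. \<mu> j * ((\<zeta> j \<omega>)\<^sup>2 - 1))"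
      by (simp add: ring_distribs sum_subtractf)
    then show ?thesis
      by (simp add: power2_eq_square[of "sum _ _"] sum_product algebra_simps)
  qed
  have "variance (\<lambda>\<omega>. \<Sum>j\<in>J. \<mu> j * (\<zeta> j \<omega>)\<^sup>2) = (\<Sum>i\<in>J. \<Sum>j\<in>J. \<mu> i * \<mu> j * (if i = j then 2 else 0))"
    unfolding E exp
    by (subst Bochner_Integration.integral_sum, (intro Bochner_Integration.integrable_sum, use m1 m2 in simp),
        intro sum.cong refl, subst Bochner_Integration.integral_sum, use m1 m2 in simp,
        intro sum.cong refl, use m1 m2 prob_space in simp)
  also have "\<dots> = (\<Sum>i\<in>J. \<Sum>j\<in>J. if j = i then 2 * (\<mu> i)\<^sup>2 else 0)"
    by (intro sum.cong refl) (auto simp: power2_eq_square)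
  also have "\<dots> = 2 * (\<Sum>j\<in>J. (\<mu> j)\<^sup>2)" using J by (simp add: sum_distrib_left)
  finally show "variance (\<lambda>\<omega>. \<Sum>j\<in>J. \<mu> j * (\<zeta> j \<omega>)\<^sup>2) = 2 * (\<Sum>j\<in>J. (\<mu> j)\<^sup>2)" .
qed

lemma diagonal_form_char:
  assumes M: "prob_space M" and Z: "gauss_fam M \<zeta> K" and J: "finite J"
    and K: "\<And>i j. i \<in> J \<Longrightarrow> j \<in> J \<Longrightarrow> K i j = (if i = j then 1 else 0)"
  shows "(CLINT \<omega>|M. iexp (t * ((\<Sum>j\<in>J. \<mu> j * (\<zeta> j \<omega>)\<^sup>2) - (\<Sum>j\<in>J. \<mu> j)))) = (\<Prod>j\<in>J. chi_char (t * \<mu> j))"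
proof -
  interpret prob_space M by (rule M)
  note [measurable] = gauss_fam_measurable[OF Z]
  have "iexp (t * ((\<Sum>j\<in>J. \<mu> j * (\<zeta> j \<omega>)\<^sup>2) - (\<Sum>j\<in>J. \<mu> j))) = (\<Prod>j\<in>J. iexp ((t * \<mu> j) * ((\<zeta> j \<omega>)\<^sup>2 - 1)))" for \<omega>
  proof -
    have "t * ((\<Sum>j\<in>J. \<mu> j * (\<zeta> j \<omega>)\<^sup>2) - (\<Sum>j\<in>J. \<mu> j)) = (\<Sum>j\<in>J. (t * \<mu> j) * ((\<zeta> j \<omega>)\<^sup>2 - 1))"
      by (simp add: sum_distrib_left right_diff_distrib sum_subtractf mult_ac)
    then show ?thesis
      using J by (simp only: of_real_sum sum_distrib_left exp_sum)
  qed
  then have "(CLINT \<omega>|M. iexp (t * ((\<Sum>j\<in>J. \<mu> j * (\<zeta> j \<omega>)\<^sup>2) - (\<Sum>j\<in>J. \<mu> j)))) =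
      (CLINT \<omega>|M. (\<Prod>j\<in>J. (\<lambda>x. iexp ((t * \<mu> j) * (x\<^sup>2 - 1))) (\<zeta> j \<omega>)))"
    by (simp only:)
  also have "\<dots> = (\<Prod>j\<in>J. CLINT \<omega>|M. (\<lambda>x. iexp ((t * \<mu> j) * (x\<^sup>2 - 1))) (\<zeta> j \<omega>))"
    by (rule gauss_fam_integral_prod[OF M Z J K]) auto
  also have "\<dots> = (\<Prod>j\<in>J. chi_char (t * \<mu> j))"
  proof (rule prod.cong[OF refl])
    fix j assume "j \<in> J"
    then have d: "distr M borel (\<zeta> j) = std_normal_distribution"
      using K by (intro gauss_fam_std_normal[OF M Z]) simp
    show "(CLINT \<omega>|M. (\<lambda>x. iexp ((t * \<mu> j) * (x\<^sup>2 - 1))) (\<zeta> j \<omega>)) = chi_char (t * \<mu> j)"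
      unfolding chi_char_def d[symmetric] by (subst integral_distr) auto
  qed
  finally show ?thesis .
qed

text \<open>The factors \<open>chi_char (t * \<mu> j)\<close> are compared one by one with exp (- (t
  * \<mu> j)^2). As all of them have modulus at most 1, the products differ by at most C |t|^3 times
  the sum of the |\<mu> j|^3, and this sum is at most the largest |\<mu> j| times a convergent
  variance. The shift \<open>d n\<close> is deterministic and enters only through the mean.\<close>

theorem gauss_quadratic_clt:
  fixes x y :: "nat \<Rightarrow> nat \<Rightarrow> 'i" and d :: "nat \<Rightarrow> real"
  assumes M: "prob_space M" and Z: "\<And>n. gauss_fam M (Z n) (K n)" and sym: "\<And>n i j. K n i j = K n j i"
    and T: "\<And>n \<omega>. T n \<omega> = (\<Sum>k<n. Z n (x n k) \<omega> * Z n (y n k) \<omega>) + d n"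
    and d: "(\<lambda>n. (\<Sum>k<n. K n (x n k) (y n k)) + d n) \<longlonglongrightarrow> 0"
    and V: "(\<lambda>n. \<Sum>k<n. \<Sum>l<n. K n (x n k) (x n l) * K n (y n k) (y n l) + K n (x n k) (y n l) * K n (y n k) (x n l)) \<longlonglongrightarrow> \<sigma>2"
    and g0: "\<And>n. g11 n \<ge> 0" "\<And>n. g22 n \<ge> 0" "\<And>n. g12 n \<ge> 0"
    and g: "\<And>n l. l < n \<Longrightarrow> (\<Sum>k<n. \<bar>K n (x n k) (x n l)\<bar>) \<le> g11 n"
       "\<And>n l. l < n \<Longrightarrow> (\<Sum>k<n. \<bar>K n (y n k) (y n l)\<bar>) \<le> g22 n"
       "\<And>n l. l < n \<Longrightarrow> (\<Sum>k<n. \<bar>K n (x n k) (y n l)\<bar>) \<le> g12 n"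
       "\<And>n l. l < n \<Longrightarrow> (\<Sum>k<n. \<bar>K n (y n k) (x n l)\<bar>) \<le> g12 n"
    and lim: "(\<lambda>n. g12 n + sqrt (g11 n * g22 n)) \<longlonglongrightarrow> 0"
  shows "(\<lambda>n. prob_space.variance M (T n)) \<longlonglongrightarrow> \<sigma>2"
    and "weak_conv_m (\<lambda>n. distr M borel (T n)) (gaussian_measure 0 \<sigma>2)"
proof -
  interpret prob_space M by (rule M)
  note [measurable] = gauss_fam_measurable[OF Z]
  have Tm[measurable]: "T n \<in> borel_measurable M" for n unfolding T[abs_def] by measurable
  define V' where "V' n = (\<Sum>k<n. \<Sum>l<n. K n (x n k) (x n l) * K n (y n k) (y n l) + K n (x n k) (y n l) * K n (y n k) (x n l))" for n
  define e where "e n = (\<Sum>k<n. K n (x n k) (y n k)) + d n" for n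
  have e: "e \<longlonglongrightarrow> 0" using d by (simp add: e_def[abs_def])
  define r where "r n = (g12 n + sqrt (g11 n * g22 n)) / 2" for n
  have r: "r \<longlonglongrightarrow> 0" using tendsto_divide[OF lim, of "\<lambda>_. 2" 2] by (simp add: r_def[abs_def])
  obtain C where C: "C \<ge> 0" "\<And>s. \<bar>s\<bar> \<le> 1 \<Longrightarrow> cmod (chi_char s - complex_of_real (exp (- s\<^sup>2))) \<le> C * \<bar>s\<bar> ^ 3"
    by (rule chi_char_approx) (rule that)
  \<comment> \<open>The eigenvalues and the orthonormal system depend on n; only the variance and
    the error bound leave this block.\<close>
  have key: "variance (T n) = V' n \<and> V' n \<ge> 0 \<and> (\<forall>t. \<bar>t\<bar> * r n \<le> 1 \<longrightarrow>
      cmod ((CLINT \<omega>|M. iexp (t * T n \<omega>)) - iexp (t * e n) * complex_of_real (exp (- (t\<^sup>2 * V' n) / 2))) \<le> C * \<bar>t\<bar> ^ 3 * r n * V' n)" for n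
  proof -
    obtain J :: "(bool \<times> nat) set" and \<zeta> Kz \<mu> where J: "finite J" and \<zeta>: "gauss_fam M \<zeta> Kz"
      and Kz: "\<And>i j. i \<in> J \<Longrightarrow> j \<in> J \<Longrightarrow> Kz i j = (if i = j then 1 else 0)"
      and rep: "AE \<omega> in M. (\<Sum>k<n. Z n (x n k) \<omega> * Z n (y n k) \<omega>) = (\<Sum>j\<in>J. \<mu> j * (\<zeta> j \<omega>)\<^sup>2)"
      and tr: "(\<Sum>j\<in>J. \<mu> j) = (\<Sum>k<n. K n (x n k) (y n k))"
      and tr2: "2 * (\<Sum>j\<in>J. (\<mu> j)\<^sup>2) = V' n"
      and row0: "\<And>g11 g22 g12 i. g11 \<ge> 0 \<Longrightarrow> g22 \<ge> 0 \<Longrightarrow> g12 \<ge> 0 \<Longrightarrow>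
       (\<And>l. l < n \<Longrightarrow> (\<Sum>k<n. \<bar>K n (x n k) (x n l)\<bar>) \<le> g11) \<Longrightarrow>
       (\<And>l. l < n \<Longrightarrow> (\<Sum>k<n. \<bar>K n (y n k) (y n l)\<bar>) \<le> g22) \<Longrightarrow>
       (\<And>l. l < n \<Longrightarrow> (\<Sum>k<n. \<bar>K n (x n k) (y n l)\<bar>) \<le> g12) \<Longrightarrow>
       (\<And>l. l < n \<Longrightarrow> (\<Sum>k<n. \<bar>K n (y n k) (x n l)\<bar>) \<le> g12) \<Longrightarrow>
       i \<in> J \<Longrightarrow> 2 * \<bar>\<mu> i\<bar> \<le> g12 + sqrt (g11 * g22)"
    proof (rule gauss_fam_quadratic_form[OF M Z[of n] sym[of n], where n=n and x="x n" and y="y n"], goal_cases)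
      case (1 J \<zeta> Kz \<mu>)
      show ?case by (rule that[OF 1(2-)[folded V'_def]])
    qed
    have row: "2 * \<bar>\<mu> i\<bar> \<le> g12 n + sqrt (g11 n * g22 n)" if "i \<in> J" for i
      using g0 g that by (intro row0) simp_all
    note [measurable] = gauss_fam_measurable[OF \<zeta>]
    have rep': "AE \<omega> in M. T n \<omega> = (\<Sum>j\<in>J. \<mu> j * (\<zeta> j \<omega>)\<^sup>2) + d n"
      using rep by eventually_elim (simp add: T)
    have i: "integrable M (\<lambda>\<omega>. \<Sum>j\<in>J. \<mu> j * (\<zeta> j \<omega>)\<^sup>2)"
      using std_normal_rv_moments(1)[OF gauss_fam_measurable[OF \<zeta>] gauss_fam_std_normal[OF M \<zeta>], of _ 2] Kz
      by (intro Bochner_Integration.integrable_sum integrable_mult_right) auto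
    have ET: "expectation (T n) = expectation (\<lambda>\<omega>. (\<Sum>j\<in>J. \<mu> j * (\<zeta> j \<omega>)\<^sup>2) + d n)"
      using rep' by (intro integral_cong_AE) auto
    have "variance (T n) = expectation (\<lambda>\<omega>. ((\<Sum>j\<in>J. \<mu> j * (\<zeta> j \<omega>)\<^sup>2) + d n - expectation (T n))\<^sup>2)"
      using rep' by (intro integral_cong_AE) auto
    also have "\<dots> = variance (\<lambda>\<omega>. \<Sum>j\<in>J. \<mu> j * (\<zeta> j \<omega>)\<^sup>2)"
      unfolding ET using i by (simp add: prob_space)
    finally have v: "variance (T n) = V' n"
      using diagonal_form_variance(2)[OF M \<zeta> J Kz] tr2 by simp
    have V0: "V' n \<ge> 0" unfolding tr2[symmetric] by (simp add: sum_nonneg)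
    have "cmod ((CLINT \<omega>|M. iexp (t * T n \<omega>)) - iexp (t * e n) * complex_of_real (exp (- (t\<^sup>2 * V' n) / 2))) \<le> C * \<bar>t\<bar> ^ 3 * r n * V' n"
      if t: "\<bar>t\<bar> * r n \<le> 1" for t
    proof -
      have "(CLINT \<omega>|M. iexp (t * T n \<omega>)) = (CLINT \<omega>|M. iexp (t * e n) * iexp (t * ((\<Sum>j\<in>J. \<mu> j * (\<zeta> j \<omega>)\<^sup>2) - (\<Sum>j\<in>J. \<mu> j))))"
      proof (rule integral_cong_AE)
        show "AE \<omega> in M. iexp (t * T n \<omega>) = iexp (t * e n) * iexp (t * ((\<Sum>j\<in>J. \<mu> j * (\<zeta> j \<omega>)\<^sup>2) - (\<Sum>j\<in>J. \<mu> j)))"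
          using rep'
        proof eventually_elim
          case (elim \<omega>)
          have "t * T n \<omega> = t * e n + t * ((\<Sum>j\<in>J. \<mu> j * (\<zeta> j \<omega>)\<^sup>2) - (\<Sum>j\<in>J. \<mu> j))"
            unfolding elim e_def tr by (simp add: ring_distribs)
          then show ?case by (simp only: of_real_add distrib_left exp_add)
        qed
      qed auto
      also have "\<dots> = iexp (t * e n) * (CLINT \<omega>|M. iexp (t * ((\<Sum>j\<in>J. \<mu> j * (\<zeta> j \<omega>)\<^sup>2) - (\<Sum>j\<in>J. \<mu> j))))"
        by (rule integral_mult_right_zero)
      also have "\<dots> = iexp (t * e n) * (\<Prod>j\<in>J. chi_char (t * \<mu> j))"
        by (rule arg_cong[OF diagonal_form_char[OF M \<zeta> J Kz]])
      finally have 1: "(CLINT \<omega>|M. iexp (t * T n \<omega>)) = iexp (t * e n) * (\<Prod>j\<in>J. chi_char (t * \<mu> j))" .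
      have 2: "complex_of_real (exp (- (t\<^sup>2 * V' n) / 2)) = (\<Prod>j\<in>J. complex_of_real (exp (- (t * \<mu> j)\<^sup>2)))"
      proof -
        have "- (t\<^sup>2 * V' n) / 2 = (\<Sum>j\<in>J. - (t * \<mu> j)\<^sup>2)"
          unfolding tr2[symmetric] by (simp add: power_mult_distrib sum_negf sum_distrib_left sum_distrib_right mult_ac)
        then show ?thesis using J by (simp only: exp_sum of_real_prod)
      qed
      have "cmod ((CLINT \<omega>|M. iexp (t * T n \<omega>)) - iexp (t * e n) * complex_of_real (exp (- (t\<^sup>2 * V' n) / 2)))
        = cmod ((\<Prod>j\<in>J. chi_char (t * \<mu> j)) - (\<Prod>j\<in>J. complex_of_real (exp (- (t * \<mu> j)\<^sup>2))))"
        unfolding 1 2 right_diff_distrib[symmetric] norm_mult by simp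
      also have "\<dots> \<le> (\<Sum>j\<in>J. cmod (chi_char (t * \<mu> j) - complex_of_real (exp (- (t * \<mu> j)\<^sup>2))))"
        by (intro norm_prod_diff norm_chi_char_le) (simp only: norm_of_real, simp)
      also have "\<dots> \<le> (\<Sum>j\<in>J. C * \<bar>t\<bar> ^ 3 * r n * (\<mu> j)\<^sup>2)"
      proof (rule sum_mono)
        fix j assume j: "j \<in> J"
        have mu: "\<bar>\<mu> j\<bar> \<le> r n" using row[OF j] by (simp add: r_def)
        have "\<bar>t * \<mu> j\<bar> \<le> \<bar>t\<bar> * r n" unfolding abs_mult using mu by (intro mult_left_mono) auto
        also note t
        finally have "cmod (chi_char (t * \<mu> j) - complex_of_real (exp (- (t * \<mu> j)\<^sup>2))) \<le> C * \<bar>t * \<mu> j\<bar> ^ 3"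
          by (rule C)
        also have "\<bar>t * \<mu> j\<bar> ^ 3 = \<bar>t\<bar> ^ 3 * (\<bar>\<mu> j\<bar> * (\<mu> j)\<^sup>2)"
          unfolding abs_mult power_mult_distrib by (simp add: power3_eq_cube power2_eq_square)
        also have "C * (\<bar>t\<bar> ^ 3 * (\<bar>\<mu> j\<bar> * (\<mu> j)\<^sup>2)) \<le> C * (\<bar>t\<bar> ^ 3 * (r n * (\<mu> j)\<^sup>2))"
          using mu C by (intro mult_left_mono mult_right_mono) auto
        finally show "cmod (chi_char (t * \<mu> j) - complex_of_real (exp (- (t * \<mu> j)\<^sup>2))) \<le> C * \<bar>t\<bar> ^ 3 * r n * (\<mu> j)\<^sup>2"
          by (simp add: mult_ac)
      qed
      also have "\<dots> = C * \<bar>t\<bar> ^ 3 * r n * (\<Sum>j\<in>J. (\<mu> j)\<^sup>2)" by (simp add: sum_distrib_left)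
      also have "\<dots> \<le> C * \<bar>t\<bar> ^ 3 * r n * V' n"
      proof -
        have "r n \<ge> 0" using g0 by (simp add: r_def)
        then show ?thesis using C unfolding tr2[symmetric]
          by (intro mult_left_mono) (auto intro: sum_nonneg)
      qed
      finally show ?thesis .
    qed
    then show ?thesis using v V0 by blast
  qed
  have Vlim: "V' \<longlonglongrightarrow> \<sigma>2" using V by (simp add: V'_def[abs_def])
  then show "(\<lambda>n. variance (T n)) \<longlonglongrightarrow> \<sigma>2" using key by simp
  \<comment> \<open>As a limit of variances \<sigma>2 is nonnegative, so the limit is a genuine law,
    the point mass at 0 if \<sigma>2 = 0.\<close>
  have s0: "\<sigma>2 \<ge> 0" by (rule LIMSEQ_le_const[OF Vlim]) (use key in auto)
  show "weak_conv_m (\<lambda>n. distr M borel (T n)) (gaussian_measure 0 \<sigma>2)"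
  proof (rule levy_continuity)
    show "real_distribution (distr M borel (T n))" for n by (rule real_distribution_distr) simp
    show "real_distribution (gaussian_measure 0 \<sigma>2)" by (rule real_distribution_gaussian[OF s0])
    fix t :: real
    define c where "c n = iexp (t * e n) * complex_of_real (exp (- (t\<^sup>2 * V' n) / 2))" for n
    have "(\<lambda>n. iexp (t * e n) * complex_of_real (exp (- (t\<^sup>2 * V' n) / 2))) \<longlonglongrightarrow> iexp (t * 0) * complex_of_real (exp (- (t\<^sup>2 * \<sigma>2) / 2))"
      by (intro tendsto_intros e Vlim) simp
    then have clim: "c \<longlonglongrightarrow> char (gaussian_measure 0 \<sigma>2) t"
      by (simp add: c_def[abs_def] char_gaussian_measure[OF s0])
    have "(\<lambda>n. \<bar>t\<bar> * r n) \<longlonglongrightarrow> \<bar>t\<bar> * 0" by (intro tendsto_intros r)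
    then have "eventually (\<lambda>n. \<bar>t\<bar> * r n < 1) sequentially" by (rule order_tendstoD) simp
    then have "eventually (\<lambda>n. norm ((CLINT \<omega>|M. iexp (t * T n \<omega>)) - c n) \<le> C * \<bar>t\<bar> ^ 3 * r n * V' n) sequentially"
      by eventually_elim (use key in \<open>simp add: c_def\<close>)
    then have "(\<lambda>n. (CLINT \<omega>|M. iexp (t * T n \<omega>)) - c n) \<longlonglongrightarrow> 0"
    proof (rule Lim_null_comparison)
      have "(\<lambda>n. C * \<bar>t\<bar> ^ 3 * r n * V' n) \<longlonglongrightarrow> C * \<bar>t\<bar> ^ 3 * 0 * \<sigma>2"
        by (intro tendsto_intros r Vlim)
      then show "(\<lambda>n. C * \<bar>t\<bar> ^ 3 * r n * V' n) \<longlonglongrightarrow> 0" by simp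
    qed
    from tendsto_add[OF this clim] have "(\<lambda>n. (CLINT \<omega>|M. iexp (t * T n \<omega>))) \<longlonglongrightarrow> char (gaussian_measure 0 \<sigma>2) t"
      by simp
    moreover have "char (distr M borel (T n)) t = (CLINT \<omega>|M. iexp (t * T n \<omega>))" for n
      unfolding char_def by (subst integral_distr) auto
    ultimately show "(\<lambda>n. char (distr M borel (T n)) t) \<longlonglongrightarrow> char (gaussian_measure 0 \<sigma>2) t"
      by simp
  qed
qed


section \<open>Covariances of the increments\<close>

text \<open>Calling this function w, the covariance of B i at s and B j at t is (w (- s) + w t - w
  (t - s)) / 2. At 0 the power vanishes, so the value of the sign there does not affect w.\<close>

definition fbm_w :: "real \<Rightarrow> real \<Rightarrow> real \<Rightarrow> real \<Rightarrow> real" where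
  "fbm_w r e h x = (r - sign_rc x * e) * \<bar>x\<bar> powr h"

text \<open>
  The covariance at lag x = t - s of the increments of length D of the i-th fractional Brownian motion
  at s and of the j-th at t, with r = rho, e = eta i j and h = H i + H j (r = 1, e = 0 if i = j).
\<close>

definition incr_cov :: "real \<Rightarrow> real \<Rightarrow> real \<Rightarrow> real \<Rightarrow> real \<Rightarrow> real" where
  "incr_cov r e h D x = (fbm_w r e h (x + D) + fbm_w r e h (x - D) - 2 * fbm_w r e h x) / 2"

text \<open>Reversing the lag amounts to exchanging the two components, whose parameters eta are
  opposite.\<close>

lemma fbm_w_minus: "fbm_w r e h (- x) = fbm_w r (- e) h x"
  by (cases "x = 0") (auto simp: fbm_w_def sign_rc_def)

lemma incr_cov_minus: "incr_cov r e h D (- x) = incr_cov r (- e) h D x"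
  using fbm_w_minus[of r e h "x - D"] fbm_w_minus[of r e h "x + D"] fbm_w_minus[of r e h x]
  by (simp add: incr_cov_def)

lemma fbm_w_scale: "D > 0 \<Longrightarrow> fbm_w r e h (D * x) = D powr h * fbm_w r e h x"
  by (auto simp: fbm_w_def sign_rc_def abs_mult powr_mult zero_le_mult_iff)

lemma incr_cov_scale:
  assumes "D > 0"
  shows "incr_cov r e h D (D * x) = D powr h * incr_cov r e h 1 x"
  using fbm_w_scale[OF assms, of r e h "x + 1"] fbm_w_scale[OF assms, of r e h "x - 1"] fbm_w_scale[OF assms, of r e h x]
  by (simp add: incr_cov_def algebra_simps)

lemma continuous_on_fbm_w:
  assumes "h > 0"
  shows "continuous_on UNIV (fbm_w r e h)"
proof -
  \<comment> \<open>The jump of the sign at 0 is removed by splitting into the powers of the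
    positive and the negative part, each continuous for h > 0.\<close>
  have "fbm_w r e h = (\<lambda>x. (r - e) * (max x 0) powr h + (r + e) * (max (- x) 0) powr h)"
    by (auto simp: fbm_w_def sign_rc_def fun_eq_iff max_def)
  moreover have "continuous_on UNIV (\<lambda>x::real. (r - e) * (max x 0) powr h + (r + e) * (max (- x) 0) powr h)"
    using assms by (intro continuous_intros continuous_on_powr') auto
  ultimately show ?thesis by simp
qed

lemma continuous_on_incr_cov:
  assumes "h > 0"
  shows "continuous_on UNIV (incr_cov r e h D)"
  unfolding incr_cov_def
  by (intro continuous_intros continuous_on_compose2[OF continuous_on_fbm_w[OF assms]]) auto

text \<open>The mean value theorem applied twice. In 36 = 2 * 2 * 9, the factors bound 2 s, |h (h -
  1)| and 3^(2 - h); the last arises because the intermediate point exceeds y - 1, which is at least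
  (1 + y) / 3 for y >= 2.\<close>

lemma powr_second_difference:
  fixes y h :: real
  assumes h: "0 < h" "h < 2" and y: "y \<ge> 2"
  shows "\<bar>(y + 1) powr h + (y - 1) powr h - 2 * y powr h\<bar> \<le> 36 * (1 + y) powr (h - 2)"
proof -
  define \<phi> where "\<phi> s = (y + s) powr h + (y - s) powr h" for s
  have d1: "DERIV \<phi> s :> h * (y + s) powr (h - 1) - h * (y - s) powr (h - 1)" if "0 \<le> s" "s \<le> 1" for s
    unfolding \<phi>_def using that y by (auto intro!: derivative_eq_intros)
  have "\<exists>s>0. s < 1 \<and> \<phi> 1 - \<phi> 0 = (1 - 0) * (h * (y + s) powr (h - 1) - h * (y - s) powr (h - 1))"
    by (rule MVT2) (use d1 in auto)
  then obtain s where s: "0 < s" "s < 1" and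
    e1: "\<phi> 1 - \<phi> 0 = h * (y + s) powr (h - 1) - h * (y - s) powr (h - 1)" by auto
  have d2: "DERIV (\<lambda>x. h * x powr (h - 1)) x :> h * (h - 1) * x powr (h - 2)" if "y - s \<le> x" "x \<le> y + s" for x
    using that s y by (auto intro!: derivative_eq_intros)
  have "\<exists>x>y - s. x < y + s \<and> h * (y + s) powr (h - 1) - h * (y - s) powr (h - 1) = ((y + s) - (y - s)) * (h * (h - 1) * x powr (h - 2))"
    by (rule MVT2) (use d2 s in auto)
  then obtain x where x: "y - s < x" "x < y + s" and
    e2: "h * (y + s) powr (h - 1) - h * (y - s) powr (h - 1) = 2 * s * (h * (h - 1) * x powr (h - 2))" by auto
  have hh: "\<bar>h * (h - 1)\<bar> \<le> 2 * 1" unfolding abs_mult using h by (intro mult_mono) auto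
  have "x powr (h - 2) \<le> ((1 + y) / 3) powr (h - 2)"
    using x s y h by (intro powr_mono2') auto
  also have "\<dots> = (1 + y) powr (h - 2) * 3 powr (2 - h)"
    using y by (simp add: powr_divide powr_diff)
  also have "\<dots> \<le> (1 + y) powr (h - 2) * 3 powr 2"
    using h by (intro mult_left_mono powr_mono) auto
  finally have xp: "x powr (h - 2) \<le> 9 * (1 + y) powr (h - 2)" by simp
  have "\<bar>\<phi> 1 - \<phi> 0\<bar> = 2 * s * (\<bar>h * (h - 1)\<bar> * x powr (h - 2))"
    unfolding e1 e2 using s by (simp add: abs_mult)
  also have "\<dots> \<le> 2 * 1 * (2 * (9 * (1 + y) powr (h - 2)))"
    using hh xp s by (intro mult_mono) auto
  finally show ?thesis by (simp add: \<phi>_def)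
qed

lemma fbm_w_le:
  assumes "h > 0" "\<bar>x\<bar> \<le> c"
  shows "\<bar>fbm_w r e h x\<bar> \<le> (\<bar>r\<bar> + \<bar>e\<bar>) * c powr h"
proof -
  have "\<bar>fbm_w r e h x\<bar> = \<bar>r - sign_rc x * e\<bar> * \<bar>x\<bar> powr h" by (simp add: fbm_w_def abs_mult)
  also have "\<dots> \<le> (\<bar>r\<bar> + \<bar>e\<bar>) * c powr h"
    using assms by (intro mult_mono powr_mono2) (auto simp: sign_rc_def)
  finally show ?thesis .
qed

text \<open>The constant 18 serves both ranges: for |y| <= 2 the three terms are bounded crudely
  through 2 * 3^h = 18 * 3^(h - 2), and for |y| > 2 it is half of the 36 of the second difference.
  Negative y are reflected, which changes the sign of e.\<close>

lemma incr_cov_1_bound: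
  assumes h: "0 < h" "h < 2"
  shows "\<bar>incr_cov r e h 1 y\<bar> \<le> 18 * (\<bar>r\<bar> + \<bar>e\<bar>) * (1 + \<bar>y\<bar>) powr (h - 2)"
proof (cases "\<bar>y\<bar> \<le> 2")
  case True
  have "\<bar>incr_cov r e h 1 y\<bar> \<le> (\<bar>fbm_w r e h (y + 1)\<bar> + \<bar>fbm_w r e h (y - 1)\<bar> + 2 * \<bar>fbm_w r e h y\<bar>) / 2"
    unfolding incr_cov_def by simp
  also have "\<dots> \<le> ((\<bar>r\<bar> + \<bar>e\<bar>) * 3 powr h + (\<bar>r\<bar> + \<bar>e\<bar>) * 3 powr h + 2 * ((\<bar>r\<bar> + \<bar>e\<bar>) * 3 powr h)) / 2"
    using True h by (intro divide_right_mono add_mono mult_left_mono fbm_w_le) auto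
  also have "\<dots> = 18 * (\<bar>r\<bar> + \<bar>e\<bar>) * 3 powr (h - 2)"
    by (simp add: powr_diff)
  also have "\<dots> \<le> 18 * (\<bar>r\<bar> + \<bar>e\<bar>) * (1 + \<bar>y\<bar>) powr (h - 2)"
    using True h by (intro mult_left_mono powr_mono2') auto
  finally show ?thesis .
next
  case False
  have *: "\<bar>incr_cov r e h 1 y\<bar> \<le> 18 * (\<bar>r\<bar> + \<bar>e\<bar>) * (1 + y) powr (h - 2)" if "y \<ge> 2" for y e
  proof -
    have "incr_cov r e h 1 y = (r - e) / 2 * ((y + 1) powr h + (y - 1) powr h - 2 * y powr h)"
    proof -
      have w: "fbm_w r e h z = (r - e) * z powr h" if "z \<ge> 0" for z
        using that by (simp add: fbm_w_def sign_rc_def)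
      have "incr_cov r e h 1 y = ((r - e) * (y + 1) powr h + (r - e) * (y - 1) powr h - 2 * ((r - e) * y powr h)) / 2"
        unfolding incr_cov_def using that by (simp only: w)
      also have "\<dots> = (r - e) / 2 * ((y + 1) powr h + (y - 1) powr h - 2 * y powr h)"
        by (simp add: field_simps)
      finally show ?thesis .
    qed
    then have "\<bar>incr_cov r e h 1 y\<bar> = \<bar>r - e\<bar> / 2 * \<bar>(y + 1) powr h + (y - 1) powr h - 2 * y powr h\<bar>"
      by (simp only: abs_mult abs_divide abs_numeral)
    also have "\<dots> \<le> (\<bar>r\<bar> + \<bar>e\<bar>) / 2 * (36 * (1 + y) powr (h - 2))"
      by (intro mult_mono powr_second_difference[OF h that]) auto
    finally show ?thesis by (simp add: algebra_simps)
  qed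
  show ?thesis
    using *[of y e] *[of "- y" "- e"] False incr_cov_minus[of r e h 1 "- y"] by (cases "y \<ge> 0") auto
qed

text \<open>Self-similarity reduces to step 1. The natural exponent 2 - h may be lowered to b, which
  later allows b < 1.\<close>

lemma incr_cov_bound:
  assumes h: "0 < h" "h < 2" and b: "b \<le> 2 - h" and D: "D > 0"
  shows "\<bar>incr_cov r e h D x\<bar> \<le> 18 * (\<bar>r\<bar> + \<bar>e\<bar>) * D powr (h + b) * (D + \<bar>x\<bar>) powr (- b)"
proof -
  have "\<bar>incr_cov r e h D x\<bar> = D powr h * \<bar>incr_cov r e h 1 (x / D)\<bar>"
    using incr_cov_scale[OF D, of r e h "x / D"] D by (simp add: abs_mult)
  also have "\<dots> \<le> D powr h * (18 * (\<bar>r\<bar> + \<bar>e\<bar>) * (1 + \<bar>x / D\<bar>) powr (h - 2))"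
    by (intro mult_left_mono incr_cov_1_bound h) simp
  also have "\<dots> \<le> D powr h * (18 * (\<bar>r\<bar> + \<bar>e\<bar>) * (1 + \<bar>x / D\<bar>) powr (- b))"
    using b by (intro mult_left_mono powr_mono) auto
  also have "(1 + \<bar>x / D\<bar>) powr (- b) = ((D + \<bar>x\<bar>) / D) powr (- b)"
    using D by (simp add: add_divide_distrib)
  also have "\<dots> = D powr b * (D + \<bar>x\<bar>) powr (- b)"
    using D by (simp add: powr_divide powr_minus field_simps)
  finally show ?thesis
    by (simp add: powr_add mult_ac)
qed

section \<open>Averages of power kernels over exponential times\<close>

definition expo :: "real \<Rightarrow> real measure" where
  "expo a = density lborel (exponential_density a)"

lemma sets_expo [simp, measurable_cong]: "sets (expo a) = sets borel"
  by (simp add: expo_def)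

lemma space_expo [simp]: "space (expo a) = UNIV"
  by (simp add: expo_def space_density)

lemma prob_space_expo: "a > 0 \<Longrightarrow> prob_space (expo a)"
  unfolding expo_def by (rule prob_space_exponential_density)

lemma nn_integral_abs_diff_le:
  fixes F :: "real \<Rightarrow> ennreal"
  assumes [measurable]: "F \<in> borel_measurable borel"
  shows "(\<integral>\<^sup>+v. F \<bar>t - v\<bar> \<partial>lborel) \<le> 2 * (\<integral>\<^sup>+v. F v * indicator {0..} v \<partial>lborel)"
proof -
  have "(\<integral>\<^sup>+v. F \<bar>t - v\<bar> \<partial>lborel) = (\<integral>\<^sup>+v. F \<bar>v\<bar> \<partial>lborel)"
    by (subst nn_integral_real_affine[of "\<lambda>v. F \<bar>v\<bar>" "-1" t]) auto
  also have "\<dots> \<le> (\<integral>\<^sup>+v. F v * indicator {0..} v + F (- v) * indicator {0..} (- v) \<partial>lborel)"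
    by (intro nn_integral_mono) (auto simp: indicator_def abs_if)
  also have "\<dots> = (\<integral>\<^sup>+v. F v * indicator {0..} v \<partial>lborel) + (\<integral>\<^sup>+v. F (- v) * indicator {0..} (- v) \<partial>lborel)"
    by (rule nn_integral_add) auto
  also have "(\<integral>\<^sup>+v. F (- v) * indicator {0..} (- v) \<partial>lborel) = (\<integral>\<^sup>+v. F v * indicator {0..} v \<partial>lborel)"
    by (subst nn_integral_real_affine[of "\<lambda>v. F v * indicator {0..} v" "-1" 0]) auto
  finally show ?thesis by (simp add: mult_2)
qed

lemma exponential_density_le: "a > 0 \<Longrightarrow> exponential_density a v \<le> a"
  by (auto simp: exponential_density_def)

text \<open>The exponential density is at most its rate, so the average is dominated by a Lebesgue
  integral, uniformly in the centre t.\<close>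

lemma nn_integral_expo_le:
  fixes F :: "real \<Rightarrow> ennreal"
  assumes [measurable]: "F \<in> borel_measurable borel" and a: "a > 0"
  shows "(\<integral>\<^sup>+v. F \<bar>t - v\<bar> \<partial>expo a) \<le> 2 * ennreal a * (\<integral>\<^sup>+v. F v * indicator {0..} v \<partial>lborel)"
proof -
  have "(\<integral>\<^sup>+v. F \<bar>t - v\<bar> \<partial>expo a) = (\<integral>\<^sup>+v. ennreal (exponential_density a v) * F \<bar>t - v\<bar> \<partial>lborel)"
    unfolding expo_def by (rule nn_integral_density) auto
  also have "\<dots> \<le> (\<integral>\<^sup>+v. ennreal a * F \<bar>t - v\<bar> \<partial>lborel)"
    by (intro nn_integral_mono mult_right_mono ennreal_leI exponential_density_le a) auto
  also have "\<dots> = ennreal a * (\<integral>\<^sup>+v. F \<bar>t - v\<bar> \<partial>lborel)"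
    by (rule nn_integral_cmult) auto
  also have "\<dots> \<le> ennreal a * (2 * (\<integral>\<^sup>+v. F v * indicator {0..} v \<partial>lborel))"
    by (intro mult_left_mono nn_integral_abs_diff_le) auto
  finally show ?thesis by (simp add: mult_ac)
qed

lemma has_real_derivative_kernel:
  fixes D b x :: real
  assumes "D + x > 0" "b \<noteq> 1"
  shows "((\<lambda>x. (D + x) powr (1 - b) / (1 - b)) has_real_derivative (D + x) powr (- b)) (at x)"
proof -
  have "((\<lambda>x. (D + x) powr (1 - b)) has_real_derivative (1 - b) * (D + x) powr (1 - b - 1)) (at x)"
    using assms by (auto intro!: derivative_eq_intros)
  from DERIV_cdivide[OF this, of "1 - b"] show ?thesis using assms by simp
qed

text \<open>For b > 1 the integral is dominated by the v within distance of order D of t, whence the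
  power of D.\<close>

lemma nn_integral_kernel_super:
  assumes a: "a > 0" and b: "b > 1" and D: "D > 0"
  shows "(\<integral>\<^sup>+v. ennreal ((D + \<bar>t - v\<bar>) powr (- b)) \<partial>expo a) \<le> ennreal (2 * a / (b - 1) * D powr (1 - b))"
proof -
  have "(\<integral>\<^sup>+v. ennreal ((D + \<bar>v\<bar>) powr (- b)) * indicator {0..} v \<partial>lborel)
      = (\<integral>\<^sup>+v. ennreal ((D + v) powr (- b)) * indicator {0..} v \<partial>lborel)"
    by (intro nn_integral_cong) (auto simp: indicator_def)
  also have "\<dots> = 0 - (D + 0) powr (1 - b) / (1 - b)"
  proof (rule nn_integral_FTC_atLeast)
    show "((\<lambda>x. (D + x) powr (1 - b) / (1 - b)) has_real_derivative (D + x) powr (- b)) (at x)" if "0 \<le> x" for x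
      using that D b by (intro has_real_derivative_kernel) auto
    have "((\<lambda>x. x powr (1 - b)) \<longlongrightarrow> 0) at_top"
      using b by (intro tendsto_neg_powr filterlim_ident) auto
    then have "((\<lambda>x. (D + x) powr (1 - b)) \<longlongrightarrow> 0) at_top"
      by (rule filterlim_compose) (intro filterlim_tendsto_add_at_top[OF tendsto_const] filterlim_ident)
    then show "((\<lambda>x. (D + x) powr (1 - b) / (1 - b)) \<longlongrightarrow> 0) at_top"
      using tendsto_divide[of "\<lambda>x. (D + x) powr (1 - b)" 0 at_top "\<lambda>_. 1 - b" "1 - b"] b by simp
  qed auto
  finally have 1: "(\<integral>\<^sup>+v. ennreal ((D + \<bar>v\<bar>) powr (- b)) * indicator {0..} v \<partial>lborel) = ennreal (D powr (1 - b) / (b - 1))"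
    using b by (simp add: minus_divide_right)
  have "(\<integral>\<^sup>+v. ennreal ((D + \<bar>t - v\<bar>) powr (- b)) \<partial>expo a) \<le> 2 * ennreal a * ennreal (D powr (1 - b) / (b - 1))"
    using nn_integral_expo_le[of "\<lambda>x. ennreal ((D + \<bar>x\<bar>) powr (- b))" a t, OF _ a] unfolding 1 by simp
  also have "\<dots> = ennreal (2 * a / (b - 1) * D powr (1 - b))"
    using a b by (simp add: ennreal_mult[symmetric] ennreal_numeral[symmetric] del: ennreal_numeral)
  finally show ?thesis .
qed

text \<open>With s = x + y, the fractions x / s and y / s lie in [0, 1], hence are at most their
  b-th powers, and they add up to 1.\<close>

lemma powr_subadditive:
  fixes x y b :: real
  assumes "x \<ge> 0" "y \<ge> 0" "0 \<le> b" "b \<le> 1"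
  shows "(x + y) powr b \<le> x powr b + y powr b"
proof (cases "x + y = 0")
  case False
  define s where "s = x + y"
  have s: "s > 0" using False assms by (simp add: s_def)
  have *: "z / s * s powr b \<le> z powr b" if "0 \<le> z" "z \<le> s" for z
  proof (cases "z = 0")
    case False
    have "z / s = (z / s) powr 1" using that False s by simp
    also have "\<dots> \<le> (z / s) powr b"
      using that s assms by (intro powr_mono') auto
    finally have "z / s * s powr b \<le> (z / s) powr b * s powr b" by (intro mult_right_mono) auto
    also have "\<dots> = z powr b" using s that by (simp add: powr_divide)
    finally show ?thesis .
  qed simp
  have "s powr b = x / s * s powr b + y / s * s powr b"
    using s by (simp add: add_divide_distrib[symmetric] s_def distrib_right[symmetric])
  also have "\<dots> \<le> x powr b + y powr b"
    using assms by (intro add_mono *) (auto simp: s_def)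
  finally show ?thesis by (simp add: s_def)
qed (use assms in auto)

text \<open>For b < 1 the singularity at v = t stays integrable as D tends to 0. Within distance 1
  of t the primitive grows by at most 1 / (1 - b), by subadditivity of the power; further away the
  kernel is at most 1.\<close>

lemma nn_integral_kernel_sub:
  assumes a: "a > 0" and b: "0 \<le> b" "b < 1" and D: "D > 0"
  shows "(\<integral>\<^sup>+v. ennreal ((D + \<bar>t - v\<bar>) powr (- b)) \<partial>expo a) \<le> ennreal (2 * a / (1 - b) + 1)"
proof -
  interpret prob_space "expo a" by (rule prob_space_expo[OF a])
  define F where "F x = ennreal ((D + \<bar>x\<bar>) powr (- b)) * indicator {..1} x" for x
  have [measurable]: "F \<in> borel_measurable borel" unfolding F_def by measurable
  have "(\<integral>\<^sup>+v. F v * indicator {0..} v \<partial>lborel) = (\<integral>\<^sup>+v. ennreal ((D + v) powr (- b)) * indicator {0..1} v \<partial>lborel)"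
    by (intro nn_integral_cong) (auto simp: indicator_def F_def)
  also have "\<dots> = (D + 1) powr (1 - b) / (1 - b) - (D + 0) powr (1 - b) / (1 - b)"
  proof (rule nn_integral_FTC_Icc)
    show "((\<lambda>x. (D + x) powr (1 - b) / (1 - b)) has_real_derivative (D + x) powr (- b)) (at x)" if "x \<in> {0..1}" for x
      using that D b by (intro has_real_derivative_kernel) auto
  qed auto
  also have "\<dots> \<le> ennreal (1 / (1 - b))"
  proof (rule ennreal_leI)
    have "(D + 1) powr (1 - b) \<le> D powr (1 - b) + 1 powr (1 - b)"
      using D b by (intro powr_subadditive) auto
    then show "(D + 1) powr (1 - b) / (1 - b) - (D + 0) powr (1 - b) / (1 - b) \<le> 1 / (1 - b)"
      using b by (simp add: diff_divide_distrib[symmetric] divide_right_mono)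
  qed
  finally have 1: "(\<integral>\<^sup>+v. F v * indicator {0..} v \<partial>lborel) \<le> ennreal (1 / (1 - b))" .
  have "(\<integral>\<^sup>+v. ennreal ((D + \<bar>t - v\<bar>) powr (- b)) \<partial>expo a) \<le> (\<integral>\<^sup>+v. F \<bar>t - v\<bar> + 1 \<partial>expo a)"
  proof (rule nn_integral_mono)
    fix v
    show "ennreal ((D + \<bar>t - v\<bar>) powr (- b)) \<le> F \<bar>t - v\<bar> + 1"
    proof (cases "\<bar>t - v\<bar> \<le> 1")
      case False
      then have "(D + \<bar>t - v\<bar>) powr (- b) \<le> 1 powr (- b)"
        using D b by (intro powr_mono2') auto
      then show ?thesis by (simp add: add_increasing)
    qed (simp add: F_def)
  qed
  also have "\<dots> = (\<integral>\<^sup>+v. F \<bar>t - v\<bar> \<partial>expo a) + 1"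
    using emeasure_space_1 by (subst nn_integral_add) auto
  also have "\<dots> \<le> 2 * ennreal a * ennreal (1 / (1 - b)) + 1"
    by (intro add_right_mono order_trans[OF nn_integral_expo_le] mult_left_mono 1 a) auto
  also have "\<dots> = ennreal (2 * a / (1 - b) + 1)"
    using a b by (simp add: ennreal_mult[symmetric] ennreal_numeral[symmetric] ennreal_plus[symmetric] ennreal_1[symmetric] del: ennreal_numeral ennreal_plus ennreal_1)
  finally show ?thesis .
qed

text \<open>Halving the rate frees a factor exp (a v / 2), which dominates 1 + v up to
  \<open>1 + 2 / a\<close>; the remaining 2 offsets the smaller normalising constant of the slower
  density.\<close>

lemma exponential_density_tilt:
  fixes a b v :: real
  assumes a: "a > 0" and b: "0 \<le> b" "b \<le> 1" and v: "v \<ge> 0"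
  shows "exponential_density a v * v powr b \<le> 2 * (1 + 2 / a) * exponential_density (a / 2) v"
proof -
  have "v powr b \<le> 1 + v"
  proof (cases "v \<le> 1")
    case True
    then have "v powr b \<le> 1" using v b by (intro powr_le1) auto
    then show ?thesis using v by simp
  next
    case False
    then have "v powr b \<le> v powr 1" using b by (intro powr_mono) auto
    then show ?thesis using False by simp
  qed
  also have "\<dots> \<le> (1 + 2 / a) * (1 + a / 2 * v)"
    using a v by (simp add: field_simps)
  also have "\<dots> \<le> (1 + 2 / a) * exp (a / 2 * v)"
    using a v by (intro mult_left_mono exp_ge_add_one_self) auto
  finally have "a * exp (- (a * v)) * v powr b \<le> a * exp (- (a * v)) * ((1 + 2 / a) * exp (a / 2 * v))"
    using a by (intro mult_left_mono) auto
  also have "\<dots> = (1 + 2 / a) * (a * exp (- (a * v) + a / 2 * v))"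
    by (simp only: exp_add mult_ac)
  also have "\<dots> = 2 * (1 + 2 / a) * exponential_density (a / 2) v"
    using v by (simp add: exponential_density_def mult.commute)
  finally show ?thesis using v by (simp add: exponential_density_def mult.commute)
qed

text \<open>For v >= 0, (D + |t|)^b <= (D + |t - v|)^b + v^b. Divided by (D + |t|)^b and multiplied
  by the kernel, the first term gives the wanted decay. In the second, v^b is absorbed by halving
  the rate, and the undecayed bound at rate a / 2 contributes \<open>a / (1 - b) + 1\<close>. The
  constant depends neither on D nor on t.\<close>

lemma nn_integral_kernel_decay:
  assumes a: "a > 0" and b: "0 \<le> b" "b < 1" and D: "D > 0"
  shows "(\<integral>\<^sup>+v. ennreal ((D + \<bar>t - v\<bar>) powr (- b)) \<partial>expo a) \<le>
    ennreal ((1 + 2 * (1 + 2 / a) * (a / (1 - b) + 1)) * (D + \<bar>t\<bar>) powr (- b))"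
proof -
  interpret prob_space "expo a" by (rule prob_space_expo[OF a])
  define F where "F v = (D + \<bar>t - v\<bar>) powr (- b)" for v
  have F0: "F v \<ge> 0" for v by (simp add: F_def)
  have [measurable]: "F \<in> borel_measurable borel" unfolding F_def by measurable
  define q where "q = (D + \<bar>t\<bar>) powr (- b)"
  define c where "c = 2 * (1 + 2 / a)"
  have c: "c \<ge> 0" using a by (simp add: c_def)
  have q0: "q \<ge> 0" by (simp add: q_def)
  have dens0: "exponential_density a' v \<ge> 0" if "a' > 0" for a' v
    using that by (simp add: exponential_density_nonneg)
  have pt: "exponential_density a v * F v \<le> q * exponential_density a v + q * c * (exponential_density (a/2) v * F v)" for v
  proof (cases "v \<ge> 0")
    case True
    have "(D + \<bar>t\<bar>) powr b \<le> ((D + \<bar>t - v\<bar>) + v) powr b"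
      using True D b by (intro powr_mono2) auto
    also have "\<dots> \<le> (D + \<bar>t - v\<bar>) powr b + v powr b"
      using True D b by (intro powr_subadditive) auto
    finally have "F v * (D + \<bar>t\<bar>) powr b \<le> F v * ((D + \<bar>t - v\<bar>) powr b + v powr b)"
      using F0 by (intro mult_left_mono)
    also have "\<dots> = 1 + v powr b * F v"
      using D by (simp add: F_def distrib_left powr_add[symmetric] mult_ac)
    finally have "F v * (D + \<bar>t\<bar>) powr b * q \<le> (1 + v powr b * F v) * q" using q0 by (intro mult_right_mono)
    moreover have "F v * (D + \<bar>t\<bar>) powr b * q = F v"
      using D by (simp add: q_def powr_add[symmetric] mult.assoc)
    ultimately have "F v \<le> (1 + v powr b * F v) * q" by simp
    then have "exponential_density a v * F v \<le> exponential_density a v * ((1 + v powr b * F v) * q)"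
      using dens0[OF a] by (intro mult_left_mono)
    also have "\<dots> = q * exponential_density a v + q * ((exponential_density a v * v powr b) * F v)"
      by (simp add: algebra_simps)
    also have "\<dots> \<le> q * exponential_density a v + q * ((c * exponential_density (a/2) v) * F v)"
      unfolding c_def using a b True q0 F0
      by (intro add_left_mono mult_left_mono mult_right_mono exponential_density_tilt) auto
    finally show ?thesis by (simp add: mult_ac)
  qed (simp add: exponential_density_def)
  have "(\<integral>\<^sup>+v. ennreal (F v) \<partial>expo a) = (\<integral>\<^sup>+v. ennreal (exponential_density a v) * ennreal (F v) \<partial>lborel)"
    unfolding expo_def by (rule nn_integral_density) auto
  also have "\<dots> \<le> (\<integral>\<^sup>+v. ennreal q * ennreal (exponential_density a v) + ennreal (q * c) * (ennreal (exponential_density (a/2) v) * ennreal (F v)) \<partial>lborel)"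
    using pt q0 c F0 a dens0
    by (intro nn_integral_mono) (simp add: ennreal_mult[symmetric] ennreal_plus[symmetric] del: ennreal_plus)
  also have "\<dots> = ennreal q * (\<integral>\<^sup>+v. ennreal (exponential_density a v) \<partial>lborel)
      + ennreal (q * c) * (\<integral>\<^sup>+v. ennreal (exponential_density (a/2) v) * ennreal (F v) \<partial>lborel)"
    by (subst nn_integral_add) (auto simp: nn_integral_cmult)
  also have "(\<integral>\<^sup>+v. ennreal (exponential_density a v) \<partial>lborel) = 1"
    using emeasure_space_1 by (simp add: expo_def emeasure_density)
  also have "(\<integral>\<^sup>+v. ennreal (exponential_density (a/2) v) * ennreal (F v) \<partial>lborel) = (\<integral>\<^sup>+v. ennreal (F v) \<partial>expo (a/2))"
    unfolding expo_def by (rule nn_integral_density[symmetric]) auto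
  also have "ennreal q * 1 + ennreal (q * c) * \<dots> \<le> ennreal q * 1 + ennreal (q * c) * ennreal (2 * (a / 2) / (1 - b) + 1)"
    unfolding F_def using a b D by (intro add_left_mono mult_left_mono nn_integral_kernel_sub) auto
  also have "\<dots> = ennreal ((1 + c * (a / (1 - b) + 1)) * q)"
    using q0 c a b by (simp add: ennreal_mult[symmetric] ennreal_plus[symmetric] algebra_simps del: ennreal_plus)
  finally show ?thesis by (simp add: F_def q_def c_def)
qed

lemma integrable_kernel:
  assumes a: "a > 0" and b: "0 \<le> b" and D: "D > 0"
  shows "integrable (expo a) (\<lambda>v. (D + \<bar>t - v\<bar>) powr (- b))"
proof -
  interpret prob_space "expo a" by (rule prob_space_expo[OF a])
  show ?thesis
    using b D by (intro integrable_const_bound[where B="D powr (- b)"] AE_I2) (auto intro!: powr_mono2')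
qed

lemma integral_le_of_nn_integral:
  assumes "integrable M f" "\<And>x. f x \<ge> 0" "(\<integral>\<^sup>+x. ennreal (f x) \<partial>M) \<le> ennreal C" "C \<ge> 0"
  shows "(\<integral>x. f x \<partial>M) \<le> C"
  using assms by (subst (asm) nn_integral_eq_integral) auto

lemma integral_kernel_sub:
  assumes a: "a > 0" and b: "0 \<le> b" "b < 1" and D: "D > 0"
  shows "(\<integral>v. (D + \<bar>t - v\<bar>) powr (- b) \<partial>expo a) \<le> 2 * a / (1 - b) + 1"
  using assms by (intro integral_le_of_nn_integral integrable_kernel nn_integral_kernel_sub) (auto intro!: add_nonneg_nonneg)

lemma integral_kernel_super:
  assumes a: "a > 0" and b: "1 < b" and D: "D > 0"
  shows "(\<integral>v. (D + \<bar>t - v\<bar>) powr (- b) \<partial>expo a) \<le> 2 * a / (b - 1) * D powr (1 - b)"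
  using assms by (intro integral_le_of_nn_integral integrable_kernel nn_integral_kernel_super) auto

lemma integral_kernel_decay:
  assumes a: "a > 0" and b: "0 \<le> b" "b < 1" and D: "D > 0"
  shows "(\<integral>v. (D + \<bar>t - v\<bar>) powr (- b) \<partial>expo a) \<le> (1 + 2 * (1 + 2 / a) * (a / (1 - b) + 1)) * (D + \<bar>t\<bar>) powr (- b)"
  using assms by (intro integral_le_of_nn_integral integrable_kernel nn_integral_kernel_decay) (auto intro!: add_nonneg_nonneg mult_nonneg_nonneg)

text \<open>
  The same covariance for the normalised Ornstein-Uhlenbeck processes with rates a and a'. It comes
  from the representation of the increment at s as X s - E (X (s - T)), where X s is the increment of
  the fractional Brownian motion and the mean is over an independent exponential time T.
\<close>

definition fou_cov :: "real \<Rightarrow> real \<Rightarrow> real \<Rightarrow> real \<Rightarrow> real \<Rightarrow> real \<Rightarrow> real \<Rightarrow> real" where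
  "fou_cov r e h D a a' x = incr_cov r e h D x - (\<integral>v. incr_cov r e h D (x - v) \<partial>expo a')
     - (\<integral>u. incr_cov r e h D (x + u) \<partial>expo a)
     + (\<integral>u. \<integral>v. incr_cov r e h D (x + u - v) \<partial>expo a' \<partial>expo a)"

lemma abs_integral_le:
  fixes f g :: "real \<Rightarrow> real"
  assumes "integrable M g" "\<And>x. \<bar>f x\<bar> \<le> g x"
  shows "\<bar>\<integral>x. f x \<partial>M\<bar> \<le> (\<integral>x. g x \<partial>M)"
proof -
  have "\<bar>\<integral>x. f x \<partial>M\<bar> \<le> (\<integral>x. \<bar>f x\<bar> \<partial>M)" by (rule integral_abs_bound)
  also have "\<dots> \<le> (\<integral>x. g x \<partial>M)"
    using assms by (intro integral_mono') (auto intro: order_trans[OF abs_ge_zero])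
  finally show ?thesis .
qed

text \<open>Each of the three corrections averages \<open>incr_cov\<close> over one or two
  exponential times; in the double average the inner bound is uniform in u, so the outer average
  costs nothing.\<close>

lemma fou_cov_minus_incr_cov:
  assumes a: "a > 0" "a' > 0" and b: "0 \<le> b" and D: "D > 0" and c: "c \<ge> 0"
    and g: "\<And>x. \<bar>incr_cov r e h D x\<bar> \<le> c * (D + \<bar>x\<bar>) powr (- b)"
    and \<kappa>: "\<And>t. (\<integral>v. (D + \<bar>t - v\<bar>) powr (- b) \<partial>expo a) \<le> \<kappa>" "\<And>t. (\<integral>v. (D + \<bar>t - v\<bar>) powr (- b) \<partial>expo a') \<le> \<kappa>"
  shows "\<bar>fou_cov r e h D a a' x - incr_cov r e h D x\<bar> \<le> 3 * (c * \<kappa>)"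
proof -
  interpret A: prob_space "expo a" by (rule prob_space_expo[OF a(1)])
  have m: "\<bar>\<integral>v. incr_cov r e h D (t - v) \<partial>expo a'\<bar> \<le> c * \<kappa>" for t
  proof -
    have "\<bar>\<integral>v. incr_cov r e h D (t - v) \<partial>expo a'\<bar> \<le> (\<integral>v. c * (D + \<bar>t - v\<bar>) powr (- b) \<partial>expo a')"
      using a b D by (intro abs_integral_le integrable_mult_right integrable_kernel g)
    also have "\<dots> = c * (\<integral>v. (D + \<bar>t - v\<bar>) powr (- b) \<partial>expo a')" by simp
    also have "\<dots> \<le> c * \<kappa>" using c \<kappa> by (intro mult_left_mono)
    finally show ?thesis .
  qed
  have p: "\<bar>\<integral>u. incr_cov r e h D (x + u) \<partial>expo a\<bar> \<le> c * \<kappa>"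
  proof -
    have "\<bar>incr_cov r e h D (x + u)\<bar> \<le> c * (D + \<bar>- x - u\<bar>) powr (- b)" for u
      using g[of "x + u"] abs_minus_cancel[of "x + u"] by simp
    then have "\<bar>\<integral>u. incr_cov r e h D (x + u) \<partial>expo a\<bar> \<le> (\<integral>u. c * (D + \<bar>- x - u\<bar>) powr (- b) \<partial>expo a)"
      using a b D by (intro abs_integral_le integrable_mult_right integrable_kernel)
    also have "\<dots> = c * (\<integral>u. (D + \<bar>- x - u\<bar>) powr (- b) \<partial>expo a)" by (rule integral_mult_right_zero)
    also have "\<dots> \<le> c * \<kappa>" using c \<kappa> by (intro mult_left_mono)
    finally show ?thesis .
  qed
  have "\<bar>\<integral>u. \<integral>v. incr_cov r e h D (x + u - v) \<partial>expo a' \<partial>expo a\<bar> \<le> (\<integral>u. c * \<kappa> \<partial>expo a)"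
    by (intro abs_integral_le m) simp
  also have "\<dots> = c * \<kappa>" using A.prob_space by simp
  finally show ?thesis using m[of x] p by (simp add: fou_cov_def)
qed

text \<open>Every average over an exponential time reproduces the decay up to a factor independent
  of the step and of the lag. The four terms of \<open>fou_cov\<close> give the four summands of the
  constant.\<close>

lemma fou_cov_decay:
  assumes h: "0 < h" "h < 2" and b: "0 \<le> b" "b < 1" "b \<le> 2 - h" and a: "a > 0" "a' > 0"
  obtains C where "C \<ge> 0"
    "\<And>D x. D > 0 \<Longrightarrow> \<bar>fou_cov r e h D a a' x\<bar> \<le> C * D powr (h + b) * (D + \<bar>x\<bar>) powr (- b)"
proof -
  define k where "k a = 1 + 2 * (1 + 2 / a) * (a / (1 - b) + 1)" for a
  have k: "k a \<ge> 0" if "a > 0" for a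
    using that b by (auto simp: k_def intro!: add_nonneg_nonneg mult_nonneg_nonneg)
  define c0 where "c0 = 18 * (\<bar>r\<bar> + \<bar>e\<bar>)"
  have c0: "c0 \<ge> 0" by (simp add: c0_def)
  have "\<bar>fou_cov r e h D a a' x\<bar> \<le> (c0 * (1 + k a' + k a + k a' * k a)) * D powr (h + b) * (D + \<bar>x\<bar>) powr (- b)" if D: "D > 0" for D x
  proof -
    define c where "c = c0 * D powr (h + b)"
    have c: "c \<ge> 0" using c0 by (simp add: c_def)
    have g: "\<bar>incr_cov r e h D x\<bar> \<le> c * (D + \<bar>x\<bar>) powr (- b)" for x
      unfolding c_def c0_def by (rule incr_cov_bound[OF h b(3) D])
    have m: "\<bar>\<integral>v. incr_cov r e h D (t - v) \<partial>expo a'\<bar> \<le> c * k a' * (D + \<bar>t\<bar>) powr (- b)" for t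
    proof -
      have "\<bar>\<integral>v. incr_cov r e h D (t - v) \<partial>expo a'\<bar> \<le> (\<integral>v. c * (D + \<bar>t - v\<bar>) powr (- b) \<partial>expo a')"
        using a b D by (intro abs_integral_le integrable_mult_right integrable_kernel g)
      also have "\<dots> = c * (\<integral>v. (D + \<bar>t - v\<bar>) powr (- b) \<partial>expo a')" by simp
      also have "\<dots> \<le> c * (k a' * (D + \<bar>t\<bar>) powr (- b))"
        unfolding k_def using c a b D by (intro mult_left_mono integral_kernel_decay)
      finally show ?thesis by (simp add: mult_ac)
    qed
    have q: "\<bar>\<integral>u. f u \<partial>expo a\<bar> \<le> c' * k a * (D + \<bar>x\<bar>) powr (- b)"
      if c': "c' \<ge> 0" and f: "\<And>u. \<bar>f u\<bar> \<le> c' * (D + \<bar>x + u\<bar>) powr (- b)" for f c'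
    proof -
      have "\<bar>f u\<bar> \<le> c' * (D + \<bar>- x - u\<bar>) powr (- b)" for u
        using f[of u] abs_minus_cancel[of "x + u"] by simp
      then have "\<bar>\<integral>u. f u \<partial>expo a\<bar> \<le> (\<integral>u. c' * (D + \<bar>- x - u\<bar>) powr (- b) \<partial>expo a)"
        using a b D by (intro abs_integral_le integrable_mult_right integrable_kernel)
      also have "\<dots> = c' * (\<integral>u. (D + \<bar>- x - u\<bar>) powr (- b) \<partial>expo a)" by (rule integral_mult_right_zero)
      also have "\<dots> \<le> c' * (k a * (D + \<bar>- x\<bar>) powr (- b))"
        unfolding k_def using c' a b D by (intro mult_left_mono integral_kernel_decay)
      finally show ?thesis by (simp add: mult_ac)
    qed
    have "\<bar>fou_cov r e h D a a' x\<bar> \<le> c * (D + \<bar>x\<bar>) powr (- b) + c * k a' * (D + \<bar>x\<bar>) powr (- b)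
        + c * k a * (D + \<bar>x\<bar>) powr (- b) + c * k a' * k a * (D + \<bar>x\<bar>) powr (- b)"
      using g[of x] m[of x] q[OF c g] q[OF mult_nonneg_nonneg[OF c k[OF a(2)]] m]
      unfolding fou_cov_def by linarith
    also have "\<dots> = (c0 * (1 + k a' + k a + k a' * k a)) * D powr (h + b) * (D + \<bar>x\<bar>) powr (- b)"
      by (simp add: c_def algebra_simps)
    finally show ?thesis .
  qed
  moreover have "c0 * (1 + k a' + k a + k a' * k a) \<ge> 0"
    using c0 k a by (intro mult_nonneg_nonneg add_nonneg_nonneg) auto
  ultimately show ?thesis using that by blast
qed

text \<open>For b < 1 the corrections are of order D^(h + b), smaller by D^b than the scale D^h of
  the main term. If h > 1, the exponent b = 2 - h is available.\<close>

lemma fou_cov_approx_sub: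
  assumes h: "0 < h" "h < 2" and b: "0 \<le> b" "b < 1" "b \<le> 2 - h" and a: "a > 0" "a' > 0"
  obtains C where "\<And>D x. D > 0 \<Longrightarrow> \<bar>fou_cov r e h D a a' x - incr_cov r e h D x\<bar> \<le> C * D powr (h + b)"
proof -
  define \<kappa> where "\<kappa> = (2 * a / (1 - b) + 1) + (2 * a' / (1 - b) + 1)"
  have p: "2 * a / (1 - b) + 1 \<ge> 0" "2 * a' / (1 - b) + 1 \<ge> 0" using a b by (auto intro!: add_nonneg_nonneg)
  have "\<bar>fou_cov r e h D a a' x - incr_cov r e h D x\<bar> \<le> 3 * (18 * (\<bar>r\<bar> + \<bar>e\<bar>) * \<kappa>) * D powr (h + b)" if D: "D > 0" for D x
  proof -
    have "\<bar>fou_cov r e h D a a' x - incr_cov r e h D x\<bar> \<le> 3 * (18 * (\<bar>r\<bar> + \<bar>e\<bar>) * D powr (h + b) * \<kappa>)"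
    proof (rule fou_cov_minus_incr_cov[OF a b(1) D])
      show "\<bar>incr_cov r e h D x\<bar> \<le> 18 * (\<bar>r\<bar> + \<bar>e\<bar>) * D powr (h + b) * (D + \<bar>x\<bar>) powr (- b)" for x
        by (rule incr_cov_bound[OF h b(3) D])
      show "(\<integral>v. (D + \<bar>t - v\<bar>) powr (- b) \<partial>expo a) \<le> \<kappa>" for t
        using integral_kernel_sub[OF a(1) b(1,2) D, of t] p by (simp add: \<kappa>_def)
      show "(\<integral>v. (D + \<bar>t - v\<bar>) powr (- b) \<partial>expo a') \<le> \<kappa>" for t
        using integral_kernel_sub[OF a(2) b(1,2) D, of t] p by (simp add: \<kappa>_def)
    qed simp
    then show ?thesis by (simp only: mult_ac)
  qed
  then show ?thesis using that by blast
qed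

text \<open>For h < 1 the full exponent 2 - h exceeds 1 and averaging contributes D^(h - 1).
  Together with D^2 from the decay bound this makes D^(h + 1), a better order than any b < 1
  provides.\<close>

lemma fou_cov_approx_super:
  assumes h: "0 < h" "h < 1" and a: "a > 0" "a' > 0"
  obtains C where "\<And>D x. D > 0 \<Longrightarrow> \<bar>fou_cov r e h D a a' x - incr_cov r e h D x\<bar> \<le> C * D powr (h + 1)"
proof -
  define \<kappa> where "\<kappa> = 2 * a / (1 - h) + 2 * a' / (1 - h)"
  have p: "2 * a / (1 - h) \<ge> 0" "2 * a' / (1 - h) \<ge> 0" using a h by auto
  have "\<bar>fou_cov r e h D a a' x - incr_cov r e h D x\<bar> \<le> 3 * (18 * (\<bar>r\<bar> + \<bar>e\<bar>) * \<kappa>) * D powr (h + 1)" if D: "D > 0" for D x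
  proof -
    have "\<bar>fou_cov r e h D a a' x - incr_cov r e h D x\<bar> \<le> 3 * (18 * (\<bar>r\<bar> + \<bar>e\<bar>) * D powr (h + (2 - h)) * (\<kappa> * D powr (h - 1)))"
    proof (rule fou_cov_minus_incr_cov[OF a _ D])
      show "\<bar>incr_cov r e h D x\<bar> \<le> 18 * (\<bar>r\<bar> + \<bar>e\<bar>) * D powr (h + (2 - h)) * (D + \<bar>x\<bar>) powr (- (2 - h))" for x
        using h by (intro incr_cov_bound[OF _ _ _ D]) auto
      have e: "2 - h - 1 = 1 - h" "1 - (2 - h) = h - 1" by auto
      show "(\<integral>v. (D + \<bar>t - v\<bar>) powr (- (2 - h)) \<partial>expo a) \<le> \<kappa> * D powr (h - 1)" for t
        using integral_kernel_super[OF a(1) _ D, of "2 - h" t] h p mult_nonneg_nonneg[OF p(2), of "D powr (h - 1)"]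
        unfolding e \<kappa>_def distrib_right by simp
      show "(\<integral>v. (D + \<bar>t - v\<bar>) powr (- (2 - h)) \<partial>expo a') \<le> \<kappa> * D powr (h - 1)" for t
        using integral_kernel_super[OF a(2) _ D, of "2 - h" t] h p mult_nonneg_nonneg[OF p(1), of "D powr (h - 1)"]
        unfolding e \<kappa>_def distrib_right by simp
    qed (use h in auto)
    also have "D powr (h + (2 - h)) = D powr (h + 1) * D powr (1 - h)" by (simp add: powr_add[symmetric])
    also have "3 * (18 * (\<bar>r\<bar> + \<bar>e\<bar>) * (D powr (h + 1) * D powr (1 - h)) * (\<kappa> * D powr (h - 1))) =
        3 * (18 * (\<bar>r\<bar> + \<bar>e\<bar>) * \<kappa>) * D powr (h + 1) * (D powr (1 - h) * D powr (h - 1))"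
      by (simp only: mult_ac)
    also have "D powr (1 - h) * D powr (h - 1) = 1" using D by (simp add: powr_add[symmetric])
    finally show ?thesis by simp
  qed
  then show ?thesis using that by blast
qed


section \<open>Gaussianity of the Ornstein-Uhlenbeck increments\<close>

lemma integrable_mult_of_squares:
  fixes X Y :: "'w \<Rightarrow> real"
  assumes [measurable]: "X \<in> borel_measurable M" "Y \<in> borel_measurable M"
    and i: "integrable M (\<lambda>\<omega>. (X \<omega>)\<^sup>2)" "integrable M (\<lambda>\<omega>. (Y \<omega>)\<^sup>2)"
  shows "integrable M (\<lambda>\<omega>. X \<omega> * Y \<omega>)"
proof (rule Bochner_Integration.integrable_bound)
  show "integrable M (\<lambda>\<omega>. (X \<omega>)\<^sup>2 + (Y \<omega>)\<^sup>2)" using i by simp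
  have "\<bar>x * y\<bar> \<le> x\<^sup>2 + y\<^sup>2" for x y :: real
  proof -
    have "2 * (\<bar>x\<bar> * \<bar>y\<bar>) \<le> x\<^sup>2 + y\<^sup>2"
      using sum_squares_bound[of "\<bar>x\<bar>" "\<bar>y\<bar>"] by (simp add: mult.assoc)
    moreover have "0 \<le> \<bar>x\<bar> * \<bar>y\<bar>" by simp
    ultimately show ?thesis unfolding abs_mult by linarith
  qed
  then show "AE \<omega> in M. norm (X \<omega> * Y \<omega>) \<le> norm ((X \<omega>)\<^sup>2 + (Y \<omega>)\<^sup>2)" by simp
qed simp

text \<open>Square integrability comes from one-element index sets; expanding the mean square of a
  combination then identifies its variance with the double sum of covariances.\<close>

lemma gauss_fam_of_gaussian_process:
  assumes M: "prob_space M" and X: "gaussian_process M X" and mean: "\<And>i. prob_space.expectation M (X i) = 0"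
  shows "gauss_fam M X (\<lambda>i j. prob_space.expectation M (\<lambda>\<omega>. X i \<omega> * X j \<omega>))"
  unfolding gauss_fam_def
proof (intro conjI allI impI)
  interpret prob_space M by (rule M)
  show m [measurable]: "X i \<in> borel_measurable M" for i using X by (simp add: gaussian_process_def)
  have gp: "\<exists>m v. v \<ge> 0 \<and> distr M borel (\<lambda>\<omega>. \<Sum>i\<in>I. c i * X i \<omega>) = gaussian_measure m v" if "finite I" for I c
    using X that by (simp add: gaussian_process_def)
  have sq: "integrable M (X i)" "integrable M (\<lambda>\<omega>. (X i \<omega>)\<^sup>2)" for i
  proof -
    obtain m v where "v \<ge> 0" "distr M borel (X i) = gaussian_measure m v"
      using gp[of "{i}" "\<lambda>_. 1"] by auto
    from gaussian_measure_moments(1,2)[OF M m this(2,1)]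
    show "integrable M (X i)" "integrable M (\<lambda>\<omega>. (X i \<omega>)\<^sup>2)" .
  qed
  have pr: "integrable M (\<lambda>\<omega>. X i \<omega> * X j \<omega>)" for i j
    by (intro integrable_mult_of_squares m sq)
  fix L :: "nat set" and c f
  assume L: "finite L"
  define S where "S \<omega> = (\<Sum>l\<in>L. c l * X (f l) \<omega>)" for \<omega>
  have [measurable]: "S \<in> borel_measurable M" unfolding S_def by measurable
  \<comment> \<open>The selection \<open>f\<close> may repeat an index whereas
    \<open>gaussian_process\<close> sums over distinct ones, so coefficients of equal indices are
    merged.\<close>
  have S: "S = (\<lambda>\<omega>. \<Sum>i\<in>f ` L. (\<Sum>l\<in>{l\<in>L. f l = i}. c l) * X i \<omega>)"
    unfolding S_def sum.image_gen[OF L, of _ f] by (intro ext sum.cong refl) (simp add: sum_distrib_right)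
  have "\<exists>m v. v \<ge> 0 \<and> distr M borel S = gaussian_measure m v"
    unfolding S by (rule gp) (use L in simp)
  then obtain m v where v: "v \<ge> 0" and d: "distr M borel S = gaussian_measure m v"
    by blast
  note mom = gaussian_measure_moments[OF M \<open>S \<in> borel_measurable M\<close> d v]
  have "m = expectation S" using mom(3) by simp
  also have "\<dots> = 0" unfolding S_def using sq mean by simp
  finally have m0: "m = 0" .
  have "v = expectation (\<lambda>\<omega>. (S \<omega>)\<^sup>2)" using mom(4) m0 by simp
  also have "\<dots> = expectation (\<lambda>\<omega>. \<Sum>l\<in>L. \<Sum>k\<in>L. c l * c k * (X (f l) \<omega> * X (f k) \<omega>))"
    by (simp add: S_def power2_eq_square sum_product mult_ac)
  also have "\<dots> = (\<Sum>l\<in>L. \<Sum>k\<in>L. c l * c k * expectation (\<lambda>\<omega>. X (f l) \<omega> * X (f k) \<omega>))"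
    using pr by simp
  finally have v': "v = (\<Sum>l\<in>L. \<Sum>k\<in>L. c l * c k * expectation (\<lambda>\<omega>. X (f l) \<omega> * X (f k) \<omega>))" .
  have "(CLINT \<omega>|M. iexp (S \<omega>)) = char (distr M borel S) 1"
    by (simp add: char_def integral_distr)
  also have "\<dots> = complex_of_real (exp (- v / 2))"
    unfolding d char_gaussian_measure[OF v] m0 by simp
  finally show "(CLINT \<omega>|M. iexp (\<Sum>l\<in>L. c l * X (f l) \<omega>)) =
      complex_of_real (exp (- (\<Sum>l\<in>L. \<Sum>k\<in>L. c l * c k * expectation (\<lambda>\<omega>. X (f l) \<omega> * X (f k) \<omega>)) / 2))"
    unfolding v' S_def .
qed

text \<open>The parts \<open>p\<close> and \<open>q\<close> depend on one of the two times only and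
  cancel in the double difference, which leaves a function of the lag.\<close>

lemma gauss_fam_increments:
  fixes B :: "'c \<Rightarrow> real \<Rightarrow> 'w \<Rightarrow> real"
  assumes Z: "gauss_fam M (\<lambda>(i, t). B i t) KB"
    and KB: "\<And>i j s t. KB (i, s) (j, t) = (p i j s + q i j t - fbm_w (r i j) (e i j) (h i j) (t - s)) / 2"
  shows "gauss_fam M (\<lambda>(i, s) \<omega>. B i (s + D) \<omega> - B i s \<omega>)
           (\<lambda>(i, s) (j, t). incr_cov (r i j) (e i j) (h i j) D (t - s))"
proof -
  let ?d = "\<lambda>a b. if b then 1 else - 1 :: real"
  let ?g = "\<lambda>a b. (fst a, if b then snd a + D else snd a :: real)"
  have "gauss_fam M (\<lambda>a \<omega>. \<Sum>b\<in>UNIV. ?d a b * (\<lambda>(i, t). B i t) (?g a b) \<omega>)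
      (\<lambda>a a'. \<Sum>b\<in>UNIV. \<Sum>b'\<in>UNIV. ?d a b * ?d a' b' * KB (?g a b) (?g a' b'))"
    by (rule gauss_fam_linear[OF Z]) simp
  moreover have "(\<lambda>a \<omega>. \<Sum>b\<in>UNIV. ?d a b * (\<lambda>(i, t). B i t) (?g a b) \<omega>) = (\<lambda>(i, s) \<omega>. B i (s + D) \<omega> - B i s \<omega>)"
    by (simp add: fun_eq_iff UNIV_bool)
  moreover have "(\<lambda>a a'. \<Sum>b\<in>UNIV. \<Sum>b'\<in>UNIV. ?d a b * ?d a' b' * KB (?g a b) (?g a' b')) =
      (\<lambda>(i, s) (j, t). incr_cov (r i j) (e i j) (h i j) D (t - s))"
  proof -
    have "(\<Sum>b\<in>UNIV. \<Sum>b'\<in>UNIV. ?d (i, s) b * ?d (j, t) b' * KB (?g (i, s) b) (?g (j, t) b'))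
        = incr_cov (r i j) (e i j) (h i j) D (t - s)" for i s j t
    proof -
      have "t + D - (s + D) = t - s" "t - (s + D) = t - s - D" "t + D - s = t - s + D" by auto
      then show ?thesis by (simp add: UNIV_bool KB incr_cov_def field_simps)
    qed
    then show ?thesis by (simp add: fun_eq_iff)
  qed
  ultimately show ?thesis by simp
qed

section \<open>Riemann-Stieltjes sums and their covariances\<close>

definition step_time :: "real \<Rightarrow> nat \<Rightarrow> real \<Rightarrow> real" where
  "step_time \<delta> N v = real (min N (nat \<lceil>v / \<delta>\<rceil>)) * \<delta>"

lemma step_time_measurable [measurable]: "step_time \<delta> N \<in> borel_measurable borel"
  unfolding step_time_def by measurable

lemma integrable_expo_bounded:
  fixes f :: "real \<Rightarrow> real"
  assumes "a > 0" "f \<in> borel_measurable borel" "\<And>x. \<bar>f x\<bar> \<le> C"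
  shows "integrable (expo a) f"
proof -
  interpret prob_space "expo a" by (rule prob_space_expo[OF assms(1)])
  show ?thesis using assms by (intro integrable_const_bound[where B=C] AE_I2) auto
qed

lemma expo_greaterThan:
  assumes "a > 0" "x \<ge> 0"
  shows "measure (expo a) {x<..} = exp (- a * x)"
proof -
  interpret prob_space "expo a" by (rule prob_space_expo[OF assms(1)])
  have "distributed (expo a) lborel (\<lambda>x. x) (exponential_density a)"
    by (auto simp: distributed_def expo_def distr_id2 intro!: measurable_ident_sets)
  from exponential_distributedD_gt[OF this assms(2,1)]
  have "prob {xa \<in> space (expo a). x < xa} = exp (- x * a)" .
  moreover have "{xa \<in> space (expo a). x < xa} = {x<..}" by auto
  ultimately show ?thesis by (simp add: mult.commute)
qed

text \<open>
  Summation by parts: the weights exp (- a j d) are the exponential tail probabilities, so a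
  Riemann-Stieltjes sum becomes an integral of the integrator at a discretised exponential time.
\<close>

lemma exp_weighted_sum_eq_integral:
  assumes a: "a > 0" and \<delta>: "\<delta> > 0"
  shows "(\<Sum>j<N. exp (- a * (real j * \<delta>)) * (\<phi> (real j * \<delta>) - \<phi> (real (Suc j) * \<delta>)))
     = \<phi> 0 - (\<integral>v. \<phi> (step_time \<delta> N v) \<partial>expo a)"
proof -
  interpret prob_space "expo a" by (rule prob_space_expo[OF a])
  have pt: "\<phi> (step_time \<delta> N v) = \<phi> 0 - (\<Sum>j<N. (\<phi> (real j * \<delta>) - \<phi> (real (Suc j) * \<delta>)) * indicator {real j * \<delta><..} v)" for v
  proof -
    define k where "k = min N (nat \<lceil>v / \<delta>\<rceil>)"
    \<comment> \<open>The strict inequality matches the ceiling: for v >= 0 exactly the ceiling of v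
      / \<delta> many grid points, counted from 0, lie strictly below v, so the sum telescopes to
      the grid point reached by rounding v up.\<close>
    have iff: "real j * \<delta> < v \<longleftrightarrow> j < nat \<lceil>v / \<delta>\<rceil>" for j
    proof -
      have "real j * \<delta> < v \<longleftrightarrow> real j < v / \<delta>" using \<delta> by (simp add: pos_less_divide_eq)
      also have "\<dots> \<longleftrightarrow> int j < \<lceil>v / \<delta>\<rceil>" by (simp add: less_ceiling_iff)
      also have "\<dots> \<longleftrightarrow> j < nat \<lceil>v / \<delta>\<rceil>" by (simp add: zless_nat_eq_int_zless)
      finally show ?thesis .
    qed
    have "(\<Sum>j<N. (\<phi> (real j * \<delta>) - \<phi> (real (Suc j) * \<delta>)) * indicator {real j * \<delta><..} v)
      = (\<Sum>j<N. if j < k then \<phi> (real j * \<delta>) - \<phi> (real (Suc j) * \<delta>) else 0)"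
      by (intro sum.cong refl) (auto simp: k_def indicator_def iff)
    also have "\<dots> = (\<Sum>j<k. \<phi> (real j * \<delta>) - \<phi> (real (Suc j) * \<delta>))"
    proof -
      have "{..<N} \<inter> {j. j < k} = {..<k}" by (auto simp: k_def)
      then show ?thesis by (simp add: sum.If_cases)
    qed
    also have "\<dots> = \<phi> (real 0 * \<delta>) - \<phi> (real k * \<delta>)"
      by (rule sum_lessThan_telescope'[of "\<lambda>j. \<phi> (real j * \<delta>)"])
    finally show ?thesis by (simp add: k_def step_time_def)
  qed
  have ind: "integrable (expo a) (indicator {x<..} :: real \<Rightarrow> real)" for x :: real
    by (rule integrable_expo_bounded[OF a, where C=1]) (auto simp: indicator_def)
  have hb: "has_bochner_integral (expo a) (indicator {x<..}) (measure (expo a) {x<..})" for x :: real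
    using ind[of x] by (simp add: has_bochner_integral_iff)
  have hc: "has_bochner_integral (expo a) (\<lambda>_. c) c" for c :: real
    using prob_space by (simp add: has_bochner_integral_iff)
  have "has_bochner_integral (expo a) (\<lambda>v. \<phi> 0 - (\<Sum>j<N. (\<phi> (real j * \<delta>) - \<phi> (real (Suc j) * \<delta>)) * indicator {real j * \<delta><..} v))
      (\<phi> 0 - (\<Sum>j<N. (\<phi> (real j * \<delta>) - \<phi> (real (Suc j) * \<delta>)) * measure (expo a) {real j * \<delta><..}))"
    by (intro has_bochner_integral_diff hc has_bochner_integral_sum has_bochner_integral_mult_right hb)
  then have "(\<integral>v. \<phi> (step_time \<delta> N v) \<partial>expo a) =
      \<phi> 0 - (\<Sum>j<N. (\<phi> (real j * \<delta>) - \<phi> (real (Suc j) * \<delta>)) * measure (expo a) {real j * \<delta><..})"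
    unfolding pt by (rule has_bochner_integral_integral_eq)
  also have "\<dots> = \<phi> 0 - (\<Sum>j<N. exp (- a * (real j * \<delta>)) * (\<phi> (real j * \<delta>) - \<phi> (real (Suc j) * \<delta>)))"
    using \<delta> by (simp add: expo_greaterThan[OF a] mult.commute)
  finally show ?thesis by simp
qed

text \<open>The formula of \<open>fou_cov\<close> with a transformed time. It serves three stages:
  \<open>step_time\<close> for Riemann-Stieltjes sums, \<open>min A\<close> for integrals over a
  window of length A, and the identity for the improper integral.\<close>

definition delayed_cov :: "(real \<Rightarrow> real) \<Rightarrow> real \<Rightarrow> real \<Rightarrow> (real \<Rightarrow> real) \<Rightarrow> real \<Rightarrow> real" where
  "delayed_cov g a a' \<tau> x = g x - (\<integral>v. g (x - \<tau> v) \<partial>expo a') - (\<integral>u. g (x + \<tau> u) \<partial>expo a)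
     + (\<integral>u. \<integral>v. g (x + \<tau> u - \<tau> v) \<partial>expo a' \<partial>expo a)"

lemma borel_measurable_delayed_integral [measurable]:
  fixes g \<tau> :: "real \<Rightarrow> real"
  assumes [measurable]: "g \<in> borel_measurable borel" "\<tau> \<in> borel_measurable borel" and a: "a' > 0"
  shows "(\<lambda>u. \<integral>v. g (x + \<tau> u - \<tau> v) \<partial>expo a') \<in> borel_measurable borel"
proof -
  interpret prob_space "expo a'" by (rule prob_space_expo[OF a])
  show ?thesis by measurable
qed

lemma abs_integral_expo_le:
  fixes f :: "real \<Rightarrow> real"
  assumes "a > 0" "\<And>x. \<bar>f x\<bar> \<le> C"
  shows "\<bar>\<integral>x. f x \<partial>expo a\<bar> \<le> C"
proof -
  interpret prob_space "expo a" by (rule prob_space_expo[OF assms(1)])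
  have "\<bar>\<integral>x. f x \<partial>expo a\<bar> \<le> (\<integral>x. C \<partial>expo a)" by (intro abs_integral_le assms) simp
  then show ?thesis using prob_space by simp
qed

text \<open>The left side is the covariance of two exponentially weighted sums when the underlying
  stationary family has covariance g; summation by parts is carried out once in each
  variable.\<close>

lemma weighted_double_sum_eq_delayed_cov:
  fixes g :: "real \<Rightarrow> real"
  assumes a: "a > 0" "a' > 0" and \<delta>: "\<delta> > 0" and [measurable]: "g \<in> borel_measurable borel" and C: "\<And>x. \<bar>g x\<bar> \<le> C"
  shows "(\<Sum>l<N. \<Sum>m<N. exp (- a * (real l * \<delta>)) * exp (- a' * (real m * \<delta>)) *
      (g (x + real l * \<delta> - real m * \<delta>) - g (x + real l * \<delta> - real (Suc m) * \<delta>)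
       - (g (x + real (Suc l) * \<delta> - real m * \<delta>) - g (x + real (Suc l) * \<delta> - real (Suc m) * \<delta>))))
     = delayed_cov g a a' (step_time \<delta> N) x"
proof -
  define R where "R u = g (x + u) - (\<integral>v. g (x + u - step_time \<delta> N v) \<partial>expo a')" for u
  have inner: "(\<Sum>m<N. exp (- a' * (real m * \<delta>)) * (g (x + u - real m * \<delta>) - g (x + u - real (Suc m) * \<delta>))) = R u" for u
    using exp_weighted_sum_eq_integral[OF a(2) \<delta>, where \<phi>="\<lambda>v. g (x + u - v)" and N=N] by (simp add: R_def)
  have "(\<Sum>l<N. \<Sum>m<N. exp (- a * (real l * \<delta>)) * exp (- a' * (real m * \<delta>)) *
      (g (x + real l * \<delta> - real m * \<delta>) - g (x + real l * \<delta> - real (Suc m) * \<delta>)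
       - (g (x + real (Suc l) * \<delta> - real m * \<delta>) - g (x + real (Suc l) * \<delta> - real (Suc m) * \<delta>))))
     = (\<Sum>l<N. exp (- a * (real l * \<delta>)) * (R (real l * \<delta>) - R (real (Suc l) * \<delta>)))"
    unfolding inner[symmetric] sum_subtractf[symmetric] sum_distrib_left right_diff_distrib[symmetric] mult.assoc ..
  also have "\<dots> = R 0 - (\<integral>u. R (step_time \<delta> N u) \<partial>expo a)"
    by (rule exp_weighted_sum_eq_integral[OF a(1) \<delta>])
  also have "(\<integral>u. R (step_time \<delta> N u) \<partial>expo a) = (\<integral>u. g (x + step_time \<delta> N u) \<partial>expo a)
       - (\<integral>u. \<integral>v. g (x + step_time \<delta> N u - step_time \<delta> N v) \<partial>expo a' \<partial>expo a)"
    unfolding R_def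
    using a C by (intro Bochner_Integration.integral_diff integrable_expo_bounded[where C=C] abs_integral_expo_le) auto
  finally show ?thesis by (simp add: R_def delayed_cov_def)
qed

text \<open>Dominated convergence, first in the inner and then in the outer integral, with the bound
  of g as majorant. Convergence of the times is asked for v >= 0 only, where the exponential laws
  live.\<close>

lemma delayed_cov_tendsto:
  fixes g :: "real \<Rightarrow> real"
  assumes a: "a > 0" "a' > 0" and g: "continuous_on UNIV g" and C: "\<And>x. \<bar>g x\<bar> \<le> C"
    and [measurable]: "\<And>n. \<tau> n \<in> borel_measurable borel" "\<tau>' \<in> borel_measurable borel"
    and \<tau>: "\<And>v. v \<ge> 0 \<Longrightarrow> (\<lambda>n. \<tau> n v) \<longlonglongrightarrow> \<tau>' v"
  shows "(\<lambda>n. delayed_cov g a a' (\<tau> n) x) \<longlonglongrightarrow> delayed_cov g a a' \<tau>' x"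
proof -
  have [measurable]: "g \<in> borel_measurable borel" using g by (rule borel_measurable_continuous_onI)
  have AE0: "AE v in expo b. v \<ge> 0" for b
    unfolding expo_def by (subst AE_density) (auto simp: exponential_density_def)
  have glim: "(\<lambda>n. g (y n)) \<longlonglongrightarrow> g z" if "y \<longlonglongrightarrow> z" for y z
    using continuous_on_tendsto_compose[OF g that] by simp
  have dct: "(\<lambda>n. \<integral>v. f n v \<partial>expo b) \<longlonglongrightarrow> (\<integral>v. f' v \<partial>expo b)"
    if b: "b > 0" and m: "\<And>n. f n \<in> borel_measurable borel" "f' \<in> borel_measurable borel"
      and bd: "\<And>n v. \<bar>f n v\<bar> \<le> C" and l: "\<And>v. v \<ge> 0 \<Longrightarrow> (\<lambda>n. f n v) \<longlonglongrightarrow> f' v" for f f' b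
  proof (rule integral_dominated_convergence[where w="\<lambda>_. C"])
    interpret prob_space "expo b" by (rule prob_space_expo[OF b])
    show "integrable (expo b) (\<lambda>_. C)" by simp
    show "AE v in expo b. (\<lambda>n. f n v) \<longlonglongrightarrow> f' v" using AE0[of b] by eventually_elim (rule l)
    show "AE v in expo b. norm (f n v) \<le> C" for n using bd by simp
  qed (use m in auto)
  have 1: "(\<lambda>n. \<integral>v. g (x - \<tau> n v) \<partial>expo a') \<longlonglongrightarrow> (\<integral>v. g (x - \<tau>' v) \<partial>expo a')"
    using a C by (intro dct glim tendsto_intros \<tau>) auto
  have 2: "(\<lambda>n. \<integral>v. g (x + \<tau> n v) \<partial>expo a) \<longlonglongrightarrow> (\<integral>v. g (x + \<tau>' v) \<partial>expo a)"
    using a C by (intro dct glim tendsto_intros \<tau>) auto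
  have 3: "(\<lambda>n. \<integral>v. g (x + \<tau> n u - \<tau> n v) \<partial>expo a') \<longlonglongrightarrow> (\<integral>v. g (x + \<tau>' u - \<tau>' v) \<partial>expo a')" if "u \<ge> 0" for u
    using a C that by (intro dct glim tendsto_intros \<tau>) auto
  have 4: "(\<lambda>n. \<integral>u. \<integral>v. g (x + \<tau> n u - \<tau> n v) \<partial>expo a' \<partial>expo a) \<longlonglongrightarrow> (\<integral>u. \<integral>v. g (x + \<tau>' u - \<tau>' v) \<partial>expo a' \<partial>expo a)"
    using a C by (intro dct 3 abs_integral_expo_le borel_measurable_delayed_integral) auto
  show ?thesis unfolding delayed_cov_def by (intro tendsto_intros 1 2 4)
qed

lemma fou_cov_eq_delayed_cov: "fou_cov r e h D a a' x = delayed_cov (incr_cov r e h D) a a' (\<lambda>v. v) x"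
  by (simp add: fou_cov_def delayed_cov_def)

text \<open>The window [0, A] is cut into n + 1 steps, so the truncation happens exactly at A;
  before it, rounding up moves v by at most the mesh.\<close>

lemma step_time_tendsto:
  assumes A: "A > 0" and v: "v \<ge> 0"
  shows "(\<lambda>n. step_time (A / real (Suc n)) (Suc n) v) \<longlonglongrightarrow> min A v"
proof -
  have st: "step_time (A / real (Suc n)) (Suc n) v = min A (real (nat \<lceil>v / (A / real (Suc n))\<rceil>) * (A / real (Suc n)))" for n
    using A by (auto simp: step_time_def min_def field_simps of_nat_Suc simp del: of_nat_Suc)
  have d0: "(\<lambda>n. A / real (Suc n)) \<longlonglongrightarrow> 0"
    using LIMSEQ_inverse_real_of_nat tendsto_mult_right_zero by (simp add: divide_inverse)
  have "(\<lambda>n. real (nat \<lceil>v / (A / real (Suc n))\<rceil>) * (A / real (Suc n))) \<longlonglongrightarrow> v"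
  proof (rule tendsto_sandwich)
    define \<delta> where "\<delta> n = A / real (Suc n)" for n
    have \<delta>: "\<delta> n > 0" for n using A by (simp add: \<delta>_def)
    have r: "real (nat \<lceil>v / \<delta> n\<rceil>) = of_int \<lceil>v / \<delta> n\<rceil>" for n
    proof -
      have "0 \<le> v / \<delta> n" using \<delta>[of n] v by simp
      then have "\<lceil>0 :: real\<rceil> \<le> \<lceil>v / \<delta> n\<rceil>" by (rule ceiling_mono)
      then show ?thesis by simp
    qed
    have "v \<le> real (nat \<lceil>v / \<delta> n\<rceil>) * \<delta> n" for n
    proof -
      have "v = v / \<delta> n * \<delta> n" using \<delta>[of n] by simp
      also have "\<dots> \<le> real (nat \<lceil>v / \<delta> n\<rceil>) * \<delta> n"
        unfolding r using \<delta>[of n] by (intro mult_right_mono le_of_int_ceiling) simp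
      finally show ?thesis .
    qed
    then show "eventually (\<lambda>n. v \<le> real (nat \<lceil>v / (A / real (Suc n))\<rceil>) * (A / real (Suc n))) sequentially"
      by (simp add: \<delta>_def)
    have "real (nat \<lceil>v / \<delta> n\<rceil>) * \<delta> n \<le> v + \<delta> n" for n
    proof -
      have "real (nat \<lceil>v / \<delta> n\<rceil>) * \<delta> n \<le> (v / \<delta> n + 1) * \<delta> n"
        unfolding r using \<delta>[of n] by (intro mult_right_mono of_int_ceiling_le_add_one) simp
      then show ?thesis using \<delta>[of n] by (simp add: distrib_right)
    qed
    then show "eventually (\<lambda>n. real (nat \<lceil>v / (A / real (Suc n))\<rceil>) * (A / real (Suc n)) \<le> v + A / real (Suc n)) sequentially"
      by (simp add: \<delta>_def)
    show "(\<lambda>n. v + A / real (Suc n)) \<longlonglongrightarrow> v" using tendsto_add[OF tendsto_const d0, of v] by simp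
  qed simp
  then show ?thesis unfolding st by (intro tendsto_intros)
qed

text \<open>Intervals are counted backwards from t and tagged at their right ends, so that the
  integrand takes the values exp (- a j \<delta>) that summation by parts reads as tail
  probabilities.\<close>

lemma uniform_tagged_division:
  fixes t \<delta> :: real
  assumes \<delta>: "\<delta> > 0" and N: "N > 0"
  shows "(\<lambda>j. (t - real j * \<delta>, {t - real (Suc j) * \<delta>..t - real j * \<delta>})) ` {..<N} tagged_division_of {t - real N * \<delta>..t}"
    (is "?p tagged_division_of _")
proof -
  let ?K = "\<lambda>j. {t - real (Suc j) * \<delta>..t - real j * \<delta>}"
  have sub: "?K j \<subseteq> {t - real N * \<delta>..t}" if "j < N" for j
  proof -
    have "real (Suc j) * \<delta> \<le> real N * \<delta>" using that \<delta> by (intro mult_right_mono) auto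
    moreover have "real j * \<delta> \<ge> 0" using \<delta> by simp
    ultimately show ?thesis by auto
  qed
  have disj: "interior (?K j) \<inter> interior (?K k) = {}" if "j < k" for j k
  proof -
    have "real (Suc j) * \<delta> \<le> real k * \<delta>" using that \<delta> by (intro mult_right_mono) auto
    then show ?thesis by (auto simp: interior_atLeastAtMost_real)
  qed
  \<comment> \<open>The left end point is treated apart: rounding (t - x) / \<delta> down would give
    the index N there, one too many.\<close>
  have cover: "\<exists>j<N. x \<in> ?K j" if x: "x \<in> {t - real N * \<delta>..t}" for x
  proof (cases "x = t - real N * \<delta>")
    case True
    then have "x \<in> ?K (N - 1)" using N \<delta> by (auto simp: of_nat_diff algebra_simps)
    then show ?thesis using N by (intro exI[of _ "N - 1"]) auto
  next
    case False
    define y where "y = (t - x) / \<delta>"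
    have y: "0 \<le> y" "y < real N" "x = t - y * \<delta>"
      using x False \<delta> by (auto simp: y_def pos_divide_less_eq)
    define j where "j = nat \<lfloor>y\<rfloor>"
    have j: "real j \<le> y" "y < real j + 1" using y by (auto simp: j_def of_nat_nat)
    have "j < N" using j y by linarith
    moreover have "real j * \<delta> \<le> y * \<delta>" "y * \<delta> \<le> real (Suc j) * \<delta>"
      using j \<delta> by (auto intro!: mult_right_mono)
    ultimately show ?thesis using y(3) by auto
  qed
  show ?thesis
  proof (rule tagged_division_ofI)
    show "finite ?p" by simp
    fix x K assume "(x, K) \<in> ?p"
    then obtain j where j: "j < N" "x = t - real j * \<delta>" "K = ?K j" by auto
    show "x \<in> K" using j \<delta> by (auto intro!: mult_right_mono)
    show "K \<subseteq> {t - real N * \<delta>..t}" using sub[OF j(1)] j(3) by simp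
    show "\<exists>a b. K = cbox a b" unfolding j(3) cbox_interval[symmetric] by blast
    fix x' K' assume "(x', K') \<in> ?p" and ne: "(x, K) \<noteq> (x', K')"
    then obtain k where k: "k < N" "x' = t - real k * \<delta>" "K' = ?K k" by auto
    have "j \<noteq> k" using ne j k by auto
    then show "interior K \<inter> interior K' = {}"
      using disj[of j k] disj[of k j] j(3) k(3) by (cases "j < k") (auto simp: Int_commute)
  next
    show "\<Union> {K. \<exists>x. (x, K) \<in> ?p} = {t - real N * \<delta>..t}"
    proof
      show "\<Union> {K. \<exists>x. (x, K) \<in> ?p} \<subseteq> {t - real N * \<delta>..t}"
      proof
        fix y assume "y \<in> \<Union> {K. \<exists>x. (x, K) \<in> ?p}"
        then obtain x K where "(x, K) \<in> ?p" "y \<in> K" by blast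
        then obtain j where "j < N" "y \<in> ?K j" by blast
        then show "y \<in> {t - real N * \<delta>..t}" using sub by blast
      qed
      show "{t - real N * \<delta>..t} \<subseteq> \<Union> {K. \<exists>x. (x, K) \<in> ?p}"
      proof
        fix y assume "y \<in> {t - real N * \<delta>..t}"
        then obtain j where j: "j < N" "y \<in> ?K j" using cover by blast
        then have "(t - real j * \<delta>, ?K j) \<in> ?p" by blast
        then show "y \<in> \<Union> {K. \<exists>x. (x, K) \<in> ?p}" using j(2) by blast
      qed
    qed
  qed
qed

lemma has_RS_integral_sequence:
  assumes I: "has_RS_integral f g (t - A) t I" and A: "A > 0"
  shows "(\<lambda>n. \<Sum>j<Suc n. f (t - real j * (A / real (Suc n))) *
     (g (t - real j * (A / real (Suc n))) - g (t - real (Suc j) * (A / real (Suc n))))) \<longlonglongrightarrow> I"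
proof (rule LIMSEQ_I)
  fix e :: real assume e: "e > 0"
  obtain \<delta>0 where \<delta>0: "\<delta>0 > 0" and
    **: "\<forall>p. p tagged_division_of {t - A..t} \<and> (\<forall>(x, K)\<in>p. diameter K < \<delta>0) \<longrightarrow>
        \<bar>(\<Sum>(x, K)\<in>p. f x * (g (Sup K) - g (Inf K))) - I\<bar> < e"
    using I[unfolded has_RS_integral_def, THEN spec, THEN mp, OF e] by (elim exE conjE) (rule that)
  have *: "\<bar>(\<Sum>(x, K)\<in>p. f x * (g (Sup K) - g (Inf K))) - I\<bar> < e"
    if "p tagged_division_of {t - A..t}" "\<forall>(x, K)\<in>p. diameter K < \<delta>0" for p
    by (rule **[THEN spec, THEN mp]) (rule conjI, (rule that)+)
  have "(\<lambda>n. A / real (Suc n)) \<longlonglongrightarrow> 0"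
    using LIMSEQ_inverse_real_of_nat tendsto_mult_right_zero by (simp add: divide_inverse)
  then have "eventually (\<lambda>n. A / real (Suc n) < \<delta>0) sequentially" by (rule order_tendstoD) (rule \<delta>0)
  then obtain n0 where n0: "\<And>n. n \<ge> n0 \<Longrightarrow> A / real (Suc n) < \<delta>0" by (auto simp: eventually_sequentially)
  show "\<exists>n0. \<forall>n\<ge>n0. norm ((\<Sum>j<Suc n. f (t - real j * (A / real (Suc n))) *
     (g (t - real j * (A / real (Suc n))) - g (t - real (Suc j) * (A / real (Suc n))))) - I) < e"
  proof (intro exI[of _ n0] allI impI)
    fix n assume n: "n \<ge> n0"
    define \<delta> where "\<delta> = A / real (Suc n)"
    have \<delta>: "\<delta> > 0" "\<delta> < \<delta>0" using A n0[OF n] by (simp_all add: \<delta>_def)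
    let ?q = "\<lambda>j. (t - real j * \<delta>, {t - real (Suc j) * \<delta>..t - real j * \<delta>})"
    have le: "t - real (Suc j) * \<delta> \<le> t - real j * \<delta>" for j using \<delta> by (auto intro!: mult_right_mono)
    have "real (Suc n) * \<delta> = A" by (simp add: \<delta>_def)
    then have "?q ` {..<Suc n} tagged_division_of {t - A..t}"
      using uniform_tagged_division[OF \<delta>(1), of "Suc n" t] by simp
    moreover have "\<forall>(x, K)\<in>?q ` {..<Suc n}. diameter K < \<delta>0"
      using le \<delta> by (auto simp: diameter_closed_interval algebra_simps)
    ultimately have "\<bar>(\<Sum>(x, K)\<in>?q ` {..<Suc n}. f x * (g (Sup K) - g (Inf K))) - I\<bar> < e" by (rule *)
    also have "(\<Sum>(x, K)\<in>?q ` {..<Suc n}. f x * (g (Sup K) - g (Inf K))) =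
       (\<Sum>j<Suc n. f (t - real j * \<delta>) * (g (t - real j * \<delta>) - g (t - real (Suc j) * \<delta>)))"
    proof (subst sum.reindex)
      show "inj_on ?q {..<Suc n}" using \<delta> by (auto simp: inj_on_def)
      have "Sup {t - real (Suc j) * \<delta>..t - real j * \<delta>} = t - real j * \<delta>"
        "Inf {t - real (Suc j) * \<delta>..t - real j * \<delta>} = t - real (Suc j) * \<delta>" for j
        using le[of j] by (rule cSup_atLeastAtMost, rule cInf_atLeastAtMost)
      then show "sum ((\<lambda>(x, K). f x * (g (Sup K) - g (Inf K))) \<circ> ?q) {..<Suc n} =
        (\<Sum>j<Suc n. f (t - real j * \<delta>) * (g (t - real j * \<delta>) - g (t - real (Suc j) * \<delta>)))"
        by (intro sum.cong refl) simp
    qed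
    finally show "norm ((\<Sum>j<Suc n. f (t - real j * (A / real (Suc n))) *
     (g (t - real j * (A / real (Suc n))) - g (t - real (Suc j) * (A / real (Suc n))))) - I) < e"
      by (simp add: \<delta>_def)
  qed
qed


text \<open>Two limits are taken: the mesh tends to 0 on windows of fixed length m + 1, then m tends
  to infinity. The integrals ending at s + D and at s are discretised on translates of one grid.
  Their difference is then a weighted sum of increments of B over length D, whose covariances are
  bounded functions of the lag, as dominated convergence requires; those of B itself are neither
  bounded nor stationary.\<close>

lemma fou_increments_gauss_fam:
  fixes B Y :: "'c \<Rightarrow> real \<Rightarrow> 'w \<Rightarrow> real"
  assumes M: "prob_space M"
    and X: "gauss_fam M (\<lambda>(i, s) \<omega>. B i (s + D) \<omega> - B i s \<omega>)
           (\<lambda>(i, s) (j, t). incr_cov (r i j) (e i j) (h i j) D (t - s))"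
    and h: "\<And>i j. 0 < h i j" "\<And>i j. h i j < 2" and \<alpha>: "\<And>i. \<alpha> i > 0" and \<nu>: "\<And>i. \<nu> i > 0" and D: "D > 0"
    and Ym: "\<And>i t. Y i t \<in> borel_measurable M"
    and Y: "\<And>i. AE \<omega> in M. \<forall>t. \<exists>I.
        has_RS_integral_from_minf (\<lambda>u. exp (- \<alpha> i * (t - u))) (\<lambda>u. B i u \<omega>) t I \<and> Y i t \<omega> = \<nu> i * I"
  shows "gauss_fam M (\<lambda>(i, s) \<omega>. (Y i (s + D) \<omega> - Y i s \<omega>) / \<nu> i)
           (\<lambda>(i, s) (j, t). fou_cov (r i j) (e i j) (h i j) D (\<alpha> i) (\<alpha> j) (t - s))"
proof -
  define XX where "XX = (\<lambda>(i, s) \<omega>. B i (s + D) \<omega> - B i s \<omega>)"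
  define G where "G i j = incr_cov (r i j) (e i j) (h i j) D" for i j
  define KX where "KX = (\<lambda>(i, s) (j, t). G i j (t - s))"
  have X': "gauss_fam M XX KX" using X by (simp add: XX_def KX_def G_def)
  have Gc: "continuous_on UNIV (G i j)" for i j unfolding G_def by (rule continuous_on_incr_cov[OF h(1)])
  have Gm [measurable]: "G i j \<in> borel_measurable borel" for i j
    using Gc by (rule borel_measurable_continuous_onI)
  \<comment> \<open>The decay bound with exponent 0, that is, a bound uniform in the lag.\<close>
  define C where "C i j = 18 * (\<bar>r i j\<bar> + \<bar>e i j\<bar>) * D powr (h i j + 0)" for i j
  have GC: "\<bar>G i j x\<bar> \<le> C i j" for i j x
  proof -
    have "\<bar>G i j x\<bar> \<le> C i j * (D + \<bar>x\<bar>) powr (- 0)"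
      unfolding G_def C_def by (rule incr_cov_bound[OF h]) (use h[of i j] D in auto)
    also have "(D + \<bar>x\<bar>) powr (- 0) = 1" using D by simp
    finally show ?thesis by simp
  qed
  define \<delta> where "\<delta> m n = real (Suc m) / real (Suc n)" for m n
  have \<delta>: "\<delta> m n > 0" for m n by (simp add: \<delta>_def)
  define Zs where "Zs m n = (\<lambda>(i, s) \<omega>. \<Sum>j<Suc n. exp (- \<alpha> i * (real j * \<delta> m n)) *
      (XX (i, s - real j * \<delta> m n) \<omega> - XX (i, s - real (Suc j) * \<delta> m n) \<omega>))" for m n
  have Zs: "gauss_fam M (Zs m n) (\<lambda>(i, s) (j, t). delayed_cov (G i j) (\<alpha> i) (\<alpha> j) (step_time (\<delta> m n) (Suc n)) (t - s))" for m n
  proof -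
    let ?J = "{..<Suc n} \<times> (UNIV :: bool set)"
    let ?d = "\<lambda>a p. exp (- \<alpha> (fst a) * (real (fst p) * \<delta> m n)) * (if snd p then 1 else - 1)"
    let ?g = "\<lambda>a p. (fst a, if snd p then snd a - real (fst p) * \<delta> m n else snd a - real (Suc (fst p)) * \<delta> m n)"
    have "gauss_fam M (\<lambda>a \<omega>. \<Sum>p\<in>?J. ?d a p * XX (?g a p) \<omega>)
        (\<lambda>a a'. \<Sum>p\<in>?J. \<Sum>p'\<in>?J. ?d a p * ?d a' p' * KX (?g a p) (?g a' p'))"
      by (rule gauss_fam_linear[OF X']) simp
    moreover have sp: "(\<Sum>p\<in>?J. F p) = (\<Sum>j<Suc n. F (j, True) + F (j, False))" for F :: "nat \<times> bool \<Rightarrow> real"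
      using sum.cartesian_product[of "\<lambda>j b. F (j, b)" "UNIV :: bool set" "{..<Suc n}"]
      by (simp add: UNIV_bool case_prod_beta add.commute)
    have "(\<lambda>a \<omega>. \<Sum>p\<in>?J. ?d a p * XX (?g a p) \<omega>) = Zs m n"
      unfolding sp Zs_def by (simp add: fun_eq_iff right_diff_distrib)
    moreover have "(\<lambda>a a'. \<Sum>p\<in>?J. \<Sum>p'\<in>?J. ?d a p * ?d a' p' * KX (?g a p) (?g a' p')) =
        (\<lambda>(i, s) (j, t). delayed_cov (G i j) (\<alpha> i) (\<alpha> j) (step_time (\<delta> m n) (Suc n)) (t - s))"
    proof -
      have "(\<Sum>p\<in>?J. \<Sum>p'\<in>?J. ?d (i, s) p * ?d (j, t) p' * KX (?g (i, s) p) (?g (j, t) p')) =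
          delayed_cov (G i j) (\<alpha> i) (\<alpha> j) (step_time (\<delta> m n) (Suc n)) (t - s)" for i s j t
      proof -
        have w: "delayed_cov (G i j) (\<alpha> i) (\<alpha> j) (step_time (\<delta> m n) (Suc n)) (t - s) =
          (\<Sum>l<Suc n. \<Sum>k<Suc n. exp (- \<alpha> i * (real l * \<delta> m n)) * exp (- \<alpha> j * (real k * \<delta> m n)) *
           (G i j (t - s + real l * \<delta> m n - real k * \<delta> m n) - G i j (t - s + real l * \<delta> m n - real (Suc k) * \<delta> m n)
            - (G i j (t - s + real (Suc l) * \<delta> m n - real k * \<delta> m n) - G i j (t - s + real (Suc l) * \<delta> m n - real (Suc k) * \<delta> m n))))"
          by (rule weighted_double_sum_eq_delayed_cov[OF \<alpha> \<alpha> \<delta> Gm GC, symmetric])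
        have pos: "t - y - (s - x) = t - s + x - y" for x y by simp
        show ?thesis
          unfolding w sp sum.distrib[symmetric]
          by (intro sum.cong refl) (simp only: KX_def prod.case fst_conv snd_conv if_True if_False simp_thms pos, simp only: mult_1_right mult_minus_right mult_minus_left minus_minus, argo)
      qed
      then show ?thesis by (simp only: fun_eq_iff split_paired_all prod.case) simp
    qed
    ultimately show ?thesis by simp
  qed
  \<comment> \<open>A \<open>lim\<close> of measurable functions is measurable on the whole space,
    including the null set where the sums do not converge.\<close>
  define W where "W m a \<omega> = lim (\<lambda>n. Zs m n a \<omega>)" for m a \<omega>
  have Zsm [measurable]: "Zs m n a \<in> borel_measurable M" for m n a by (rule gauss_fam_measurable[OF Zs])
  have Wm: "W m a \<in> borel_measurable M" for m a
    unfolding W_def by (rule borel_measurable_lim_metric) (rule Zsm)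
  have AElim: "AE \<omega> in M. (\<forall>m. (\<lambda>n. Zs m n (i, s) \<omega>) \<longlonglongrightarrow> W m (i, s) \<omega>) \<and>
      (\<lambda>m. W m (i, s) \<omega>) \<longlonglongrightarrow> (Y i (s + D) \<omega> - Y i s \<omega>) / \<nu> i" for i s
    using Y[of i]
  proof eventually_elim
    case (elim \<omega>)
    obtain I1 where I1: "has_RS_integral_from_minf (\<lambda>u. exp (- \<alpha> i * (s + D - u))) (\<lambda>u. B i u \<omega>) (s + D) I1"
      "Y i (s + D) \<omega> = \<nu> i * I1" using elim[THEN spec, of "s + D"] by (elim exE conjE) (rule that)
    obtain I0 where I0: "has_RS_integral_from_minf (\<lambda>u. exp (- \<alpha> i * (s - u))) (\<lambda>u. B i u \<omega>) s I0"
      "Y i s \<omega> = \<nu> i * I0" using elim[THEN spec, of s] by (elim exE conjE) (rule that)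
    obtain J1 where J1: "\<forall>a<s + D. has_RS_integral (\<lambda>u. exp (- \<alpha> i * (s + D - u))) (\<lambda>u. B i u \<omega>) a (s + D) (J1 a)"
      "(J1 \<longlongrightarrow> I1) at_bot" using I1(1) unfolding has_RS_integral_from_minf_def by (elim exE conjE) (rule that)
    obtain J0 where J0: "\<forall>a<s. has_RS_integral (\<lambda>u. exp (- \<alpha> i * (s - u))) (\<lambda>u. B i u \<omega>) a s (J0 a)"
      "(J0 \<longlongrightarrow> I0) at_bot" using I0(1) unfolding has_RS_integral_from_minf_def by (elim exE conjE) (rule that)
    have Zlim: "(\<lambda>n. Zs m n (i, s) \<omega>) \<longlonglongrightarrow> J1 (s + D - real (Suc m)) - J0 (s - real (Suc m))" for m
    proof -
      have A: "real (Suc m) > 0" by simp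
      have "has_RS_integral (\<lambda>u. exp (- \<alpha> i * (s + D - u))) (\<lambda>u. B i u \<omega>) (s + D - real (Suc m)) (s + D) (J1 (s + D - real (Suc m)))"
        using J1(1) A by simp
      note l1 = has_RS_integral_sequence[OF this A]
      have "has_RS_integral (\<lambda>u. exp (- \<alpha> i * (s - u))) (\<lambda>u. B i u \<omega>) (s - real (Suc m)) s (J0 (s - real (Suc m)))"
        using J0(1) A by simp
      note l0 = has_RS_integral_sequence[OF this A]
      have "(\<Sum>j<Suc n. exp (- \<alpha> i * (s + D - (s + D - real j * (real (Suc m) / real (Suc n))))) *
             (B i (s + D - real j * (real (Suc m) / real (Suc n))) \<omega> - B i (s + D - real (Suc j) * (real (Suc m) / real (Suc n))) \<omega>)) -
          (\<Sum>j<Suc n. exp (- \<alpha> i * (s - (s - real j * (real (Suc m) / real (Suc n))))) *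
             (B i (s - real j * (real (Suc m) / real (Suc n))) \<omega> - B i (s - real (Suc j) * (real (Suc m) / real (Suc n))) \<omega>)) = Zs m n (i, s) \<omega>" for n
      proof -
        have "exp (- \<alpha> i * (s + D - (s + D - x))) * (B i (s + D - x) \<omega> - B i (s + D - y) \<omega>) -
            exp (- \<alpha> i * (s - (s - x))) * (B i (s - x) \<omega> - B i (s - y) \<omega>) =
            exp (- \<alpha> i * x) * (B i (s - x + D) \<omega> - B i (s - x) \<omega> - (B i (s - y + D) \<omega> - B i (s - y) \<omega>))" for x y
          by (simp add: algebra_simps)
        then show ?thesis
          unfolding Zs_def XX_def \<delta>_def prod.case sum_subtractf[symmetric] by (intro sum.cong refl)
      qed
      then show ?thesis using tendsto_diff[OF l1 l0] by simp
    qed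
    have WJ: "W m (i, s) \<omega> = J1 (s + D - real (Suc m)) - J0 (s - real (Suc m))" for m
      unfolding W_def by (rule limI) (rule Zlim)
    have bot: "filterlim (\<lambda>m. t - real (Suc m)) at_bot sequentially" for t :: real
    proof -
      have "filterlim (\<lambda>m. - t + real (Suc m)) at_top sequentially"
        by (intro filterlim_tendsto_add_at_top[OF tendsto_const] filterlim_compose[OF filterlim_real_sequentially filterlim_Suc])
      then show ?thesis by (subst filterlim_uminus_at_bot) (simp add: algebra_simps)
    qed
    have "(\<lambda>m. J1 (s + D - real (Suc m)) - J0 (s - real (Suc m))) \<longlonglongrightarrow> I1 - I0"
      by (intro tendsto_diff filterlim_compose[OF J1(2) bot] filterlim_compose[OF J0(2) bot])
    moreover have "I1 - I0 = (Y i (s + D) \<omega> - Y i s \<omega>) / \<nu> i"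
      using I1(2) I0(2) \<nu>[of i] by (simp add: diff_divide_distrib)
    ultimately show ?case using Zlim by (simp add: WJ)
  qed
  have W: "gauss_fam M (W m) (\<lambda>(i, s) (j, t). delayed_cov (G i j) (\<alpha> i) (\<alpha> j) (min (real (Suc m))) (t - s))" for m
  proof (rule gauss_fam_limit[OF M Zs Wm])
    show "AE \<omega> in M. (\<lambda>n. Zs m n a \<omega>) \<longlonglongrightarrow> W m a \<omega>" for a
      using AElim[of "fst a" "snd a"] by (auto elim!: eventually_mono)
    show "(\<lambda>n. (case a of (i, s) \<Rightarrow> \<lambda>(j, t). delayed_cov (G i j) (\<alpha> i) (\<alpha> j) (step_time (\<delta> m n) (Suc n)) (t - s)) b)
      \<longlonglongrightarrow> (case a of (i, s) \<Rightarrow> \<lambda>(j, t). delayed_cov (G i j) (\<alpha> i) (\<alpha> j) (min (real (Suc m))) (t - s)) b" for a b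
      unfolding case_prod_beta \<delta>_def
      by (intro delayed_cov_tendsto[OF \<alpha> \<alpha> Gc GC] step_time_tendsto) auto
  qed
  have "gauss_fam M (\<lambda>a \<omega>. (Y (fst a) (snd a + D) \<omega> - Y (fst a) (snd a) \<omega>) / \<nu> (fst a))
      (\<lambda>a b. delayed_cov (G (fst a) (fst b)) (\<alpha> (fst a)) (\<alpha> (fst b)) (\<lambda>v. v) (snd b - snd a))"
  proof (rule gauss_fam_limit[OF M W])
    show "(\<lambda>\<omega>. (Y (fst a) (snd a + D) \<omega> - Y (fst a) (snd a) \<omega>) / \<nu> (fst a)) \<in> borel_measurable M" for a
      using Ym by measurable
    show "AE \<omega> in M. (\<lambda>n. W n a \<omega>) \<longlonglongrightarrow> (Y (fst a) (snd a + D) \<omega> - Y (fst a) (snd a) \<omega>) / \<nu> (fst a)" for a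
      using AElim[of "fst a" "snd a"] by (auto elim!: eventually_mono)
    show "(\<lambda>m. (case a of (i, s) \<Rightarrow> \<lambda>(j, t). delayed_cov (G i j) (\<alpha> i) (\<alpha> j) (min (real (Suc m))) (t - s)) b)
      \<longlonglongrightarrow> delayed_cov (G (fst a) (fst b)) (\<alpha> (fst a)) (\<alpha> (fst b)) (\<lambda>v. v) (snd b - snd a)" for a b
      unfolding case_prod_beta
    proof (rule delayed_cov_tendsto[OF \<alpha> \<alpha> Gc GC])
      show "(\<lambda>m. min (real (Suc m)) v) \<longlonglongrightarrow> v" for v
      proof (rule tendsto_eventually)
        obtain n0 :: nat where "v \<le> real n0" using real_arch_simple by blast
        then have "min (real (Suc m)) v = v" if "m \<ge> n0" for m using that by auto
        then show "eventually (\<lambda>m. min (real (Suc m)) v = v) sequentially"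
          by (auto simp: eventually_sequentially)
      qed
    qed auto
  qed
  then show ?thesis
    by (simp add: fou_cov_eq_delayed_cov G_def case_prod_beta')
qed

section \<open>The limit theorem\<close>

lemma sum_powr_le:
  fixes b :: real
  assumes b: "0 \<le> b" "b < 1"
  shows "(\<Sum>m<n. (1 + real m) powr (- b)) \<le> real n powr (1 - b) / (1 - b)"
proof (induction n)
  case (Suc n)
  have "(1 + real n) powr (- b) \<le> (real (Suc n) powr (1 - b) - real n powr (1 - b)) / (1 - b)"
  proof (cases "n = 0")
    case True
    then show ?thesis using b by (simp add: le_divide_eq)
  next
    case False
    have "\<exists>z>real n. z < real (Suc n) \<and> real (Suc n) powr (1 - b) / (1 - b) - real n powr (1 - b) / (1 - b) = (real (Suc n) - real n) * z powr (- b)"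
    proof (rule MVT2)
      fix x assume "real n \<le> x" "x \<le> real (Suc n)"
      then have "x > 0" using False by simp
      then show "((\<lambda>x. x powr (1 - b) / (1 - b)) has_real_derivative x powr (- b)) (at x)"
        using has_real_derivative_kernel[of 0 x b] b by simp
    qed simp
    then obtain z where z: "real n < z" "z < real (Suc n)"
      "real (Suc n) powr (1 - b) / (1 - b) - real n powr (1 - b) / (1 - b) = z powr (- b)" by auto
    have "(1 + real n) powr (- b) \<le> z powr (- b)"
      using z b by (intro powr_mono2') auto
    then show ?thesis using z by (simp add: diff_divide_distrib)
  qed
  with Suc show ?case by (simp add: diff_divide_distrib)
qed simp

text \<open>In truncated subtraction \<open>(k - l) + (l - k)\<close> is |k - l|, and along a row
  each lag occurs at most twice.\<close>

lemma row_sum_le: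
  fixes f :: "nat \<Rightarrow> real"
  assumes f: "\<And>m. f m \<ge> 0" and l: "l < n"
  shows "(\<Sum>k<n. f ((k - l) + (l - k))) \<le> 2 * (\<Sum>m<n. f m)"
proof -
  have "(\<Sum>k<n. f ((k - l) + (l - k))) = (\<Sum>k\<in>{..<l}. f ((k - l) + (l - k))) + (\<Sum>k\<in>{l..<n}. f ((k - l) + (l - k)))"
    using l by (subst sum.union_disjoint[symmetric]) (auto intro!: sum.cong)
  also have "(\<Sum>k\<in>{..<l}. f ((k - l) + (l - k))) = (\<Sum>k\<in>{..<l}. f (l - k))" by (intro sum.cong refl) simp
  also have "\<dots> = sum f ((\<lambda>k. l - k) ` {..<l})" by (subst sum.reindex) (auto simp: inj_on_def)
  also have "\<dots> \<le> (\<Sum>m<n. f m)" using f l by (intro sum_mono2) auto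
  also have "(\<Sum>k\<in>{l..<n}. f ((k - l) + (l - k))) = (\<Sum>k\<in>{l..<n}. f (k - l))" by (intro sum.cong refl) simp
  also have "\<dots> = sum f ((\<lambda>k. k - l) ` {l..<n})" by (subst sum.reindex) (auto simp: inj_on_def)
  also have "\<dots> \<le> (\<Sum>m<n. f m)" using f l by (intro sum_mono2) auto
  finally show ?thesis by simp
qed

text \<open>A lag m >= 1 occurs 2 (n - m) times in the square; the induction adds one row and one
  column, each containing the lags 1 to n once, and one diagonal entry.\<close>

lemma toeplitz_sum:
  fixes f :: "nat \<Rightarrow> real"
  shows "(\<Sum>k<n. \<Sum>l<n. f ((k - l) + (l - k))) = real n * f 0 + 2 * (\<Sum>m<n. (real n - real (Suc m)) * f (Suc m))"
proof (induction n)
  case (Suc n)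
  have r: "(\<Sum>l<n. f (n - l)) = (\<Sum>m<n. f (Suc m))"
  proof -
    have "(\<Sum>l<n. f (n - l)) = (\<Sum>l<n. f (Suc (n - Suc l)))" by (intro sum.cong refl) (simp add: Suc_diff_Suc)
    also have "\<dots> = (\<Sum>m<n. f (Suc m))" by (rule sum.nat_diff_reindex)
    finally show ?thesis .
  qed
  have "(\<Sum>k<Suc n. \<Sum>l<Suc n. f ((k - l) + (l - k))) =
      (\<Sum>k<n. \<Sum>l<n. f ((k - l) + (l - k))) + (\<Sum>k<n. f ((k - n) + (n - k))) + (\<Sum>l<n. f ((n - l) + (l - n))) + f 0"
    by (simp add: sum.distrib)
  also have "(\<Sum>k<n. f ((k - n) + (n - k))) = (\<Sum>m<n. f (Suc m))" unfolding r[symmetric] by (intro sum.cong refl) simp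
  also have "(\<Sum>l<n. f ((n - l) + (l - n))) = (\<Sum>m<n. f (Suc m))" unfolding r[symmetric] by (intro sum.cong refl) simp
  finally show ?case unfolding Suc.IH by (simp add: algebra_simps sum.distrib sum_subtractf sum_distrib_left)
qed simp

text \<open>Grouping by lag gives Cesaro weights 1 - m / n. Since \<beta> > 1 provides a summable
  majorant, Tannery's theorem lets the weights and the values F n m converge together.\<close>

lemma toeplitz_mean_tendsto:
  fixes F :: "nat \<Rightarrow> nat \<Rightarrow> real"
  assumes bound: "\<And>n m. \<bar>F n m\<bar> \<le> C * (1 + real m) powr (- \<beta>)" and \<beta>: "\<beta> > 1" and C: "C \<ge> 0"
    and lim: "\<And>m. (\<lambda>n. F n m) \<longlonglongrightarrow> F' m"
  shows "\<exists>s. (\<lambda>n. (\<Sum>k<n. \<Sum>l<n. F n ((k - l) + (l - k))) / real n) \<longlonglongrightarrow> s"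
proof -
  \<comment> \<open>Shifted by one: \<open>a m n\<close> belongs to the lag m + 1. Lag 0 is kept
    apart because it is counted once and not twice.\<close>
  define a where "a m n = (if m < n then (1 - real (Suc m) / real n) * F n (Suc m) else 0)" for m n
  have "summable (\<lambda>m. (real m) powr (- \<beta>))" using \<beta> by (simp add: summable_real_powr_iff)
  then have "summable (\<lambda>m. (real (m + 2)) powr (- \<beta>))" by (rule summable_ignore_initial_segment)
  then have S: "summable (\<lambda>m. C * (real (m + 2)) powr (- \<beta>))" by (rule summable_mult)
  have ab: "\<bar>a m n\<bar> \<le> C * (real (m + 2)) powr (- \<beta>)" for m n
  proof (cases "m < n")
    case True
    then have "0 \<le> 1 - real (Suc m) / real n" "1 - real (Suc m) / real n \<le> 1" by (auto simp: field_simps)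
    then have "\<bar>a m n\<bar> \<le> 1 * \<bar>F n (Suc m)\<bar>"
      using True unfolding a_def by (simp add: abs_mult mult_left_le_one_le)
    also have "\<dots> \<le> C * (real (m + 2)) powr (- \<beta>)" using bound[of n "Suc m"] by (simp add: add.commute)
    finally show ?thesis .
  qed (use C in \<open>simp add: a_def\<close>)
  have al: "(\<lambda>n. a m n) \<longlonglongrightarrow> F' (Suc m)" for m
  proof -
    have "(\<lambda>n. real (Suc m) / real n) \<longlonglongrightarrow> 0" by (rule tendsto_divide_0[OF tendsto_const]) (intro filterlim_at_top_imp_at_infinity filterlim_real_sequentially)
    then have "(\<lambda>n. (1 - real (Suc m) / real n) * F n (Suc m)) \<longlonglongrightarrow> (1 - 0) * F' (Suc m)" by (intro tendsto_intros lim)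
    then have "(\<lambda>n. (1 - real (Suc m) / real n) * F n (Suc m)) \<longlonglongrightarrow> F' (Suc m)" by simp
    moreover have "eventually (\<lambda>n. (1 - real (Suc m) / real n) * F n (Suc m) = a m n) sequentially"
      using eventually_gt_at_top[of m] by eventually_elim (simp add: a_def)
    ultimately show ?thesis by (rule Lim_transform_eventually)
  qed
  have "(\<lambda>n. \<Sum>m. a m n) \<longlonglongrightarrow> (\<Sum>m. F' (Suc m))"
    using tannerys_theorem[OF al _ S] ab by (simp add: always_eventually)
  then have "(\<lambda>n. F n 0 + 2 * (\<Sum>m. a m n)) \<longlonglongrightarrow> F' 0 + 2 * (\<Sum>m. F' (Suc m))"
    by (intro tendsto_intros lim)
  moreover have "eventually (\<lambda>n. F n 0 + 2 * (\<Sum>m. a m n) = (\<Sum>k<n. \<Sum>l<n. F n ((k - l) + (l - k))) / real n) sequentially"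
    using eventually_gt_at_top[of 0]
  proof eventually_elim
    case (elim n)
    have "(\<Sum>m. a m n) = (\<Sum>m<n. a m n)" by (rule suminf_finite) (auto simp: a_def)
    also have "\<dots> = (\<Sum>m<n. (real n - real (Suc m)) * F n (Suc m) / real n)"
      using elim by (intro sum.cong refl) (simp add: a_def field_simps)
    also have "\<dots> = (\<Sum>m<n. (real n - real (Suc m)) * F n (Suc m)) / real n" by (rule sum_divide_distrib[symmetric])
    finally show ?case unfolding toeplitz_sum using elim by (simp add: add_divide_distrib)
  qed
  ultimately show ?thesis by (intro exI) (rule Lim_transform_eventually)
qed


section \<open>Reflection, scaling and bias of the covariances\<close>

lemma fou_cov_minus:
  assumes h: "0 < h" "h < 2" and a: "a > 0" "a' > 0" and D: "D > 0"
  shows "fou_cov r e h D a a' (- x) = fou_cov r (- e) h D a' a x"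
proof -
  interpret A: prob_space "expo a" by (rule prob_space_expo[OF a(1)])
  interpret A': prob_space "expo a'" by (rule prob_space_expo[OF a(2)])
  interpret P: pair_prob_space "expo a'" "expo a" ..
  define g where "g = incr_cov r (- e) h D"
  have gm [measurable]: "g \<in> borel_measurable borel"
    unfolding g_def by (rule borel_measurable_continuous_onI[OF continuous_on_incr_cov[OF h(1)]])
  have gb: "\<bar>g y\<bar> \<le> 18 * (\<bar>r\<bar> + \<bar>- e\<bar>) * D powr (h + 0)" for y
  proof -
    have "(D + \<bar>y\<bar>) powr (- 0) = 1" using D by simp
    then show ?thesis
      unfolding g_def using incr_cov_bound[OF h _ D, of 0 r "- e" y] h by (simp only:) simp
  qed
  have m: "incr_cov r e h D y = g (- y)" for y using incr_cov_minus[of r e h D "- y"] by (simp add: g_def)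
  \<comment> \<open>Exchanging the components exchanges the two exponential times, hence Fubini for
    the double average; boundedness is the decay bound with exponent 0.\<close>
  have "(\<integral>u. \<integral>v. g (x + v - u) \<partial>expo a' \<partial>expo a) = (\<integral>v. \<integral>u. g (x + v - u) \<partial>expo a \<partial>expo a')"
  proof (rule P.Fubini_integral[of "\<lambda>v u. g (x + v - u)"])
    show "integrable (expo a' \<Otimes>\<^sub>M expo a) (\<lambda>(v, u). g (x + v - u))"
      by (rule P.integrable_const_bound[where B="18 * (\<bar>r\<bar> + \<bar>- e\<bar>) * D powr (h + 0)"]) (use gb in auto)
  qed
  moreover have "- (- x - v) = x + v" "- (- x + v) = x - v" "- (- x + u - v) = x + v - u" for u v
    by auto
  ultimately show ?thesis
    unfolding fou_cov_def m g_def[symmetric] by (simp only: minus_minus)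
qed

lemma scaled_fou_cov_bound:
  assumes h: "0 < h" "h < 2" and b: "0 \<le> b" "b < 1" "b \<le> 2 - h" and a: "a > 0" "a' > 0"
  shows "\<exists>C\<ge>0. \<forall>D m. D > 0 \<longrightarrow> \<bar>D powr (- h) * fou_cov r e h D a a' (m * D)\<bar> \<le> C * (1 + \<bar>m\<bar>) powr (- b)"
proof (rule fou_cov_decay[OF h b a, of r e])
  fix C :: real
  assume C: "C \<ge> 0" "\<And>D x. D > 0 \<Longrightarrow> \<bar>fou_cov r e h D a a' x\<bar> \<le> C * D powr (h + b) * (D + \<bar>x\<bar>) powr (- b)"
  have "\<bar>D powr (- h) * fou_cov r e h D a a' (m * D)\<bar> \<le> C * (1 + \<bar>m\<bar>) powr (- b)" if D: "D > 0" for D m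
  proof -
    have "\<bar>D powr (- h) * fou_cov r e h D a a' (m * D)\<bar> = D powr (- h) * \<bar>fou_cov r e h D a a' (m * D)\<bar>"
      by (simp add: abs_mult)
    also have "\<dots> \<le> D powr (- h) * (C * D powr (h + b) * (D + \<bar>m * D\<bar>) powr (- b))"
      by (intro mult_left_mono C D) simp
    also have "D + \<bar>m * D\<bar> = D * (1 + \<bar>m\<bar>)" using D by (simp add: abs_mult algebra_simps)
    also have "(D * (1 + \<bar>m\<bar>)) powr (- b) = D powr (- b) * (1 + \<bar>m\<bar>) powr (- b)"
      by (rule powr_mult)
    also have "D powr (- h) * (C * D powr (h + b) * (D powr (- b) * (1 + \<bar>m\<bar>) powr (- b))) =
        C * (1 + \<bar>m\<bar>) powr (- b) * (D powr (- h) * D powr (h + b) * D powr (- b))" by (simp only: mult_ac)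
    also have "D powr (- h) * D powr (h + b) * D powr (- b) = 1" using D by (simp add: powr_add[symmetric])
    finally show ?thesis by simp
  qed
  then show ?thesis using C(1) by blast
qed

lemma scaled_fou_cov_diff:
  assumes D: "D > 0" and d: "\<bar>fou_cov r e h D a a' (m * D) - incr_cov r e h D (m * D)\<bar> \<le> C * D powr (h + b)"
  shows "\<bar>D powr (- h) * fou_cov r e h D a a' (m * D) - incr_cov r e h 1 m\<bar> \<le> C * D powr b"
proof -
  have "incr_cov r e h 1 m = D powr (- h) * incr_cov r e h D (m * D)"
    using incr_cov_scale[OF D, of r e h m] D by (simp add: mult.commute powr_minus field_simps)
  then have "\<bar>D powr (- h) * fou_cov r e h D a a' (m * D) - incr_cov r e h 1 m\<bar> =
      D powr (- h) * \<bar>fou_cov r e h D a a' (m * D) - incr_cov r e h D (m * D)\<bar>"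
    by (simp add: right_diff_distrib[symmetric] abs_mult)
  also have "\<dots> \<le> D powr (- h) * (C * D powr (h + b))" by (intro mult_left_mono d) simp
  also have "\<dots> = C * (D powr (- h) * D powr (h + b))" by simp
  also have "D powr (- h) * D powr (h + b) = D powr b" by (simp add: powr_add[symmetric])
  finally show ?thesis .
qed

text \<open>On the scale of one step the mean reversion disappears, and the limit is the covariance
  of the increments of the fractional Brownian motions over unit time.\<close>

lemma scaled_fou_cov_tendsto:
  assumes h: "0 < h" "h < 2" and a: "a > 0" "a' > 0" and \<Delta>: "\<And>n. \<Delta> n > 0" "\<Delta> \<longlonglongrightarrow> 0"
  shows "(\<lambda>n. \<Delta> n powr (- h) * fou_cov r e h (\<Delta> n) a a' (m * \<Delta> n)) \<longlonglongrightarrow> incr_cov r e h 1 m"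
proof -
  \<comment> \<open>Any positive exponent admissible in \<open>fou_cov_approx_sub\<close> would
    do.\<close>
  define b where "b = min (1 / 2) (2 - h)"
  have b: "0 < b" "b < 1" "b \<le> 2 - h" using h by (auto simp: b_def)
  obtain C where C: "\<And>D x. D > 0 \<Longrightarrow> \<bar>fou_cov r e h D a a' x - incr_cov r e h D x\<bar> \<le> C * D powr (h + b)"
    by (rule fou_cov_approx_sub[OF h less_imp_le[OF b(1)] b(2,3) a, of r e]) (rule that)
  have "(\<lambda>n. \<Delta> n powr b) \<longlonglongrightarrow> 0"
    using \<Delta> b by (intro tendsto_zero_powrI[OF _ tendsto_const]) (auto intro!: always_eventually less_imp_le)
  from tendsto_mult_right_zero[OF this, of C] have "(\<lambda>n. C * \<Delta> n powr b) \<longlonglongrightarrow> 0" .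
  then have "(\<lambda>n. \<Delta> n powr (- h) * fou_cov r e h (\<Delta> n) a a' (m * \<Delta> n) - incr_cov r e h 1 m) \<longlonglongrightarrow> 0"
    by (rule Lim_null_comparison[rotated]) (simp add: scaled_fou_cov_diff[OF \<Delta>(1) C[OF \<Delta>(1)]])
  then show ?thesis by (rule LIM_zero_cancel)
qed

lemma incr_cov_at_0: "incr_cov r e h 1 0 = r"
  by (simp add: incr_cov_def fbm_w_def sign_rc_def)

text \<open>At lag 0 the scaled covariance of the fractional increments is exactly r, so only the
  corrections matter. Both regimes reduce to n times the squared relative error D^b, with b = 1 or b
  = 2 - h. At h = 1 the kernel exponent 2 - h is the borderline 1, covered by neither
  approximation.\<close>

lemma sqrt_scaled_bias_tendsto:
  assumes h: "0 < h" "h < 2" "h \<noteq> 1" and a: "a > 0" "a' > 0" and \<Delta>: "\<And>n. \<Delta> n > 0"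
    and l2: "(\<lambda>n. real n * (\<Delta> n)\<^sup>2) \<longlonglongrightarrow> 0" and lh: "(\<lambda>n. real n * \<Delta> n powr (4 - 2 * h)) \<longlonglongrightarrow> 0"
  shows "(\<lambda>n. sqrt (real n) * (\<Delta> n powr (- h) * fou_cov r e h (\<Delta> n) a a' (0 * \<Delta> n) - r)) \<longlonglongrightarrow> 0"
proof -
  have *: ?thesis if C: "\<And>D x. D > 0 \<Longrightarrow> \<bar>fou_cov r e h D a a' x - incr_cov r e h D x\<bar> \<le> C * D powr (h + b)"
    and l: "(\<lambda>n. real n * (\<Delta> n powr b)\<^sup>2) \<longlonglongrightarrow> 0" for C b
  proof -
    have "(\<lambda>n. C * sqrt (real n * (\<Delta> n powr b)\<^sup>2)) \<longlonglongrightarrow> C * sqrt 0" by (intro tendsto_intros l)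
    then have "(\<lambda>n. C * sqrt (real n * (\<Delta> n powr b)\<^sup>2)) \<longlonglongrightarrow> 0" by simp
    then show ?thesis
    proof (rule Lim_null_comparison[rotated], intro always_eventually allI)
      fix n
      have "norm (sqrt (real n) * (\<Delta> n powr (- h) * fou_cov r e h (\<Delta> n) a a' (0 * \<Delta> n) - r)) =
          sqrt (real n) * \<bar>\<Delta> n powr (- h) * fou_cov r e h (\<Delta> n) a a' (0 * \<Delta> n) - incr_cov r e h 1 0\<bar>"
        by (simp add: abs_mult incr_cov_at_0)
      also have "\<dots> \<le> sqrt (real n) * (C * \<Delta> n powr b)"
        by (intro mult_left_mono scaled_fou_cov_diff[OF \<Delta> C[OF \<Delta>]]) simp
      also have "\<dots> = C * sqrt (real n * (\<Delta> n powr b)\<^sup>2)" by (simp add: real_sqrt_mult)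
      finally show "norm (sqrt (real n) * (\<Delta> n powr (- h) * fou_cov r e h (\<Delta> n) a a' (0 * \<Delta> n) - r)) \<le> C * sqrt (real n * (\<Delta> n powr b)\<^sup>2)" .
    qed
  qed
  show ?thesis
  proof (cases "h < 1")
    case True
    show ?thesis
    proof (rule fou_cov_approx_super[OF h(1) True a, of r e])
      fix C assume C: "\<And>D x. D > 0 \<Longrightarrow> \<bar>fou_cov r e h D a a' x - incr_cov r e h D x\<bar> \<le> C * D powr (h + 1)"
      show ?thesis by (rule *[OF C]) (use l2 \<Delta> in \<open>simp_all add: less_imp_le\<close>)
    qed
  next
    case False
    have b: "0 \<le> 2 - h" "2 - h < 1" "2 - h \<le> 2 - h" using False h by auto
    show ?thesis
    proof (rule fou_cov_approx_sub[OF h(1,2) b a, of r e])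
      fix C assume C: "\<And>D x. D > 0 \<Longrightarrow> \<bar>fou_cov r e h D a a' x - incr_cov r e h D x\<bar> \<le> C * D powr (h + (2 - h))"
      have e: "(\<Delta> n powr (2 - h))\<^sup>2 = \<Delta> n powr (4 - 2 * h)" for n
        by (simp add: power2_eq_square powr_add[symmetric])
      show ?thesis by (rule *[OF C]) (use lh in \<open>simp_all add: e\<close>)
    qed
  qed
qed

lemma real_mult_powr_neg_half: "real n * real n powr (- (1 / 2)) = sqrt (real n)"
proof (cases "n = 0")
  case False
  have "real n * real n powr (- (1 / 2)) = real n powr 1 * real n powr (- (1 / 2))" using False by simp
  also have "\<dots> = real n powr (1 / 2)" by (simp only: powr_add[symmetric]) simp
  finally show ?thesis by (simp add: powr_half_sqrt)
qed simp

text \<open>Lags up to n with decay exponent b sum to order n^(1 - b), and the normalisation removes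
  n^(1/2).\<close>

lemma row_sum_decay:
  fixes \<gamma> :: "real \<Rightarrow> real"
  assumes b: "0 \<le> b" "b < 1" and C: "C \<ge> 0" and g: "\<And>m. \<bar>\<gamma> m\<bar> \<le> C * (1 + \<bar>m\<bar>) powr (- b)" and l: "l < n"
  shows "(\<Sum>k<n. \<bar>real n powr (- (1 / 2)) * \<gamma> (real l - real k)\<bar>) \<le> 2 * C / (1 - b) * real n powr (1 / 2 - b)"
proof -
  have "(\<Sum>k<n. \<bar>real n powr (- (1 / 2)) * \<gamma> (real l - real k)\<bar>) = real n powr (- (1 / 2)) * (\<Sum>k<n. \<bar>\<gamma> (real l - real k)\<bar>)"
    by (simp add: abs_mult sum_distrib_left)
  also have "(\<Sum>k<n. \<bar>\<gamma> (real l - real k)\<bar>) \<le> (\<Sum>k<n. C * (1 + real ((k - l) + (l - k))) powr (- b))"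
  proof (rule sum_mono)
    fix k
    have "\<bar>real l - real k\<bar> = real ((k - l) + (l - k))" by (cases "k \<le> l") (auto simp: of_nat_diff)
    then show "\<bar>\<gamma> (real l - real k)\<bar> \<le> C * (1 + real ((k - l) + (l - k))) powr (- b)"
      using g[of "real l - real k"] by simp
  qed
  also have "\<dots> \<le> 2 * (\<Sum>m<n. C * (1 + real m) powr (- b))"
    by (rule row_sum_le[where f="\<lambda>m. C * (1 + real m) powr (- b)"]) (use C l in auto)
  also have "\<dots> = 2 * C * (\<Sum>m<n. (1 + real m) powr (- b))" by (simp add: sum_distrib_left mult.assoc)
  also have "\<dots> \<le> 2 * C * (real n powr (1 - b) / (1 - b))"
    using C by (intro mult_left_mono sum_powr_le b) simp
  finally have "(\<Sum>k<n. \<bar>real n powr (- (1 / 2)) * \<gamma> (real l - real k)\<bar>) \<le>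
      real n powr (- (1 / 2)) * (2 * C * (real n powr (1 - b) / (1 - b)))"
    by (simp add: mult_left_mono)
  also have "\<dots> = 2 * C / (1 - b) * (real n powr (- (1 / 2)) * real n powr (1 - b))" by simp
  also have "real n powr (- (1 / 2)) * real n powr (1 - b) = real n powr (1 / 2 - b)"
    by (simp add: powr_add[symmetric])
  finally show ?thesis .
qed

theorem theorem6p2p8:
  fixes M :: "'w measure"
    and H \<alpha> \<nu> :: "2 \<Rightarrow> real" and \<rho> :: real and \<eta> :: "2 \<Rightarrow> 2 \<Rightarrow> real"
    and B Y :: "2 \<Rightarrow> real \<Rightarrow> 'w \<Rightarrow> real"
    and \<Delta> :: "nat \<Rightarrow> real"
  assumes "prob_space M"
    and "\<And>i. 0 < H i" and "\<And>i. H i < 1" and "\<And>i. H i \<noteq> 1 / 2"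
    and "H 1 + H 2 < 3 / 2" and "H 1 + H 2 \<noteq> 1"
    and "\<And>i. \<alpha> i > 0" and "\<And>i. \<nu> i > 0"
    and "bivariate_fbm M H \<rho> \<eta> B"
    and "bivariate_fou M \<alpha> \<nu> B Y"
    and "\<And>n. \<Delta> n > 0"
    and "\<Delta> \<longlonglongrightarrow> 0"
    and "filterlim (\<lambda>n. real n * \<Delta> n) at_top sequentially"
    and "(\<lambda>n. real n * (\<Delta> n)\<^sup>2) \<longlonglongrightarrow> 0"
    and "(\<lambda>n. real n * \<Delta> n powr (4 - 2 * (H 1 + H 2))) \<longlonglongrightarrow> 0"
  shows "\<exists>\<sigma>2.
     (\<lambda>n. prob_space.variance M (\<lambda>\<omega>. sqrt (real n) * (rho_estimator H \<nu> \<Delta> Y n \<omega> - \<rho>))) \<longlonglongrightarrow> \<sigma>2 \<and>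
     weak_conv_m (\<lambda>n. distr M borel (\<lambda>\<omega>. sqrt (real n) * (rho_estimator H \<nu> \<Delta> Y n \<omega> - \<rho>)))
       (gaussian_measure 0 \<sigma>2)"
proof -
  note M = assms(1) and H0 = assms(2) and H1 = assms(3) and \<alpha> = assms(7) and \<nu> = assms(8) and \<Delta> = assms(11)
  \<comment> \<open>With these parameters a single formula covers autocovariances and
    cross-covariances.\<close>
  define r where "r i j = (if i = j then 1 else \<rho>)" for i j :: 2
  define e where "e i j = (if i = j then 0 else \<eta> i j)" for i j :: 2
  define h where "h i j = H i + H j" for i j
  have h: "0 < h i j" "h i j < 2" "h i j = h j i" for i j
    using H0[of i] H0[of j] H1[of i] H1[of j] by (auto simp: h_def)
  have h12: "h i j = H 1 + H 2" if "i \<noteq> j" for i j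
    using that exhaust_2[of i] exhaust_2[of j] by (auto simp: h_def)
  have eta: "\<eta> 1 2 = - \<eta> 2 1" using assms(9) by (simp add: bivariate_fbm_def)
  have es: "e j i = - e i j" and rs: "r j i = r i j" for i j
    using exhaust_2[of i] exhaust_2[of j] eta by (auto simp: e_def r_def)
  have fbm: "standard_fbm M (H i) (B i)" for i using assms(9) by (simp add: bivariate_fbm_def)
  have gB: "gauss_fam M (\<lambda>(i, t). B i t) (\<lambda>a b. prob_space.expectation M (\<lambda>\<omega>. (\<lambda>(i, t). B i t) a \<omega> * (\<lambda>(i, t). B i t) b \<omega>))"
  proof (rule gauss_fam_of_gaussian_process[OF M])
    show "gaussian_process M (\<lambda>(i, t). B i t)" using assms(9) by (simp add: bivariate_fbm_def)
    show "prob_space.expectation M ((\<lambda>(i, t). B i t) a) = 0" for a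
      using fbm[of "fst a"] by (simp add: standard_fbm_def case_prod_beta)
  qed
  define p where "p i j s = (if i = j then \<bar>s\<bar> powr (2 * H i) else (\<rho> + sign_rc s * \<eta> i j) * \<bar>s\<bar> powr (H 1 + H 2))" for i j s
  define q where "q i j s = (if i = j then \<bar>s\<bar> powr (2 * H i) else (\<rho> - sign_rc s * \<eta> i j) * \<bar>s\<bar> powr (H 1 + H 2))" for i j s
  have KB: "(\<lambda>a b. prob_space.expectation M (\<lambda>\<omega>. (\<lambda>(i, t). B i t) a \<omega> * (\<lambda>(i, t). B i t) b \<omega>)) (i, s) (j, t) =
      (p i j s + q i j t - fbm_w (r i j) (e i j) (h i j) (t - s)) / 2" for i j s t
  proof (cases "i = j")
    case True
    have "prob_space.expectation M (\<lambda>\<omega>. B i s \<omega> * B i t \<omega>) =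
        (\<bar>s\<bar> powr (2 * H i) + \<bar>t\<bar> powr (2 * H i) - \<bar>t - s\<bar> powr (2 * H i)) / 2"
      using fbm[of i] by (simp add: standard_fbm_def)
    then show ?thesis using True by (simp add: p_def q_def fbm_w_def r_def e_def h_def)
  next
    case False
    have "prob_space.expectation M (\<lambda>\<omega>. B i s \<omega> * B j t \<omega>) =
          ((\<rho> + sign_rc s * \<eta> i j) * \<bar>s\<bar> powr (H 1 + H 2)
           + (\<rho> - sign_rc t * \<eta> i j) * \<bar>t\<bar> powr (H 1 + H 2)
           - (\<rho> - sign_rc (t - s) * \<eta> i j) * \<bar>t - s\<bar> powr (H 1 + H 2)) / 2"
      using assms(9) False by (simp add: bivariate_fbm_def)
    then show ?thesis using False h12[OF False] by (simp add: p_def q_def fbm_w_def r_def e_def)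
  qed
  have Ym: "Y i t \<in> borel_measurable M" for i t using assms(10) by (simp add: bivariate_fou_def)
  have YI: "AE \<omega> in M. \<forall>t. \<exists>I. has_RS_integral_from_minf (\<lambda>u. exp (- \<alpha> i * (t - u))) (\<lambda>u. B i u \<omega>) t I \<and> Y i t \<omega> = \<nu> i * I" for i
    using assms(10) unfolding bivariate_fou_def by blast
  define DY where "DY n = (\<lambda>(i, s) \<omega>. (Y i (s + \<Delta> n) \<omega> - Y i s \<omega>) / \<nu> i)" for n
  have gDY: "gauss_fam M (DY n) (\<lambda>(i, s) (j, t). fou_cov (r i j) (e i j) (h i j) (\<Delta> n) (\<alpha> i) (\<alpha> j) (t - s))" for n
    unfolding DY_def
    by (rule fou_increments_gauss_fam[OF M gauss_fam_increments[OF gB KB] h(1,2) \<alpha> \<nu> \<Delta> Ym YI])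
  define \<gamma> where "\<gamma> n i j m = \<Delta> n powr (- h i j) * fou_cov (r i j) (e i j) (h i j) (\<Delta> n) (\<alpha> i) (\<alpha> j) (m * \<Delta> n)" for n i j m
  have \<gamma>sym: "\<gamma> n i j (- m) = \<gamma> n j i m" for n i j m
    using fou_cov_minus[OF h(1)[of i j] h(2)[of i j] \<alpha>[of i] \<alpha>[of j] \<Delta>[of n], of "r i j" "e i j" "m * \<Delta> n"]
    by (simp add: \<gamma>_def es[of j i] rs[of j i] h(3)[of j i])
  \<comment> \<open>Each factor carries n^(-1/4); the product of two then carries n^(-1/2), which is
    sqrt n times the 1 / n of the estimator.\<close>
  define c where "c n i = real n powr (- (1 / 4)) * \<Delta> n powr (- H i)" for n i
  define Z where "Z n = (\<lambda>(i, k) \<omega>. c n i * DY n (i, real k * \<Delta> n) \<omega>)" for n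
  define K where "K n = (\<lambda>(i, k) (j, l). real n powr (- (1 / 2)) * \<gamma> n i j (real l - real k))" for n
  have cc: "c n i * c n j = real n powr (- (1 / 2)) * \<Delta> n powr (- h i j)" for n i j
  proof -
    have "c n i * c n j = (real n powr (- (1 / 4)) * real n powr (- (1 / 4))) * (\<Delta> n powr (- H i) * \<Delta> n powr (- H j))"
      by (simp add: c_def mult_ac)
    then show ?thesis by (simp add: powr_add[symmetric] h_def)
  qed
  have Z: "gauss_fam M (Z n) (K n)" for n
  proof -
    have "gauss_fam M (\<lambda>a \<omega>. \<Sum>u\<in>{()}. c n (fst a) * DY n (fst a, real (snd a) * \<Delta> n) \<omega>)
      (\<lambda>a b. \<Sum>u\<in>{()}. \<Sum>v\<in>{()}. c n (fst a) * c n (fst b) *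
        (\<lambda>(i, s) (j, t). fou_cov (r i j) (e i j) (h i j) (\<Delta> n) (\<alpha> i) (\<alpha> j) (t - s)) (fst a, real (snd a) * \<Delta> n) (fst b, real (snd b) * \<Delta> n))"
      by (rule gauss_fam_linear[OF gDY]) simp
    moreover have "K n = (\<lambda>a b. c n (fst a) * c n (fst b) * fou_cov (r (fst a) (fst b)) (e (fst a) (fst b)) (h (fst a) (fst b)) (\<Delta> n) (\<alpha> (fst a)) (\<alpha> (fst b)) (real (snd b) * \<Delta> n - real (snd a) * \<Delta> n))"
      by (simp add: K_def fun_eq_iff cc \<gamma>_def left_diff_distrib)
    moreover have "Z n = (\<lambda>a \<omega>. c n (fst a) * DY n (fst a, real (snd a) * \<Delta> n) \<omega>)"
      by (simp add: Z_def fun_eq_iff)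
    ultimately show ?thesis by simp
  qed
  have Ksym: "K n a b = K n b a" for n a b
    using \<gamma>sym[of n "fst a" "fst b" "real (snd a) - real (snd b)"] by (simp add: K_def case_prod_beta)
  \<comment> \<open>The cap must be below 1 and keep \<open>bb 1 1 + bb 2 2\<close> above 1 and both
    cross exponents above 1/2. If it is active for no component, the sum is 4 - 2 (H 1 + H 2) > 1.
    If it is active for one, the bound H i <= bm gives at least 2 - H i > 1 with i the other
    component. If it is active for both, 3/4 <= bm gives at least 3/2.\<close>
  define bm where "bm = max (3 / 4) (max (H 1) (H 2))"
  define bb where "bb i j = min (2 - h i j) bm" for i j
  have bm: "3 / 4 \<le> bm" "bm < 1" "H i \<le> bm" for i
    using H1 exhaust_2[of i] by (auto simp: bm_def)
  have bb: "0 \<le> bb i j" "bb i j < 1" "bb i j \<le> 2 - h i j" for i j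
    using bm h(2)[of i j] by (auto simp: bb_def)
  have b12: "bb 1 2 > 1 / 2" "bb 2 1 > 1 / 2"
    using bm assms(5) by (auto simp: bb_def h_def)
  have b1122: "bb 1 1 + bb 2 2 > 1"
  proof -
    have "2 - 2 * H i + bm > 1" for i using bm(1) bm(3)[of i] H1[of i] by linarith
    then show ?thesis using bm assms(5) by (auto simp: bb_def h_def min_def)
  qed
  \<comment> \<open>The constants are valid for all steps D, hence for all n simultaneously.\<close>
  define P where "P i j C \<longleftrightarrow> C \<ge> 0 \<and> (\<forall>D m. D > 0 \<longrightarrow>
      \<bar>D powr (- h i j) * fou_cov (r i j) (e i j) (h i j) D (\<alpha> i) (\<alpha> j) (m * D)\<bar> \<le> C * (1 + \<bar>m\<bar>) powr (- bb i j))" for i j C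
  define C where "C i j = (SOME C. P i j C)" for i j
  have "P i j (C i j)" for i j
    unfolding C_def using scaled_fou_cov_bound[OF h(1)[of i j] h(2)[of i j] bb(1)[of i j] bb(2)[of i j] bb(3)[of i j] \<alpha>[of i] \<alpha>[of j], of "r i j" "e i j"]
    by (intro someI_ex[of "P i j"]) (auto simp: P_def)
  then have C0: "C i j \<ge> 0" and \<gamma>b: "\<bar>\<gamma> n i j m\<bar> \<le> C i j * (1 + \<bar>m\<bar>) powr (- bb i j)" for n i j m
    using \<Delta> by (auto simp: P_def \<gamma>_def)
  have \<gamma>lim: "(\<lambda>n. \<gamma> n i j m) \<longlonglongrightarrow> incr_cov (r i j) (e i j) (h i j) 1 m" for i j m
    unfolding \<gamma>_def by (rule scaled_fou_cov_tendsto[OF h(1,2) \<alpha> \<alpha> \<Delta> assms(12)])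
  define F where "F n m = \<gamma> n 1 1 (real m) * \<gamma> n 2 2 (real m) + \<gamma> n 1 2 (real m) * \<gamma> n 2 1 (real m)" for n m
  define \<beta> where "\<beta> = min (bb 1 1 + bb 2 2) (bb 1 2 + bb 2 1)"
  have \<beta>: "\<beta> > 1" using b12 b1122 by (auto simp: \<beta>_def)
  have Fb: "\<bar>F n m\<bar> \<le> (C 1 1 * C 2 2 + C 1 2 * C 2 1) * (1 + real m) powr (- \<beta>)" for n m
  proof -
    have pr: "\<bar>\<gamma> n i j (real m) * \<gamma> n i' j' (real m)\<bar> \<le> C i j * C i' j' * (1 + real m) powr (- \<beta>)"
      if "\<beta> \<le> bb i j + bb i' j'" for i j i' j'
    proof -
      have "\<bar>\<gamma> n i j (real m) * \<gamma> n i' j' (real m)\<bar> \<le>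
          (C i j * (1 + real m) powr (- bb i j)) * (C i' j' * (1 + real m) powr (- bb i' j'))"
        unfolding abs_mult using \<gamma>b[of n i j "real m"] \<gamma>b[of n i' j' "real m"] C0 by (intro mult_mono) auto
      also have "\<dots> = C i j * C i' j' * ((1 + real m) powr (- bb i j) * (1 + real m) powr (- bb i' j'))"
        by (simp only: mult_ac)
      also have "(1 + real m) powr (- bb i j) * (1 + real m) powr (- bb i' j') = (1 + real m) powr (- (bb i j + bb i' j'))"
        by (simp add: powr_add[symmetric])
      also have "C i j * C i' j' * (1 + real m) powr (- (bb i j + bb i' j')) \<le> C i j * C i' j' * (1 + real m) powr (- \<beta>)"
        using that C0 by (intro mult_left_mono powr_mono) auto
      finally show ?thesis .
    qed
    have "\<bar>F n m\<bar> \<le> \<bar>\<gamma> n 1 1 (real m) * \<gamma> n 2 2 (real m)\<bar> + \<bar>\<gamma> n 1 2 (real m) * \<gamma> n 2 1 (real m)\<bar>"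
      unfolding F_def by (rule abs_triangle_ineq)
    also have "\<dots> \<le> C 1 1 * C 2 2 * (1 + real m) powr (- \<beta>) + C 1 2 * C 2 1 * (1 + real m) powr (- \<beta>)"
      by (intro add_mono pr) (auto simp: \<beta>_def)
    finally show ?thesis by (simp add: distrib_right)
  qed
  have "\<exists>s. (\<lambda>n. (\<Sum>k<n. \<Sum>l<n. F n ((k - l) + (l - k))) / real n) \<longlonglongrightarrow> s"
  proof (rule toeplitz_mean_tendsto[OF Fb \<beta>])
    show "C 1 1 * C 2 2 + C 1 2 * C 2 1 \<ge> 0" using C0 by (intro add_nonneg_nonneg mult_nonneg_nonneg)
    show "(\<lambda>n. F n m) \<longlonglongrightarrow> incr_cov (r 1 1) (e 1 1) (h 1 1) 1 (real m) * incr_cov (r 2 2) (e 2 2) (h 2 2) 1 (real m) +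
       incr_cov (r 1 2) (e 1 2) (h 1 2) 1 (real m) * incr_cov (r 2 1) (e 2 1) (h 2 1) 1 (real m)" for m
      unfolding F_def by (intro tendsto_intros \<gamma>lim)
  qed
  then obtain s where s: "(\<lambda>n. (\<Sum>k<n. \<Sum>l<n. F n ((k - l) + (l - k))) / real n) \<longlonglongrightarrow> s" ..
  have hh: "real n powr (- (1 / 2)) * real n powr (- (1 / 2)) = 1 / real n" for n
  proof -
    have "real n powr (- (1 / 2)) * real n powr (- (1 / 2)) = real n powr (- (1 / 2) + - (1 / 2))"
      by (rule powr_add[symmetric])
    also have "- (1 / 2) + - (1 / 2) = - (1 :: real)" by simp
    also have "real n powr - 1 = 1 / real n" by (simp add: powr_minus_divide)
    finally show ?thesis .
  qed
  have V: "(\<Sum>k<n. \<Sum>l<n. K n (1, k) (1, l) * K n (2, k) (2, l) + K n (1, k) (2, l) * K n (2, k) (1, l)) =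
      (\<Sum>k<n. \<Sum>l<n. F n ((k - l) + (l - k))) / real n" for n
  proof -
    have "K n (1, k) (1, l) * K n (2, k) (2, l) + K n (1, k) (2, l) * K n (2, k) (1, l) = F n ((k - l) + (l - k)) / real n" for k l
    proof -
      define x where "x = real l - real k"
      have "K n (1, k) (1, l) * K n (2, k) (2, l) + K n (1, k) (2, l) * K n (2, k) (1, l) =
         (real n powr (- (1 / 2)) * real n powr (- (1 / 2))) * (\<gamma> n 1 1 x * \<gamma> n 2 2 x + \<gamma> n 1 2 x * \<gamma> n 2 1 x)"
        unfolding K_def x_def prod.case by (simp only: distrib_left mult_ac)
      \<comment> \<open>The expression is even in the lag: reversing it swaps the two
        cross-covariances, which enter only through their product.\<close>
      also have "\<gamma> n 1 1 x * \<gamma> n 2 2 x + \<gamma> n 1 2 x * \<gamma> n 2 1 x = F n ((k - l) + (l - k))"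
      proof (cases "k \<le> l")
        case True
        then have "x = real ((k - l) + (l - k))" by (simp add: x_def of_nat_diff)
        then show ?thesis by (simp add: F_def)
      next
        case False
        then have "x = - real ((k - l) + (l - k))" by (simp add: x_def of_nat_diff)
        then show ?thesis by (simp only: F_def \<gamma>sym mult.commute)
      qed
      finally show ?thesis unfolding hh by simp
    qed
    then show ?thesis by (simp only: sum_divide_distrib[symmetric])
  qed
  define T where "T n \<omega> = sqrt (real n) * (rho_estimator H \<nu> \<Delta> Y n \<omega> - \<rho>)" for n \<omega>
  define gg where "gg i j n = 2 * C i j / (1 - bb i j) * real n powr (1 / 2 - bb i j)" for i j n
  have gg0: "gg i j n \<ge> 0" for i j n using C0[of i j] bb(2)[of i j] by (simp add: gg_def)
  have row: "(\<Sum>k<n. \<bar>K n (i, k) (j, l)\<bar>) \<le> gg i j n" if "l < n" for n i j l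
    using row_sum_decay[OF bb(1,2) C0 \<gamma>b that] by (simp add: K_def gg_def)
  have neg: "(\<lambda>n. real n powr x) \<longlonglongrightarrow> 0" if "x < 0" for x
    using that by (intro tendsto_neg_powr filterlim_real_sequentially)
  \<comment> \<open>One of \<open>gg 1 1\<close> and \<open>gg 2 2\<close> may diverge; only their
    product, with the power 1 - bb 1 1 - bb 2 2 of n, is sure to vanish.\<close>
  have glim: "(\<lambda>n. (gg 1 2 n + gg 2 1 n) + sqrt (gg 1 1 n * gg 2 2 n)) \<longlonglongrightarrow> 0"
  proof -
    have "(\<lambda>n. gg 1 2 n) \<longlonglongrightarrow> 2 * C 1 2 / (1 - bb 1 2) * 0" "(\<lambda>n. gg 2 1 n) \<longlonglongrightarrow> 2 * C 2 1 / (1 - bb 2 1) * 0"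
      unfolding gg_def using b12 by (intro tendsto_mult tendsto_const neg; simp)+
    moreover have "(\<lambda>n. (2 * C 1 1 / (1 - bb 1 1)) * (2 * C 2 2 / (1 - bb 2 2)) * real n powr (1 - bb 1 1 - bb 2 2)) \<longlonglongrightarrow>
        (2 * C 1 1 / (1 - bb 1 1)) * (2 * C 2 2 / (1 - bb 2 2)) * 0"
      using b1122 by (intro tendsto_mult tendsto_const neg) simp
    moreover have "gg 1 1 n * gg 2 2 n = (2 * C 1 1 / (1 - bb 1 1)) * (2 * C 2 2 / (1 - bb 2 2)) * real n powr (1 - bb 1 1 - bb 2 2)" for n
    proof -
      have "gg 1 1 n * gg 2 2 n = (2 * C 1 1 / (1 - bb 1 1)) * (2 * C 2 2 / (1 - bb 2 2)) * (real n powr (1 / 2 - bb 1 1) * real n powr (1 / 2 - bb 2 2))"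
        unfolding gg_def by (simp only: mult_ac)
      then show ?thesis by (simp add: powr_add[symmetric] algebra_simps)
    qed
    ultimately have "(\<lambda>n. gg 1 2 n) \<longlonglongrightarrow> 0" "(\<lambda>n. gg 2 1 n) \<longlonglongrightarrow> 0" "(\<lambda>n. gg 1 1 n * gg 2 2 n) \<longlonglongrightarrow> 0" by simp_all
    then have "(\<lambda>n. (gg 1 2 n + gg 2 1 n) + sqrt (gg 1 1 n * gg 2 2 n)) \<longlonglongrightarrow> (0 + 0) + sqrt 0"
      by (intro tendsto_intros)
    then show ?thesis by simp
  qed
  have Teq: "T n \<omega> = (\<Sum>k<n. Z n (1, k) \<omega> * Z n (2, k) \<omega>) + (- sqrt (real n) * \<rho>)" for n \<omega>
  proof -
    \<comment> \<open>For n = 0 both sides are 0, by the conventions for division by 0 and for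
      powers of 0.\<close>
    have sn: "sqrt (real n) / real n = real n powr (- (1 / 2))"
      by (cases "n = 0") (simp_all add: real_mult_powr_neg_half[symmetric])
    define d where "d i k = Y i (real (k + 1) * \<Delta> n) \<omega> - Y i (real k * \<Delta> n) \<omega>" for i :: 2 and k
    have "Z n (1, k) \<omega> * Z n (2, k) \<omega> = (c n 1 * c n 2) / (\<nu> 1 * \<nu> 2) * (d 1 k * d 2 k)" for k
    proof -
      have "real k * \<Delta> n + \<Delta> n = real (k + 1) * \<Delta> n" by (simp add: distrib_right)
      then show ?thesis by (simp add: Z_def DY_def d_def)
    qed
    then have "(\<Sum>k<n. Z n (1, k) \<omega> * Z n (2, k) \<omega>) = (c n 1 * c n 2) / (\<nu> 1 * \<nu> 2) * (\<Sum>k<n. d 1 k * d 2 k)"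
      by (simp add: sum_distrib_left)
    also have "(c n 1 * c n 2) / (\<nu> 1 * \<nu> 2) = sqrt (real n) * (1 / (\<nu> 1 * \<nu> 2 * real n * \<Delta> n powr (H 1 + H 2)))"
      unfolding cc sn[symmetric] using powr_minus[of "\<Delta> n" "H 1 + H 2"] by (simp add: h_def divide_inverse mult_ac)
    finally show ?thesis
      by (simp add: T_def rho_estimator_def d_def right_diff_distrib)
  qed
  have bias: "(\<lambda>n. (\<Sum>k<n. K n (1, k) (2, k)) + (- sqrt (real n) * \<rho>)) \<longlonglongrightarrow> 0"
  proof -
    have "(\<Sum>k<n. K n (1, k) (2, k)) + (- sqrt (real n) * \<rho>) = sqrt (real n) * (\<gamma> n 1 2 0 - \<rho>)" for n
      by (simp add: K_def real_mult_powr_neg_half[symmetric] right_diff_distrib)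
    moreover have "(\<lambda>n. sqrt (real n) * (\<gamma> n 1 2 0 - \<rho>)) \<longlonglongrightarrow> 0"
    proof -
      have "h 1 2 \<noteq> 1" "(\<lambda>n. real n * \<Delta> n powr (4 - 2 * h 1 2)) \<longlonglongrightarrow> 0" "r 1 2 = \<rho>"
        using assms(6,15) by (auto simp: h_def r_def)
      then show ?thesis
        using sqrt_scaled_bias_tendsto[OF h(1)[of 1 2] h(2)[of 1 2] _ \<alpha>[of 1] \<alpha>[of 2] \<Delta> assms(14), of "r 1 2" "e 1 2"] by (simp add: \<gamma>_def)
    qed
    ultimately show ?thesis by simp
  qed
  have T: "(\<lambda>n. prob_space.variance M (T n)) \<longlonglongrightarrow> s" "weak_conv_m (\<lambda>n. distr M borel (T n)) (gaussian_measure 0 s)"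
  proof -
    \<comment> \<open>The limit theorem takes one bound for the two kinds of cross rows, hence the
      sum.\<close>
    have row12: "(\<Sum>k<n. \<bar>K n (1, k) (2, l)\<bar>) \<le> gg 1 2 n + gg 2 1 n" "(\<Sum>k<n. \<bar>K n (2, k) (1, l)\<bar>) \<le> gg 1 2 n + gg 2 1 n" if "l < n" for n l
      using row[OF that, of 1 2] row[OF that, of 2 1] gg0[of 1 2 n] gg0[of 2 1 n] by linarith+
    have Vl: "(\<lambda>n. \<Sum>k<n. \<Sum>l<n. K n (1, k) (1, l) * K n (2, k) (2, l) + K n (1, k) (2, l) * K n (2, k) (1, l)) \<longlonglongrightarrow> s"
      unfolding V by (rule s)
    note clt = gauss_quadratic_clt[where x="\<lambda>n k. (1, k)" and y="\<lambda>n k. (2, k)" and ?g11.0="gg 1 1" and ?g22.0="gg 2 2"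
        and ?g12.0="\<lambda>n. gg 1 2 n + gg 2 1 n", OF M Z Ksym Teq bias Vl gg0 gg0 add_nonneg_nonneg[OF gg0 gg0] row row row12 glim]
    show "(\<lambda>n. prob_space.variance M (T n)) \<longlonglongrightarrow> s" by (rule clt(1))
    show "weak_conv_m (\<lambda>n. distr M borel (T n)) (gaussian_measure 0 s)" by (rule clt(2))
  qed
  then show ?thesis unfolding T_def by blast
qed

end
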